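(* For every $\varepsilon>0$ there exist $\delta>0$ and $N_0$ such that for every $n\ge N_0$ the following holds. If $\mathcal H$ is an $n$-vertex $C_5^{3-}$-free $3$-graph with at least $\frac14\binom{n}{3}-\delta n^3$ edges, then one can remove at most $\varepsilon n^3$ edges from $\mathcal H$ so that the resulting $3$-graph is a $T_{\mathrm{rec}}$-subconstruction.
   Context: $C_5^{3-}$ is the $3$-graph on $\{1,\dots,5\}$ with edges $\{1,2,3\},\{2,3,4\},\{3,4,5\},\{4,5,1\}$; a $3$-graph is $C_5^{3-}$-free if it contains no copy of $C_5^{3-}$ as a subgraph. For pairwise disjoint sets $V_1,V_2,V_3$, $\mathcal K[V_1,V_2,V_3]$ is the complete $3$-partite $3$-graph consisting of all triples with exactly one vertex in each $V_i$. $T_{\mathrm{rec}}$-constructions are defined recursively: for $n\in\{0,1,2\}$ the $n$-vertex $T_{\mathrm{rec}}$-construction is the empty $3$-graph on $n$ vertices; for $n\ge 3$, an $n$-vertex $3$-graph is a $T_{\mathrm{rec}}$-construction if its vertex set has a partition $V_1\cup V_2\cup V_3$ into non-empty parts such that it is obtained from $\mathcal K[V_1,V_2,V_3]$ by adding, inside each $V_i$, a $T_{\mathrm{rec}}$-construction on $V_i$. A $T_{\mathrm{rec}}$-subconstruction is a subgraph of some $T_{\mathrm{rec}}$-construction (on the same vertex set). *)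

theory Defs
  imports Complex_Main
begin

text \<open>A 3-graph is given by its vertex set \<open>V\<close> together with its edge set \<open>E\<close>.\<close>

definition three_graph :: "'a set \<Rightarrow> 'a set set \<Rightarrow> bool" where
  "three_graph V E \<longleftrightarrow> finite V \<and> (\<forall>e\<in>E. e \<subseteq> V \<and> card e = 3)"

text \<open>A copy need not be induced: \<open>(W, F)\<close> is embedded in \<open>(V, E)\<close> injectively on vertices.\<close>

definition contains_copy :: "'b set \<Rightarrow> 'b set set \<Rightarrow> 'a set \<Rightarrow> 'a set set \<Rightarrow> bool" where
  "contains_copy W F V E \<longleftrightarrow>
     (\<exists>f. inj_on f W \<and> f ` W \<subseteq> V \<and> (\<forall>e\<in>F. f ` e \<in> E))"

definition C5_minus_edges :: "nat set set" where
  "C5_minus_edges = {{1, 2, 3}, {2, 3, 4}, {3, 4, 5}, {4, 5, 1}}"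

definition C5_minus_free :: "'a set \<Rightarrow> 'a set set \<Rightarrow> bool" where
  "C5_minus_free V E \<longleftrightarrow> \<not> contains_copy {1..5} C5_minus_edges V E"

definition complete_3partite :: "'a set \<Rightarrow> 'a set \<Rightarrow> 'a set \<Rightarrow> 'a set set" where
  "complete_3partite V1 V2 V3 = {{x, y, z} | x y z. x \<in> V1 \<and> y \<in> V2 \<and> z \<in> V3}"

text \<open>In the second rule the union of the three parts automatically has at least 3 vertices.\<close>

inductive T_rec_construction :: "'a set \<Rightarrow> 'a set set \<Rightarrow> bool" where
  small: "finite V \<Longrightarrow> card V \<le> 2 \<Longrightarrow> T_rec_construction V {}"
| step: "V1 \<noteq> {} \<Longrightarrow> V2 \<noteq> {} \<Longrightarrow> V3 \<noteq> {} \<Longrightarrow>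
     V1 \<inter> V2 = {} \<Longrightarrow> V1 \<inter> V3 = {} \<Longrightarrow> V2 \<inter> V3 = {} \<Longrightarrow>
     T_rec_construction V1 E1 \<Longrightarrow> T_rec_construction V2 E2 \<Longrightarrow> T_rec_construction V3 E3 \<Longrightarrow>
     T_rec_construction (V1 \<union> V2 \<union> V3) (complete_3partite V1 V2 V3 \<union> E1 \<union> E2 \<union> E3)"

definition T_rec_subconstruction :: "'a set \<Rightarrow> 'a set set \<Rightarrow> bool" where
  "T_rec_subconstruction V E \<longleftrightarrow> (\<exists>E'. T_rec_construction V E' \<and> E \<subseteq> E')"

end

theory Submission
  imports Defs "HOL-Library.FuncSet"
begin

text \<open>
  Write $T$ for the number of ordered edges, let $n$ be the number of vertices and let $\varrho \ge 1/4$ be the extremal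
  density. A triple of vertices has at most one centre of a $K_4^-$, so a $C_5^{3-}$-free graph has only $O(n^3)$ copies
  of $K_4^-$.

  A flag-algebra certificate on six vertices, which also uses that the link of every pair spans density at most
  $\varrho$, yields an edge $abc$ of a nearly extremal graph whose three common neighbourhoods form an almost complete
  tripartition of almost all vertices. If $v$ is in one part and $vbb'$ is an edge with $b, b'$ in another part, then
  forbidding $C_5^{3-}$ forces $vb$ to miss most of the third part; hence every vertex gains fewer badly placed edges
  than it loses transversal ones, even a vertex that fits badly into all parts. Comparing
  $T \le \varrho(a^3 + b^3 + c^3) + 6abc$ minus the losses with $T \ge (\varrho - o(1)) n^3$ gives $\varrho = 1/4$ and
  shows that all losses are $o(n^3)$. So a nearly extremal graph is a complete tripartite graph with nearly extremal
  graphs inside the parts, up to $o(n^3)$ edges, and iterating this proves stability.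
\<close>

section \<open>A six-vertex inequality\<close>

text \<open>The certificate is written for the value 1/4 before the extremal density is known. If
  the density were (1 + \<open>\<theta>\<close>)/4, the link term could lose up to 972391
  \<open>\<theta>\<close>/6, as the cubed codegrees sum to about n^5/6 at most, while the density
  term gains 244451 \<open>\<theta>\<close>. The gain is larger, so one integer certificate serves
  every possible density. The value 1/4 appears only when parts are compared: (n^3 - p^3 - q^3 -
  r^3)/4 is at least 6pqr for parts of sizes p, q, r.

  Copies of K_4^- are not removed. A 6-tuple containing one is determined by five of its entries, so
  such tuples only add an O(n^5) error, and the certificate has to be checked on just 55 graphs.

  No minimum degree is available, so a vertex that fits nowhere cannot be discarded. It is put into
  the part opposite the pair of parts where its link is densest. That it then still falls short of a
  perfect transversal vertex by a fixed multiple of n^2 is the tightest estimate of the proof and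
  dictates most numerical constants.\<close>

datatype ix = I0 | I1 | I2 | I3 | I4 | I5

text \<open>
  The coefficients below are a rounded solution of a semidefinite program. For a root $a,b,c,d$ the six arguments of
  a flag tell whether an extra vertex $u$ forms an edge with $ab$, $ac$, $bc$, $ad$, $bd$, $cd$; for a root $a,b$ the
  four arguments tell whether $abc$, $abd$, $acd$, $bcd$ are edges.
\<close>

definition flag_i :: "bool \<Rightarrow> bool \<Rightarrow> bool \<Rightarrow> bool \<Rightarrow> bool \<Rightarrow> bool \<Rightarrow> int" where
  "flag_i p q r x y z = (if p \<or> q \<or> r
     then if p \<and> z \<or> q \<and> y \<or> r \<and> x then 31 else if x \<or> y \<or> z then 25 else - 44
     else if x \<and> y \<and> z then 60 else if x \<and> y \<or> x \<and> z \<or> y \<and> z then 28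
     else if x \<or> y \<or> z then 1 else - 19)"

text \<open>On free patterns \<open>flag_s\<close> and \<open>flag_t\<close> change sign when b and
  c are exchanged, while \<open>flag_i\<close> is symmetric in a, b, c; the semidefinite program is
  split by such symmetries. The order of the tests relies on freeness: with abc an edge,
  \<open>p\<close> and \<open>q\<close> together would already form a K_4^-.\<close>

definition flag_s :: "bool \<Rightarrow> bool \<Rightarrow> bool \<Rightarrow> bool \<Rightarrow> bool \<Rightarrow> bool \<Rightarrow> int" where
  "flag_s p q r x y z = (if p then if x then 16 else if y then 49 else if z then - 59 else 15
     else if q then if x then - 16 else if z then - 49 else if y then 59 else - 15
     else if r then if y then 30 else if z then - 30 else 0
     else if y then if z then 0 else if x then 40 else 21
     else if z then if x then - 40 else - 21 else 0)"

definition flag_t :: "bool \<Rightarrow> bool \<Rightarrow> bool \<Rightarrow> bool \<Rightarrow> bool \<Rightarrow> bool \<Rightarrow> int" where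
  "flag_t p q r x y z = (if p then if x then 50 else if y then 40 else if z then 61 else 18
     else if q then if x then - 50 else if z then - 40 else if y then - 61 else - 18
     else if r then if y then - 9 else if z then 9 else 0
     else if y then if z then 0 else if x then 20 else 4
     else if z then if x then - 20 else - 4 else 0)"

definition flag_z0 :: "bool \<Rightarrow> bool \<Rightarrow> bool \<Rightarrow> bool \<Rightarrow> int" where
  "flag_z0 p q x y = (if x \<and> y then if p \<and> q then 14 else if p \<or> q then 20 else 66
     else if p \<and> q then 15 else if p \<or> q then 6 else 29)"

text \<open>Antisymmetric under the exchange of c and d, which swaps \<open>q\<close> with
  \<open>x\<close> and \<open>r\<close> with \<open>y\<close>. In the same way \<open>flag_r\<close>
  below changes sign when the two roots are exchanged, and \<open>flag_y\<close>,
  \<open>flag_y'\<close> are symmetric.\<close>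

definition flag_z :: "bool \<Rightarrow> bool \<Rightarrow> bool \<Rightarrow> bool \<Rightarrow> bool \<Rightarrow> bool \<Rightarrow> int" where
  "flag_z p q r x y z = (if x \<or> r
     then if q \<or> y then if q \<and> y then if x \<and> r then 0 else - 6 else if x \<and> r then 6 else 0
          else flag_z0 p z x r
     else if q \<or> y then - flag_z0 p z q y else 0)"

definition flag_y :: "bool \<Rightarrow> bool \<Rightarrow> bool \<Rightarrow> bool \<Rightarrow> int" where
  "flag_y p q x y = (if p then if q then - 43 else if x \<or> y then 28 else - 19
     else if q then if x \<or> y then 28 else - 19 else if x then if y then 60 else 5 else if y then 5 else - 20)"

definition flag_y' :: "bool \<Rightarrow> bool \<Rightarrow> bool \<Rightarrow> bool \<Rightarrow> int" where
  "flag_y' p q x y = (if p then if q then - 61 else if x \<or> y then 4 else 12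
     else if q then if x \<or> y then 4 else 12 else if x then if y then - 36 else 5 else if y then 5 else 12)"

definition flag_r :: "bool \<Rightarrow> bool \<Rightarrow> bool \<Rightarrow> bool \<Rightarrow> int" where
  "flag_r p q x y = (if x then if y then 0 else if p \<or> q then 25 else 59
     else if y then if p \<or> q then - 25 else - 59 else 0)"

definition nb :: "('v \<Rightarrow> 'v \<Rightarrow> 'v \<Rightarrow> bool) \<Rightarrow> 'v \<Rightarrow> 'v \<Rightarrow> 'v \<Rightarrow> 'v \<Rightarrow> bool" where
  "nb h a b c t \<longleftrightarrow> h a b t \<or> h a c t \<or> h b c t"

definition \<phi>1 :: "('v \<Rightarrow> 'v \<Rightarrow> 'v \<Rightarrow> bool) \<Rightarrow> 'v \<Rightarrow> 'v \<Rightarrow> 'v \<Rightarrow> 'v \<Rightarrow> 'v \<Rightarrow> 'v \<Rightarrow> int" where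
  "\<phi>1 h a b c d u v = (if h a b c then
      (if nb h a b c d then (if nb h a b c u \<and> nb h a b c v then 5000 else 0) - 27
       else 18 + (if nb h a b c u then if nb h a b c v then 1960 else - 840
                  else if nb h a b c v then - 840 else 360))
      - (if h b c d \<and> h a c u \<and> h a b v \<and> h d u v then 135000 else 0) else 0)"

definition \<phi>2 :: "('v \<Rightarrow> 'v \<Rightarrow> 'v \<Rightarrow> bool) \<Rightarrow> 'v \<Rightarrow> 'v \<Rightarrow> 'v \<Rightarrow> 'v \<Rightarrow> 'v \<Rightarrow> 'v \<Rightarrow> int" where
  "\<phi>2 h a b c d u v = (if h a b c \<and> h a b d \<and> h a b u then if h c d u then - 3 else 1 else 0)"

definition \<phi>3 :: "('v \<Rightarrow> 'v \<Rightarrow> 'v \<Rightarrow> bool) \<Rightarrow> 'v \<Rightarrow> 'v \<Rightarrow> 'v \<Rightarrow> 'v \<Rightarrow> 'v \<Rightarrow> 'v \<Rightarrow> int" where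
  "\<phi>3 h a b c d u v = (if h a b c then 4 else 0)"

abbreviation (input) on6 where
  "on6 f h a b c d u \<equiv> f (h a b u) (h a c u) (h b c u) (h a d u) (h b d u) (h c d u)"

definition sq1 where
  "sq1 f h a b c d u v = (if h a b c then if h a b d \<or> h a c d \<or> h b c d then 0
      else on6 f h a b c d u * on6 f h a b c d v else 0 :: int)"

definition sq0 where
  "sq0 f h a b c d u v = (if h a b c \<or> h a b d \<or> h a c d \<or> h b c d then 0
      else on6 f h a b c d u * on6 f h a b c d v :: int)"

definition sq2 where
  "sq2 f h a b c d u v = (f (h a b c) (h a b d) (h a c d) (h b c d) * f (h a b u) (h a b v) (h a u v) (h b u v) :: int)"

definition \<Phi> :: "('v \<Rightarrow> 'v \<Rightarrow> 'v \<Rightarrow> bool) \<Rightarrow> 'v \<Rightarrow> 'v \<Rightarrow> 'v \<Rightarrow> 'v \<Rightarrow> 'v \<Rightarrow> 'v \<Rightarrow> int" where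
  "\<Phi> h a b c d u v = 100 * \<phi>1 h a b c d u v + 972391 * \<phi>2 h a b c d u v + 244451 * \<phi>3 h a b c d u v - 244451
     + 620 * sq1 flag_i h a b c d u v + 2044 * sq1 flag_s h a b c d u v + 1668 * sq1 flag_t h a b c d u v
     + 631 * sq0 flag_z h a b c d u v
     + 585 * sq2 flag_y h a b c d u v + 72 * sq2 flag_y' h a b c d u v + 412 * sq2 flag_r h a b c d u v"

text \<open>
  For an edge $abc$, \<open>\<phi>1\<close> is the term that detects the tripartition; \<open>\<phi>2\<close> and \<open>\<phi>3\<close> compare the density inside the
  link of a pair and of the whole graph with $1/4$; the remaining terms sum to squares.
\<close>

definition S6 :: "(ix \<Rightarrow> ix \<Rightarrow> ix \<Rightarrow> ix \<Rightarrow> ix \<Rightarrow> ix \<Rightarrow> int) \<Rightarrow> int" where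
  "S6 G = (\<Sum>\<pi>\<in>{\<pi>. bij \<pi>}. G (\<pi> I0) (\<pi> I1) (\<pi> I2) (\<pi> I3) (\<pi> I4) (\<pi> I5))"

lemma all_ix: "(\<forall>i. P i) \<longleftrightarrow> P I0 \<and> P I1 \<and> P I2 \<and> P I3 \<and> P I4 \<and> P I5"
  by (metis ix.exhaust)

lemma UNIV_ix: "(UNIV :: ix set) = {I0, I1, I2, I3, I4, I5}"
  by (auto intro: ix.exhaust)

instance ix :: finite
  by standard (simp add: UNIV_ix)

lemma bij_case_ix:
  assumes "distinct [a, b, c, d, u, v]"
  shows "bij (case_ix a b c d u v :: ix \<Rightarrow> ix)"
proof -
  have "inj (case_ix a b c d u v :: ix \<Rightarrow> ix)"
    using assms by (auto simp: inj_def all_ix)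
  then show ?thesis
    by (simp add: bij_def finite_UNIV_inj_surj)
qed

lemma S6_nested:
  "S6 G = (\<Sum>a\<in>UNIV. \<Sum>b\<in>UNIV - {a}. \<Sum>c\<in>UNIV - {a, b}. \<Sum>d\<in>UNIV - {a, b, c}.
     \<Sum>u\<in>UNIV - {a, b, c, d}. \<Sum>v\<in>UNIV - {a, b, c, d, u}. G a b c d u v)"
proof -
  have "S6 G = (\<Sum>(a, b, c, d, u, v)\<in>(SIGMA a:UNIV. SIGMA b:UNIV - {a}. SIGMA c:UNIV - {a, b}.
     SIGMA d:UNIV - {a, b, c}. SIGMA u:UNIV - {a, b, c, d}. UNIV - {a, b, c, d, u}). G a b c d u v)"
    unfolding S6_def
  proof (rule sum.reindex_bij_witness
      [of _ "\<lambda>(a, b, c, d, u, v). case_ix a b c d u v" "\<lambda>\<pi>. (\<pi> I0, \<pi> I1, \<pi> I2, \<pi> I3, \<pi> I4, \<pi> I5)"], goal_cases)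
    case (1 p)
    then show ?case by (auto simp: fun_eq_iff all_ix)
  next
    case (2 p)
    then have "inj p" by (simp add: bij_def)
    then show ?case by (auto simp: inj_def all_ix)
  next
    case (4 q)
    then show ?case by (auto intro!: bij_case_ix)
  qed (auto simp: fun_eq_iff all_ix)
  then show ?thesis
    by (simp add: sum.Sigma split_def)
qed

text \<open>Fully explicit sums over all orders, choosing one vertex at a time, so that evaluating
  \<open>S6\<close> at a concrete graph is pure rewriting.\<close>

definition "P2 f x y = f x y + (f y x :: int)"
definition "P3 f x y z = P2 (f x) y z + (P2 (f y) x z + P2 (f z) x y)"
definition "P4 f w x y z = P3 (f w) x y z + (P3 (f x) w y z + (P3 (f y) w x z + P3 (f z) w x y))"
definition "P5 f v w x y z = P4 (f v) w x y z + (P4 (f w) v x y z + (P4 (f x) v w y z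
  + (P4 (f y) v w x z + P4 (f z) v w x y)))"
definition "P6 f u v w x y z = P5 (f u) v w x y z + (P5 (f v) u w x y z + (P5 (f w) u v x y z
  + (P5 (f x) u v w y z + (P5 (f y) u v w x z + P5 (f z) u v w x y))))"

lemmas P_defs = P6_def P5_def P4_def P3_def P2_def

lemma S6_expand: "S6 G = P6 G I0 I1 I2 I3 I4 I5"
  unfolding S6_nested
  by (simp add: UNIV_ix insert_Diff_if P_defs)

lemma card_bij_ix: "int (card {\<pi> :: ix \<Rightarrow> ix. bij \<pi>}) = 720"
proof -
  have "int (card {\<pi> :: ix \<Rightarrow> ix. bij \<pi>}) = S6 (\<lambda>_ _ _ _ _ _. 1)"
    by (simp add: S6_def)
  also have "\<dots> = 720"
    by (simp add: S6_expand P_defs)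
  finally show ?thesis .
qed

text \<open>Separating the summands before evaluation lets each one be expanded through its own
  conditionals only. The constant is 720 * 244451.\<close>

lemma S6_\<Phi>:
  "S6 (\<Phi> g) = - 176004720 + 100 * S6 (\<phi>1 g) + 972391 * S6 (\<phi>2 g) + 244451 * S6 (\<phi>3 g)
     + 620 * S6 (sq1 flag_i g) + 2044 * S6 (sq1 flag_s g) + 1668 * S6 (sq1 flag_t g) + 631 * S6 (sq0 flag_z g)
     + 585 * S6 (sq2 flag_y g) + 72 * S6 (sq2 flag_y' g) + 412 * S6 (sq2 flag_r g)"
  using card_bij_ix by (simp add: S6_def \<Phi>_def sum.distrib sum_subtractf sum_distrib_left)

section \<open>Canonical labellings of the free graphs on six vertices\<close>

definition sym3 :: "('v \<Rightarrow> 'v \<Rightarrow> 'v \<Rightarrow> bool) \<Rightarrow> bool" where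
  "sym3 g \<longleftrightarrow> (\<forall>a b c. g a b c = g b a c \<and> g a b c = g a c b)"

definition bits :: "(ix \<Rightarrow> ix \<Rightarrow> ix \<Rightarrow> bool) \<Rightarrow> bool list" where
  "bits g = [
    g I0 I1 I2, g I0 I1 I3, g I0 I2 I3, g I1 I2 I3, g I0 I1 I4, g I0 I2 I4, g I1 I2 I4,
    g I0 I3 I4, g I1 I3 I4, g I2 I3 I4, g I0 I1 I5, g I0 I2 I5, g I1 I2 I5, g I0 I3 I5,
    g I1 I3 I5, g I2 I3 I5, g I0 I4 I5, g I1 I4 I5, g I2 I4 I5, g I3 I4 I5]"

lemma sym3_ix:
  assumes "sym3 g"
  shows
    "g I0 I2 I1 = g I0 I1 I2" "g I1 I0 I2 = g I0 I1 I2" "g I1 I2 I0 = g I0 I1 I2"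
    "g I2 I0 I1 = g I0 I1 I2" "g I2 I1 I0 = g I0 I1 I2" "g I0 I3 I1 = g I0 I1 I3"
    "g I1 I0 I3 = g I0 I1 I3" "g I1 I3 I0 = g I0 I1 I3" "g I3 I0 I1 = g I0 I1 I3"
    "g I3 I1 I0 = g I0 I1 I3" "g I0 I3 I2 = g I0 I2 I3" "g I2 I0 I3 = g I0 I2 I3"
    "g I2 I3 I0 = g I0 I2 I3" "g I3 I0 I2 = g I0 I2 I3" "g I3 I2 I0 = g I0 I2 I3"
    "g I1 I3 I2 = g I1 I2 I3" "g I2 I1 I3 = g I1 I2 I3" "g I2 I3 I1 = g I1 I2 I3"
    "g I3 I1 I2 = g I1 I2 I3" "g I3 I2 I1 = g I1 I2 I3" "g I0 I4 I1 = g I0 I1 I4"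
    "g I1 I0 I4 = g I0 I1 I4" "g I1 I4 I0 = g I0 I1 I4" "g I4 I0 I1 = g I0 I1 I4"
    "g I4 I1 I0 = g I0 I1 I4" "g I0 I4 I2 = g I0 I2 I4" "g I2 I0 I4 = g I0 I2 I4"
    "g I2 I4 I0 = g I0 I2 I4" "g I4 I0 I2 = g I0 I2 I4" "g I4 I2 I0 = g I0 I2 I4"
    "g I1 I4 I2 = g I1 I2 I4" "g I2 I1 I4 = g I1 I2 I4" "g I2 I4 I1 = g I1 I2 I4"
    "g I4 I1 I2 = g I1 I2 I4" "g I4 I2 I1 = g I1 I2 I4" "g I0 I4 I3 = g I0 I3 I4"
    "g I3 I0 I4 = g I0 I3 I4" "g I3 I4 I0 = g I0 I3 I4" "g I4 I0 I3 = g I0 I3 I4"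
    "g I4 I3 I0 = g I0 I3 I4" "g I1 I4 I3 = g I1 I3 I4" "g I3 I1 I4 = g I1 I3 I4"
    "g I3 I4 I1 = g I1 I3 I4" "g I4 I1 I3 = g I1 I3 I4" "g I4 I3 I1 = g I1 I3 I4"
    "g I2 I4 I3 = g I2 I3 I4" "g I3 I2 I4 = g I2 I3 I4" "g I3 I4 I2 = g I2 I3 I4"
    "g I4 I2 I3 = g I2 I3 I4" "g I4 I3 I2 = g I2 I3 I4" "g I0 I5 I1 = g I0 I1 I5"
    "g I1 I0 I5 = g I0 I1 I5" "g I1 I5 I0 = g I0 I1 I5" "g I5 I0 I1 = g I0 I1 I5"
    "g I5 I1 I0 = g I0 I1 I5" "g I0 I5 I2 = g I0 I2 I5" "g I2 I0 I5 = g I0 I2 I5"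
    "g I2 I5 I0 = g I0 I2 I5" "g I5 I0 I2 = g I0 I2 I5" "g I5 I2 I0 = g I0 I2 I5"
    "g I1 I5 I2 = g I1 I2 I5" "g I2 I1 I5 = g I1 I2 I5" "g I2 I5 I1 = g I1 I2 I5"
    "g I5 I1 I2 = g I1 I2 I5" "g I5 I2 I1 = g I1 I2 I5" "g I0 I5 I3 = g I0 I3 I5"
    "g I3 I0 I5 = g I0 I3 I5" "g I3 I5 I0 = g I0 I3 I5" "g I5 I0 I3 = g I0 I3 I5"
    "g I5 I3 I0 = g I0 I3 I5" "g I1 I5 I3 = g I1 I3 I5" "g I3 I1 I5 = g I1 I3 I5"
    "g I3 I5 I1 = g I1 I3 I5" "g I5 I1 I3 = g I1 I3 I5" "g I5 I3 I1 = g I1 I3 I5"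
    "g I2 I5 I3 = g I2 I3 I5" "g I3 I2 I5 = g I2 I3 I5" "g I3 I5 I2 = g I2 I3 I5"
    "g I5 I2 I3 = g I2 I3 I5" "g I5 I3 I2 = g I2 I3 I5" "g I0 I5 I4 = g I0 I4 I5"
    "g I4 I0 I5 = g I0 I4 I5" "g I4 I5 I0 = g I0 I4 I5" "g I5 I0 I4 = g I0 I4 I5"
    "g I5 I4 I0 = g I0 I4 I5" "g I1 I5 I4 = g I1 I4 I5" "g I4 I1 I5 = g I1 I4 I5"
    "g I4 I5 I1 = g I1 I4 I5" "g I5 I1 I4 = g I1 I4 I5" "g I5 I4 I1 = g I1 I4 I5"
    "g I2 I5 I4 = g I2 I4 I5" "g I4 I2 I5 = g I2 I4 I5" "g I4 I5 I2 = g I2 I4 I5"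
    "g I5 I2 I4 = g I2 I4 I5" "g I5 I4 I2 = g I2 I4 I5" "g I3 I5 I4 = g I3 I4 I5"
    "g I4 I3 I5 = g I3 I4 I5" "g I4 I5 I3 = g I3 I4 I5" "g I5 I3 I4 = g I3 I4 I5"
    "g I5 I4 I3 = g I3 I4 I5"
  using assms unfolding sym3_def by metis+

text \<open>
  The symmetrised sum is invariant under relabelling, so one labelling from each isomorphism class has to be evaluated:
  the one whose list of bits is lexicographically largest.
\<close>

fun code :: "bool list \<Rightarrow> nat" where
  "code [] = 0"
| "code (x # xs) = of_bool x * 2 ^ length xs + code xs"

fun lexle :: "bool list \<Rightarrow> bool list \<Rightarrow> bool" where
  "lexle (x # xs) (y # ys) \<longleftrightarrow> (x \<longrightarrow> y) \<and> (x = y \<longrightarrow> lexle xs ys)"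
| "lexle _ _ \<longleftrightarrow> True"

lemma code_less: "code xs < 2 ^ length xs"
  by (induction xs) auto

lemma lexle_of_code_le: "length xs = length ys \<Longrightarrow> code xs \<le> code ys \<Longrightarrow> lexle xs ys"
proof (induction xs arbitrary: ys)
  case (Cons x xs)
  then obtain y zs where [simp]: "ys = y # zs" "length xs = length zs"
    by (cases ys) auto
  show ?case
    using Cons code_less[of zs] by (cases x; cases y) auto
qed simp

abbreviation (input) "tt \<equiv> True"
abbreviation (input) "ff \<equiv> False"

definition free_patterns :: "bool list list" where
  "free_patterns = [
    [ff,ff,ff,ff,ff,ff,ff,ff,ff,ff,ff,ff,ff,ff,ff,ff,ff,ff,ff,ff],
    [tt,ff,ff,ff,ff,ff,ff,ff,ff,ff,ff,ff,ff,ff,ff,ff,ff,ff,ff,ff],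
    [tt,ff,ff,ff,ff,ff,ff,ff,ff,ff,ff,ff,ff,ff,ff,ff,ff,ff,ff,tt],
    [tt,ff,ff,ff,ff,ff,ff,tt,ff,ff,ff,ff,ff,ff,ff,ff,ff,ff,ff,ff],
    [tt,ff,ff,ff,ff,ff,ff,tt,ff,ff,ff,ff,ff,ff,tt,ff,ff,ff,ff,ff],
    [tt,ff,ff,ff,ff,ff,ff,tt,ff,ff,ff,ff,ff,ff,tt,ff,ff,ff,tt,ff],
    [tt,tt,ff,ff,ff,ff,ff,ff,ff,ff,ff,ff,ff,ff,ff,ff,ff,ff,ff,ff],
    [tt,tt,ff,ff,ff,ff,ff,ff,ff,ff,ff,ff,ff,ff,ff,ff,tt,ff,ff,ff],
    [tt,tt,ff,ff,ff,ff,ff,ff,ff,ff,ff,ff,ff,ff,ff,ff,ff,ff,tt,ff],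
    [tt,tt,ff,ff,ff,ff,ff,ff,ff,ff,ff,ff,ff,ff,ff,ff,ff,ff,tt,tt],
    [tt,tt,ff,ff,tt,ff,ff,ff,ff,ff,ff,ff,ff,ff,ff,ff,ff,ff,ff,ff],
    [tt,tt,ff,ff,tt,ff,ff,ff,ff,ff,tt,ff,ff,ff,ff,ff,ff,ff,ff,ff],
    [tt,tt,ff,ff,tt,ff,ff,ff,ff,ff,ff,tt,ff,ff,ff,ff,ff,ff,ff,ff],
    [tt,tt,ff,ff,tt,ff,ff,ff,ff,ff,ff,tt,ff,tt,ff,ff,ff,ff,ff,ff],
    [tt,tt,ff,ff,tt,ff,ff,ff,ff,ff,ff,ff,ff,ff,ff,tt,ff,ff,ff,ff],
    [tt,tt,ff,ff,tt,ff,ff,ff,ff,ff,ff,tt,ff,tt,ff,ff,tt,ff,ff,ff],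
    [tt,tt,ff,ff,tt,ff,ff,ff,ff,ff,ff,ff,ff,ff,ff,tt,ff,ff,tt,ff],
    [tt,tt,ff,ff,tt,ff,ff,ff,ff,ff,ff,tt,ff,ff,ff,ff,ff,ff,ff,tt],
    [tt,tt,ff,ff,ff,tt,ff,ff,ff,ff,ff,ff,ff,ff,ff,ff,ff,ff,ff,ff],
    [tt,tt,ff,ff,ff,tt,ff,ff,ff,ff,ff,ff,tt,ff,ff,ff,ff,ff,ff,ff],
    [tt,tt,ff,ff,ff,tt,ff,ff,ff,ff,ff,ff,ff,tt,ff,ff,ff,ff,ff,ff],
    [tt,tt,ff,ff,ff,tt,ff,ff,ff,ff,ff,ff,ff,ff,tt,ff,ff,ff,ff,ff],
    [tt,tt,ff,ff,ff,tt,ff,ff,ff,ff,ff,ff,ff,ff,ff,tt,ff,ff,ff,ff],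
    [tt,tt,ff,ff,ff,tt,ff,ff,ff,ff,ff,ff,ff,tt,ff,ff,tt,ff,ff,ff],
    [tt,tt,ff,ff,ff,tt,ff,ff,ff,ff,ff,ff,ff,tt,ff,ff,ff,tt,ff,ff],
    [tt,tt,ff,ff,ff,tt,ff,ff,ff,ff,ff,ff,ff,ff,ff,tt,ff,tt,ff,ff],
    [tt,tt,ff,ff,ff,tt,ff,ff,ff,ff,ff,ff,ff,tt,ff,ff,ff,ff,tt,ff],
    [tt,tt,ff,ff,ff,tt,ff,ff,ff,ff,ff,ff,ff,ff,tt,ff,ff,ff,tt,ff],
    [tt,tt,ff,ff,ff,tt,ff,ff,ff,ff,ff,ff,ff,ff,ff,ff,ff,ff,ff,tt],
    [tt,tt,ff,ff,ff,tt,ff,ff,ff,ff,ff,ff,tt,ff,ff,ff,ff,ff,ff,tt],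
    [tt,tt,ff,ff,ff,tt,ff,ff,ff,ff,ff,ff,ff,ff,ff,tt,ff,ff,ff,tt],
    [tt,tt,ff,ff,ff,tt,ff,ff,ff,ff,ff,ff,ff,ff,ff,tt,ff,tt,ff,tt],
    [tt,tt,ff,ff,ff,tt,ff,ff,ff,ff,ff,ff,ff,ff,tt,ff,ff,ff,tt,tt],
    [tt,tt,ff,ff,ff,tt,ff,tt,ff,ff,ff,ff,ff,ff,ff,ff,ff,ff,ff,ff],
    [tt,tt,ff,ff,ff,tt,ff,tt,ff,ff,ff,ff,tt,ff,ff,ff,ff,ff,ff,ff],
    [tt,tt,ff,ff,ff,tt,ff,tt,ff,ff,ff,ff,tt,ff,tt,ff,ff,ff,ff,ff],
    [tt,tt,ff,ff,ff,tt,ff,tt,ff,ff,ff,ff,ff,ff,ff,tt,ff,ff,ff,ff],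
    [tt,tt,ff,ff,ff,tt,ff,tt,ff,ff,ff,ff,ff,ff,ff,tt,ff,tt,ff,ff],
    [tt,tt,ff,ff,ff,tt,ff,tt,ff,ff,ff,ff,tt,ff,tt,ff,ff,ff,tt,ff],
    [tt,tt,ff,ff,ff,tt,ff,tt,ff,ff,ff,ff,tt,ff,ff,ff,ff,ff,ff,tt],
    [tt,tt,ff,ff,ff,tt,ff,tt,ff,ff,ff,ff,tt,ff,tt,ff,ff,ff,tt,tt],
    [tt,tt,ff,ff,ff,ff,ff,ff,ff,tt,ff,ff,ff,ff,ff,ff,ff,ff,ff,ff],
    [tt,tt,ff,ff,ff,ff,ff,ff,ff,tt,ff,ff,ff,ff,ff,tt,ff,ff,ff,ff],
    [tt,tt,ff,ff,ff,ff,ff,ff,ff,tt,ff,ff,ff,ff,ff,ff,tt,ff,ff,ff],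
    [tt,tt,ff,ff,ff,ff,ff,ff,ff,tt,ff,ff,ff,ff,ff,tt,tt,ff,ff,ff],
    [tt,tt,ff,ff,ff,ff,ff,ff,ff,tt,ff,ff,ff,ff,ff,tt,tt,tt,ff,ff],
    [tt,tt,ff,ff,ff,ff,ff,ff,ff,tt,ff,ff,ff,ff,ff,ff,ff,ff,tt,ff],
    [tt,tt,ff,ff,tt,ff,ff,ff,ff,tt,ff,ff,ff,ff,ff,ff,ff,ff,ff,ff],
    [tt,tt,ff,ff,tt,ff,ff,ff,ff,tt,tt,ff,ff,ff,ff,ff,ff,ff,ff,ff],
    [tt,tt,ff,ff,tt,ff,ff,ff,ff,tt,ff,tt,ff,ff,ff,ff,ff,ff,ff,ff],
    [tt,tt,ff,ff,tt,ff,ff,ff,ff,tt,ff,tt,ff,tt,ff,ff,ff,ff,ff,ff],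
    [tt,tt,ff,ff,tt,ff,ff,ff,ff,tt,ff,ff,ff,ff,ff,tt,ff,ff,ff,ff],
    [tt,tt,ff,ff,tt,ff,ff,ff,ff,tt,tt,ff,ff,ff,ff,tt,ff,ff,ff,ff],
    [tt,tt,ff,ff,tt,ff,ff,ff,ff,tt,ff,tt,ff,tt,ff,ff,tt,ff,ff,ff],
    [tt,tt,ff,ff,tt,ff,ff,ff,ff,tt,ff,tt,ff,ff,ff,ff,ff,ff,ff,tt]]"

text \<open>A propositional problem in the twenty edge bits: freeness and maximality under
  relabelling unfold to clauses, and a solver refutes every assignment outside the list. This is why
  maximality is stated with \<open>lexle\<close>, whose recursion unfolds without numerals, and not
  with \<open>code\<close>.\<close>

lemma canonical_cover:
  assumes sy: "sym3 g"
    and k4: "\<And>a b c d. distinct [a, b, c, d] \<Longrightarrow> \<not> (g a b c \<and> g a b d \<and> g a c d)"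
    and c5: "\<And>a b c d e. distinct [a, b, c, d, e] \<Longrightarrow> \<not> (g a b c \<and> g b c d \<and> g c d e \<and> g d e a)"
    and lex: "\<And>a b c d u v. distinct [a, b, c, d, u, v] \<longrightarrow> lexle
      (bits (\<lambda>i j k. g (case_ix a b c d u v i) (case_ix a b c d u v j) (case_ix a b c d u v k))) (bits g)"
  shows "bits g \<in> set free_patterns"
proof -
  note sr = sym3_ix[OF sy]
  have "\<forall>a b. a \<noteq> b \<longrightarrow> (\<forall>c. a \<noteq> c \<and> b \<noteq> c \<longrightarrow> (\<forall>d. a \<noteq> d \<and> b \<noteq> d \<and> c \<noteq> d
      \<longrightarrow> \<not> (g a b c \<and> g a b d \<and> g a c d)))"
    by (intro allI impI k4) simp
  note k = this[unfolded all_ix, simplified sr ix.simps simp_thms conj_assoc]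
  have "\<forall>a b. a \<noteq> b \<longrightarrow> (\<forall>c. a \<noteq> c \<and> b \<noteq> c \<longrightarrow> (\<forall>d. a \<noteq> d \<and> b \<noteq> d \<and> c \<noteq> d
      \<longrightarrow> (\<forall>e. a \<noteq> e \<and> b \<noteq> e \<and> c \<noteq> e \<and> d \<noteq> e \<longrightarrow> \<not> (g a b c \<and> g b c d \<and> g c d e \<and> g d e a))))"
    by (intro allI impI c5) simp
  note c = this[unfolded all_ix, simplified sr ix.simps simp_thms conj_assoc]
  \<comment> \<open>These permutations leave exactly one labelling of each of the 55 graphs.\<close>
  show ?thesis
    using
      lex[of I1 I0 I2 I3 I4 I5] lex[of I2 I1 I0 I3 I4 I5] lex[of I3 I1 I2 I0 I4 I5]
      lex[of I4 I1 I2 I3 I0 I5] lex[of I5 I1 I2 I3 I4 I0] lex[of I0 I2 I1 I3 I4 I5]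
      lex[of I0 I3 I2 I1 I4 I5] lex[of I0 I4 I2 I3 I1 I5] lex[of I0 I5 I2 I3 I4 I1]
      lex[of I0 I1 I3 I2 I4 I5] lex[of I0 I1 I4 I3 I2 I5] lex[of I0 I1 I5 I3 I4 I2]
      lex[of I0 I1 I2 I4 I3 I5] lex[of I0 I1 I2 I5 I4 I3] lex[of I0 I1 I2 I3 I5 I4]
      lex[of I3 I0 I4 I5 I1 I2] lex[of I0 I2 I1 I4 I3 I5] lex[of I4 I5 I0 I2 I1 I3]
      lex[of I1 I0 I3 I2 I5 I4] lex[of I4 I5 I0 I1 I2 I3] lex[of I0 I1 I3 I2 I5 I4]
    apply (simp (no_asm_use) only: bits_def distinct.simps list.set insert_iff empty_iff ix.distinct ix.case simp_thms
        if_True if_False sr lexle.simps free_patterns_def list.inject)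
    apply (insert k c)
    apply satx
    done
qed

lemma bitsD:
  assumes "sym3 g" "bits g = [b0, b1, b2, b3, b4, b5, b6, b7, b8, b9, b10, b11, b12, b13, b14, b15, b16, b17, b18, b19]"
  shows "
    g I0 I1 I2 = b0 \<and> g I0 I2 I1 = b0 \<and> g I1 I0 I2 = b0 \<and> g I1 I2 I0 = b0 \<and>
    g I2 I0 I1 = b0 \<and> g I2 I1 I0 = b0 \<and> g I0 I1 I3 = b1 \<and> g I0 I3 I1 = b1 \<and>
    g I1 I0 I3 = b1 \<and> g I1 I3 I0 = b1 \<and> g I3 I0 I1 = b1 \<and> g I3 I1 I0 = b1 \<and>
    g I0 I2 I3 = b2 \<and> g I0 I3 I2 = b2 \<and> g I2 I0 I3 = b2 \<and> g I2 I3 I0 = b2 \<and>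
    g I3 I0 I2 = b2 \<and> g I3 I2 I0 = b2 \<and> g I1 I2 I3 = b3 \<and> g I1 I3 I2 = b3 \<and>
    g I2 I1 I3 = b3 \<and> g I2 I3 I1 = b3 \<and> g I3 I1 I2 = b3 \<and> g I3 I2 I1 = b3 \<and>
    g I0 I1 I4 = b4 \<and> g I0 I4 I1 = b4 \<and> g I1 I0 I4 = b4 \<and> g I1 I4 I0 = b4 \<and>
    g I4 I0 I1 = b4 \<and> g I4 I1 I0 = b4 \<and> g I0 I2 I4 = b5 \<and> g I0 I4 I2 = b5 \<and>
    g I2 I0 I4 = b5 \<and> g I2 I4 I0 = b5 \<and> g I4 I0 I2 = b5 \<and> g I4 I2 I0 = b5 \<and>
    g I1 I2 I4 = b6 \<and> g I1 I4 I2 = b6 \<and> g I2 I1 I4 = b6 \<and> g I2 I4 I1 = b6 \<and>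
    g I4 I1 I2 = b6 \<and> g I4 I2 I1 = b6 \<and> g I0 I3 I4 = b7 \<and> g I0 I4 I3 = b7 \<and>
    g I3 I0 I4 = b7 \<and> g I3 I4 I0 = b7 \<and> g I4 I0 I3 = b7 \<and> g I4 I3 I0 = b7 \<and>
    g I1 I3 I4 = b8 \<and> g I1 I4 I3 = b8 \<and> g I3 I1 I4 = b8 \<and> g I3 I4 I1 = b8 \<and>
    g I4 I1 I3 = b8 \<and> g I4 I3 I1 = b8 \<and> g I2 I3 I4 = b9 \<and> g I2 I4 I3 = b9 \<and>
    g I3 I2 I4 = b9 \<and> g I3 I4 I2 = b9 \<and> g I4 I2 I3 = b9 \<and> g I4 I3 I2 = b9 \<and>
    g I0 I1 I5 = b10 \<and> g I0 I5 I1 = b10 \<and> g I1 I0 I5 = b10 \<and> g I1 I5 I0 = b10 \<and>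
    g I5 I0 I1 = b10 \<and> g I5 I1 I0 = b10 \<and> g I0 I2 I5 = b11 \<and> g I0 I5 I2 = b11 \<and>
    g I2 I0 I5 = b11 \<and> g I2 I5 I0 = b11 \<and> g I5 I0 I2 = b11 \<and> g I5 I2 I0 = b11 \<and>
    g I1 I2 I5 = b12 \<and> g I1 I5 I2 = b12 \<and> g I2 I1 I5 = b12 \<and> g I2 I5 I1 = b12 \<and>
    g I5 I1 I2 = b12 \<and> g I5 I2 I1 = b12 \<and> g I0 I3 I5 = b13 \<and> g I0 I5 I3 = b13 \<and>
    g I3 I0 I5 = b13 \<and> g I3 I5 I0 = b13 \<and> g I5 I0 I3 = b13 \<and> g I5 I3 I0 = b13 \<and>
    g I1 I3 I5 = b14 \<and> g I1 I5 I3 = b14 \<and> g I3 I1 I5 = b14 \<and> g I3 I5 I1 = b14 \<and>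
    g I5 I1 I3 = b14 \<and> g I5 I3 I1 = b14 \<and> g I2 I3 I5 = b15 \<and> g I2 I5 I3 = b15 \<and>
    g I3 I2 I5 = b15 \<and> g I3 I5 I2 = b15 \<and> g I5 I2 I3 = b15 \<and> g I5 I3 I2 = b15 \<and>
    g I0 I4 I5 = b16 \<and> g I0 I5 I4 = b16 \<and> g I4 I0 I5 = b16 \<and> g I4 I5 I0 = b16 \<and>
    g I5 I0 I4 = b16 \<and> g I5 I4 I0 = b16 \<and> g I1 I4 I5 = b17 \<and> g I1 I5 I4 = b17 \<and>
    g I4 I1 I5 = b17 \<and> g I4 I5 I1 = b17 \<and> g I5 I1 I4 = b17 \<and> g I5 I4 I1 = b17 \<and>
    g I2 I4 I5 = b18 \<and> g I2 I5 I4 = b18 \<and> g I4 I2 I5 = b18 \<and> g I4 I5 I2 = b18 \<and>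
    g I5 I2 I4 = b18 \<and> g I5 I4 I2 = b18 \<and> g I3 I4 I5 = b19 \<and> g I3 I5 I4 = b19 \<and>
    g I4 I3 I5 = b19 \<and> g I4 I5 I3 = b19 \<and> g I5 I3 I4 = b19 \<and> g I5 I4 I3 = b19"
  using assms(2) unfolding sym3_ix[OF assms(1)] bits_def list.inject by simp

lemmas pattern_simps = S6_expand P_defs \<phi>1_def nb_def \<phi>2_def \<phi>3_def sq1_def sq0_def sq2_def
  flag_i_def flag_s_def flag_t_def flag_z_def flag_z0_def flag_y_def flag_y'_def flag_r_def
  if_True if_False simp_thms arith_simps rel_simps arith_special mult_1 mult_1_right mult_minus1 mult_minus1_right
  minus_zero minus_minus

text \<open>The numerical check of the certificate: once all twenty bits are constants, every term
  evaluates to an integer. The weak congruence decides a condition before either branch is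
  touched.\<close>

lemma S6_\<Phi>_nonpos_of_pattern:
  assumes "sym3 g"
  shows "bits g \<in> set free_patterns \<Longrightarrow> S6 (\<Phi> g) \<le> 0"
  unfolding S6_\<Phi> free_patterns_def list.set insert_iff empty_iff
  by (elim disjE FalseE) (drule bitsD[OF assms], simp only: pattern_simps cong: if_weak_cong)+

lemma six_vertex_inequality:
  assumes sy: "sym3 g"
    and k4: "\<And>a b c d. distinct [a, b, c, d] \<Longrightarrow> \<not> (g a b c \<and> g a b d \<and> g a c d)"
    and c5: "\<And>a b c d e. distinct [a, b, c, d, e] \<Longrightarrow> \<not> (g a b c \<and> g b c d \<and> g c d e \<and> g d e a)"
  shows "S6 (\<Phi> g) \<le> 0"
proof -
  define G where "G = (\<lambda>\<sigma> :: ix \<Rightarrow> ix. \<lambda>i j k. g (\<sigma> i) (\<sigma> j) (\<sigma> k))"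
  have "finite {\<sigma> :: ix \<Rightarrow> ix. bij \<sigma>}" "{\<sigma> :: ix \<Rightarrow> ix. bij \<sigma>} \<noteq> {}"
    using bij_id by auto
  from ex_is_arg_min_if_finite[OF this, of "\<lambda>\<sigma>. - int (code (bits (G \<sigma>)))"]
  obtain \<sigma> where \<sigma>: "bij \<sigma>" and mx: "\<And>\<tau>. bij \<tau> \<Longrightarrow> code (bits (G \<tau>)) \<le> code (bits (G \<sigma>))"
    unfolding is_arg_min_linorder by auto
  have inj: "\<sigma> a = \<sigma> b \<longleftrightarrow> a = b" for a b
    using \<sigma> by (auto simp: bij_def inj_def)
  have sG: "sym3 (G \<sigma>)"
    using sy unfolding sym3_def G_def by blast
  have "bits (G \<sigma>) \<in> set free_patterns"
  proof (rule canonical_cover[OF sG], unfold G_def)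
    show "\<not> (g (\<sigma> a) (\<sigma> b) (\<sigma> c) \<and> g (\<sigma> a) (\<sigma> b) (\<sigma> d) \<and> g (\<sigma> a) (\<sigma> c) (\<sigma> d))"
      if "distinct [a, b, c, d]" for a b c d
      by (rule k4) (use that in \<open>simp add: inj\<close>)
    show "\<not> (g (\<sigma> a) (\<sigma> b) (\<sigma> c) \<and> g (\<sigma> b) (\<sigma> c) (\<sigma> d) \<and> g (\<sigma> c) (\<sigma> d) (\<sigma> e) \<and> g (\<sigma> d) (\<sigma> e) (\<sigma> a))"
      if "distinct [a, b, c, d, e]" for a b c d e
      by (rule c5) (use that in \<open>simp add: inj\<close>)
    show "distinct [a, b, c, d, u, v] \<longrightarrow> lexle (bits (\<lambda>i j k. g (\<sigma> (case_ix a b c d u v i))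
        (\<sigma> (case_ix a b c d u v j)) (\<sigma> (case_ix a b c d u v k)))) (bits (\<lambda>i j k. g (\<sigma> i) (\<sigma> j) (\<sigma> k)))"
      for a b c d u v
    proof
      assume "distinct [a, b, c, d, u, v]"
      then have "bij (\<sigma> \<circ> case_ix a b c d u v)"
        using \<sigma> bij_case_ix by (blast intro: bij_comp)
      from mx[OF this] show "lexle (bits (\<lambda>i j k. g (\<sigma> (case_ix a b c d u v i))
          (\<sigma> (case_ix a b c d u v j)) (\<sigma> (case_ix a b c d u v k)))) (bits (\<lambda>i j k. g (\<sigma> i) (\<sigma> j) (\<sigma> k)))"
        by (intro lexle_of_code_le) (simp_all add: bits_def G_def)
    qed
  qed
  then have "S6 (\<Phi> (G \<sigma>)) \<le> 0"
    by (rule S6_\<Phi>_nonpos_of_pattern[OF sG])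
  also have "S6 (\<Phi> (G \<sigma>)) = S6 (\<Phi> g)"
  proof -
    have "\<Phi> (G \<sigma>) a b c d u v = \<Phi> g (\<sigma> a) (\<sigma> b) (\<sigma> c) (\<sigma> d) (\<sigma> u) (\<sigma> v)" for a b c d u v
      by (simp only: \<Phi>_def \<phi>1_def nb_def \<phi>2_def \<phi>3_def sq1_def sq0_def sq2_def G_def)
    then show ?thesis unfolding S6_def
      by (intro sum.reindex_bij_witness[of _ "\<lambda>\<pi>. inv \<sigma> \<circ> \<pi>" "\<lambda>\<pi>. \<sigma> \<circ> \<pi>"])
        (use \<sigma> in \<open>auto simp: fun_eq_iff bij_is_surj surj_f_inv_f bij_is_inj inv_f_f
           intro: bij_comp bij_imp_bij_inv\<close>)
  qed
  finally show ?thesis .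
qed

section \<open>Counting six-tuples\<close>

text \<open>A ternary predicate makes ordered counting and pulling back to six labels immediate; set
  systems return only in \<open>three_graph_c5_free\<close> and the final theorem.\<close>

locale c5_free =
  fixes V :: "'a set" and h :: "'a \<Rightarrow> 'a \<Rightarrow> 'a \<Rightarrow> bool"
  assumes finite_V: "finite V"
    and sym: "sym3 h"
    and edge: "h a b c \<Longrightarrow> a \<in> V \<and> b \<in> V \<and> c \<in> V \<and> a \<noteq> b \<and> a \<noteq> c \<and> b \<noteq> c"
    and c5: "distinct [a, b, c, d, e] \<Longrightarrow> \<not> (h a b c \<and> h b c d \<and> h c d e \<and> h d e a)"
begin

lemma swap12: "h a b c = h b a c" and swap23: "h a b c = h a c b"
  using sym unfolding sym3_def by blast+

lemma rot: "h a b c = h b c a" "h a b c = h c a b" "h a b c = h c b a"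
  using swap12 swap23 by metis+

abbreviation n :: real where "n \<equiv> real (card V)"

text \<open>Two centres \<open>a\<close>, \<open>a'\<close> over \<open>b\<close>, \<open>c\<close>,
  \<open>d\<close> yield a copy of C_5^{3-} in the cyclic order \<open>b\<close>, \<open>a\<close>,
  \<open>c\<close>, \<open>d\<close>, \<open>a'\<close>.\<close>

lemma K4_centre_unique:
  assumes "h a b c" "h a b d" "h a c d" "h a' b c" "h a' b d" "h a' c d"
  shows "a = a'"
proof (rule ccontr)
  assume "a \<noteq> a'"
  moreover note assms[THEN edge]
  ultimately have "distinct [b, a, c, d, a']" by auto
  from c5[OF this] show False
    using assms swap12 swap23 by metis
qed

definition tuples :: "(ix \<Rightarrow> 'a) set" where
  "tuples = PiE UNIV (\<lambda>_. V)"

lemma finite_tuples: "finite tuples"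
  unfolding tuples_def by (intro finite_PiE) (auto simp: finite_V)

lemma in_tuples: "t \<in> tuples \<longleftrightarrow> (\<forall>i. t i \<in> V)"
  by (auto simp: tuples_def PiE_def)

lemma sum_tuples:
  "(\<Sum>t\<in>tuples. F (t I0) (t I1) (t I2) (t I3) (t I4) (t I5)) =
   (\<Sum>a\<in>V. \<Sum>b\<in>V. \<Sum>c\<in>V. \<Sum>d\<in>V. \<Sum>u\<in>V. \<Sum>v\<in>V. F a b c d u v :: 'b :: comm_monoid_add)"
  unfolding sum.cartesian_product
  by (rule sum.reindex_bij_witness
      [of _ "\<lambda>(a, b, c, d, u, v). case_ix a b c d u v" "\<lambda>t. (t I0, t I1, t I2, t I3, t I4, t I5)"])
    (auto simp: in_tuples fun_eq_iff all_ix)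

text \<open>Forgetting coordinate \<open>i\<close> is injective on \<open>X\<close>. This serves
  both kinds of bad tuples: those with a repeated entry, and those with a K_4^-, whose centre is
  determined by the other three vertices.\<close>

lemma card_determined_le:
  assumes X: "X \<subseteq> tuples"
    and det: "\<And>t t'. t \<in> X \<Longrightarrow> t' \<in> X \<Longrightarrow> (\<And>k. k \<noteq> i \<Longrightarrow> t k = t' k) \<Longrightarrow> t i = t' i"
  shows "card X \<le> card V ^ 5"
proof -
  let ?Y = "PiE (UNIV - {i}) (\<lambda>_. V)"
  have "inj_on (\<lambda>t. restrict t (UNIV - {i})) X"
  proof (rule inj_onI)
    fix t t' assume t: "t \<in> X" "t' \<in> X" "restrict t (UNIV - {i}) = restrict t' (UNIV - {i})"
    have eq: "t k = t' k" if "k \<noteq> i" for k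
      using fun_cong[OF t(3), of k] that by simp
    then show "t = t'"
      using det[OF t(1,2)] by (metis ext)
  qed
  moreover have "(\<lambda>t. restrict t (UNIV - {i})) ` X \<subseteq> ?Y"
    using X unfolding subset_iff in_tuples by (auto split: if_split_asm)
  moreover have "finite ?Y"
    by (intro finite_PiE) (auto simp: finite_V)
  ultimately have "card X \<le> card ?Y"
    by (rule card_inj_on_le)
  also have "card ?Y = card V ^ 5"
    by (simp add: card_PiE card_Diff_singleton UNIV_ix[THEN arg_cong[of _ _ card]] power_numeral_reduce)
  finally show ?thesis .
qed

text \<open>Permuting coordinates is a bijection of the set of all tuples. Repetitions are kept in
  \<open>tuples\<close> so that sums over it factor into sums over \<open>V\<close>.\<close>

lemma sum_tuples_S6:
  "(\<Sum>t\<in>tuples. S6 (\<Phi> (\<lambda>i j k. h (t i) (t j) (t k)))) =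
   720 * (\<Sum>t\<in>tuples. \<Phi> h (t I0) (t I1) (t I2) (t I3) (t I4) (t I5))"
proof -
  have \<Phi>: "\<Phi> (\<lambda>i j k. h (t i) (t j) (t k)) a b c d u v = \<Phi> h (t a) (t b) (t c) (t d) (t u) (t v)"
    for t :: "ix \<Rightarrow> 'a" and a b c d u v
    by (simp only: \<Phi>_def \<phi>1_def nb_def \<phi>2_def \<phi>3_def sq1_def sq0_def sq2_def)
  have "(\<Sum>t\<in>tuples. S6 (\<Phi> (\<lambda>i j k. h (t i) (t j) (t k)))) =
      (\<Sum>\<pi>\<in>{\<pi>. bij \<pi>}. \<Sum>t\<in>tuples. \<Phi> h (t (\<pi> I0)) (t (\<pi> I1)) (t (\<pi> I2)) (t (\<pi> I3)) (t (\<pi> I4)) (t (\<pi> I5)))"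
    unfolding S6_def \<Phi> by (rule sum.swap)
  also have "\<dots> = (\<Sum>\<pi>\<in>{\<pi> :: ix \<Rightarrow> ix. bij \<pi>}. \<Sum>t\<in>tuples. \<Phi> h (t I0) (t I1) (t I2) (t I3) (t I4) (t I5))"
  proof (rule sum.cong[OF refl])
    fix \<pi> :: "ix \<Rightarrow> ix" assume "\<pi> \<in> {\<pi>. bij \<pi>}"
    then have "bij \<pi>" by simp
    then show "(\<Sum>t\<in>tuples. \<Phi> h (t (\<pi> I0)) (t (\<pi> I1)) (t (\<pi> I2)) (t (\<pi> I3)) (t (\<pi> I4)) (t (\<pi> I5))) =
        (\<Sum>t\<in>tuples. \<Phi> h (t I0) (t I1) (t I2) (t I3) (t I4) (t I5))"
      by (intro sum.reindex_bij_witness[of _ "\<lambda>t. t \<circ> inv \<pi>" "\<lambda>t. t \<circ> \<pi>"])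
        (auto simp: in_tuples fun_eq_iff bij_is_surj surj_f_inv_f bij_is_inj inv_f_f)
  qed
  also have "\<dots> = 720 * (\<Sum>t\<in>tuples. \<Phi> h (t I0) (t I1) (t I2) (t I3) (t I4) (t I5))"
    using card_bij_ix by (simp add: sum_distrib_left[symmetric])
  finally show ?thesis .
qed

text \<open>A crude bound suffices because it is applied to O(n^5) tuples only. The largest absolute
  value of a flag is 66, and 4356 = 66^2.\<close>

lemma \<Phi>_le: "\<Phi> h' a b c d u v \<le> 30000000"
proof -
  have *: "x * y \<le> 4356" if "\<bar>x\<bar> \<le> 66" "\<bar>y\<bar> \<le> 66" for x y :: int
  proof -
    have "\<bar>x\<bar> * \<bar>y\<bar> \<le> 66 * 66" using that by (intro mult_mono) auto
    then show ?thesis by (simp add: abs_mult[symmetric] abs_le_iff)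
  qed
  have f: "\<bar>flag_i p q r x y z\<bar> \<le> 66" "\<bar>flag_s p q r x y z\<bar> \<le> 66" "\<bar>flag_t p q r x y z\<bar> \<le> 66"
    "\<bar>flag_z p q r x y z\<bar> \<le> 66" "\<bar>flag_y p q x y\<bar> \<le> 66" "\<bar>flag_y' p q x y\<bar> \<le> 66" "\<bar>flag_r p q x y\<bar> \<le> 66"
    for p q r x y z
    by (simp_all add: flag_i_def flag_s_def flag_t_def flag_z_def flag_z0_def flag_y_def flag_y'_def flag_r_def)
  have "\<phi>1 h' a b c d u v \<le> 5000" "\<phi>2 h' a b c d u v \<le> 1" "\<phi>3 h' a b c d u v \<le> 4"
    by (simp_all add: \<phi>1_def \<phi>2_def \<phi>3_def)
  moreover have "sq1 flag_i h' a b c d u v \<le> 4356" "sq1 flag_s h' a b c d u v \<le> 4356"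
    "sq1 flag_t h' a b c d u v \<le> 4356" "sq0 flag_z h' a b c d u v \<le> 4356" "sq2 flag_y h' a b c d u v \<le> 4356"
    "sq2 flag_y' h' a b c d u v \<le> 4356" "sq2 flag_r h' a b c d u v \<le> 4356"
    unfolding sq1_def sq0_def sq2_def by (auto intro!: * f)
  ultimately show ?thesis
    unfolding \<Phi>_def by linarith
qed

lemma sum_\<Phi>_le:
  "(\<Sum>a\<in>V. \<Sum>b\<in>V. \<Sum>c\<in>V. \<Sum>d\<in>V. \<Sum>u\<in>V. \<Sum>v\<in>V. real_of_int (\<Phi> h a b c d u v)) \<le> 40000000000 * n ^ 5"
proof -
  define E where "E = (\<lambda>(i, j). {t \<in> tuples. i \<noteq> j \<and> t i = t j})"
  define K where "K = (\<lambda>(i, j, k, l). {t \<in> tuples. distinct [i, j, k, l] \<and>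
     h (t i) (t j) (t k) \<and> h (t i) (t j) (t l) \<and> h (t i) (t k) (t l)})"
  define B where "B = \<Union> (range E) \<union> \<Union> (range K)"
  have E: "card (E p) \<le> card V ^ 5" for p
    by (rule card_determined_le[where i = "fst p"]) (auto simp: E_def split: prod.splits)
  have K: "card (K p) \<le> card V ^ 5" for p
  proof (rule card_determined_le[where i = "fst p"])
    show "K p \<subseteq> tuples" by (auto simp: K_def split: prod.splits)
    fix t t' assume tt: "t \<in> K p" "t' \<in> K p" "\<And>k. k \<noteq> fst p \<Longrightarrow> t k = t' k"
    obtain i j k l where p: "p = (i, j, k, l)" by (metis surj_pair)
    show "t (fst p) = t' (fst p)"
      by (rule K4_centre_unique[of _ "t j" "t k" "t l"]) (use tt in \<open>auto simp: K_def p\<close>)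
  qed
  have fB: "B \<subseteq> tuples" by (auto simp: B_def E_def K_def split: prod.splits)
  have c6: "card (UNIV :: ix set) = 6" by (simp add: UNIV_ix)
  have "card B \<le> card (\<Union> (range E)) + card (\<Union> (range K))"
    unfolding B_def by (rule card_Un_le)
  also have "\<dots> \<le> (\<Sum>p\<in>UNIV. card (E p)) + (\<Sum>p\<in>UNIV. card (K p))"
    by (intro add_mono card_UN_le) simp_all
  also have "\<dots> \<le> (\<Sum>p\<in>(UNIV :: (ix \<times> ix) set). card V ^ 5) + (\<Sum>p\<in>(UNIV :: (ix \<times> ix \<times> ix \<times> ix) set). card V ^ 5)"
    by (intro add_mono sum_mono E K)
  \<comment> \<open>36 pairs and 1296 quadruples of indices.\<close>
  also have "\<dots> = 1332 * card V ^ 5"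
    by (simp add: UNIV_Times_UNIV[symmetric] card_cartesian_product c6 del: UNIV_Times_UNIV)
  finally have cB: "card B \<le> 1332 * card V ^ 5" .
  have "S6 (\<Phi> (\<lambda>i j k. h (t i) (t j) (t k))) \<le> (if t \<in> B then 720 * 30000000 else 0)" if t: "t \<in> tuples" for t
  proof (cases "t \<in> B")
    case True
    have "S6 (\<Phi> (\<lambda>i j k. h (t i) (t j) (t k))) \<le> (\<Sum>\<pi>\<in>{\<pi> :: ix \<Rightarrow> ix. bij \<pi>}. 30000000)"
      unfolding S6_def by (intro sum_mono \<Phi>_le)
    with True card_bij_ix show ?thesis by simp
  next
    case False
    have inj: "t i \<noteq> t j" if "i \<noteq> j" for i j
      using False t that by (auto simp: B_def E_def)
    have "S6 (\<Phi> (\<lambda>i j k. h (t i) (t j) (t k))) \<le> 0"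
    proof (rule six_vertex_inequality)
      show "sym3 (\<lambda>i j k. h (t i) (t j) (t k))"
        using sym unfolding sym3_def by blast
      show "\<not> (h (t a) (t b) (t c) \<and> h (t a) (t b) (t d) \<and> h (t a) (t c) (t d))" if "distinct [a, b, c, d]" for a b c d
      proof
        assume "h (t a) (t b) (t c) \<and> h (t a) (t b) (t d) \<and> h (t a) (t c) (t d)"
        then have "t \<in> K (a, b, c, d)" using that t by (simp add: K_def)
        with False show False by (auto simp: B_def)
      qed
      show "\<not> (h (t a) (t b) (t c) \<and> h (t b) (t c) (t d) \<and> h (t c) (t d) (t e) \<and> h (t d) (t e) (t a))"
        if "distinct [a, b, c, d, e]" for a b c d e
        by (rule c5) (use that inj in auto)
    qed
    with False show ?thesis by simp
  qed
  then have "(\<Sum>t\<in>tuples. S6 (\<Phi> (\<lambda>i j k. h (t i) (t j) (t k)))) \<le> (\<Sum>t\<in>tuples. if t \<in> B then 720 * 30000000 else 0)"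
    by (rule sum_mono)
  also have "\<dots> = 720 * 30000000 * int (card B)"
    using fB by (simp add: sum.If_cases finite_tuples Int_absorb1)
  finally have "720 * (\<Sum>t\<in>tuples. \<Phi> h (t I0) (t I1) (t I2) (t I3) (t I4) (t I5)) \<le> 720 * 30000000 * int (card B)"
    by (simp add: sum_tuples_S6)
  also have "\<dots> \<le> 720 * 30000000 * int (1332 * card V ^ 5)"
    by (intro mult_left_mono iffD2[OF of_nat_le_iff] cB) simp
  also have "\<dots> \<le> 720 * (40000000000 * int (card V) ^ 5)"
    by simp
  finally have "(\<Sum>t\<in>tuples. \<Phi> h (t I0) (t I1) (t I2) (t I3) (t I4) (t I5)) \<le> 40000000000 * int (card V) ^ 5"
    by linarith
  then have "real_of_int (\<Sum>a\<in>V. \<Sum>b\<in>V. \<Sum>c\<in>V. \<Sum>d\<in>V. \<Sum>u\<in>V. \<Sum>v\<in>V. \<Phi> h a b c d u v) \<le> real_of_int (40000000000 * int (card V) ^ 5)"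
    unfolding sum_tuples of_int_le_iff .
  then show ?thesis
    by simp
qed

section \<open>The terms of the certificate as counts of ordered edges\<close>

definition N3 :: "'a set \<Rightarrow> 'a set \<Rightarrow> 'a set \<Rightarrow> real" where
  "N3 A B C = (\<Sum>x\<in>A. \<Sum>y\<in>B. \<Sum>z\<in>C. of_bool (h x y z))"

abbreviation nbr :: "'a \<Rightarrow> 'a \<Rightarrow> 'a set" where
  "nbr a b \<equiv> {c \<in> V. h a b c}"

lemma sum_of_bool_V: "(\<Sum>c\<in>V. of_bool (P c) * f c) = (\<Sum>c\<in>{c \<in> V. P c}. f c :: real)"
  using finite_V by (simp add: sum.inter_filter of_bool_def if_distrib[of "\<lambda>x. x * _"] cong: if_cong)

lemma sum_of_bool_V1: "(\<Sum>c\<in>V. of_bool (P c)) = real (card {c \<in> V. P c})"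
  using sum_of_bool_V[of P "\<lambda>_. 1"] by simp

lemma sum_product_nonneg:
  "0 \<le> (\<Sum>a\<in>V. \<Sum>b\<in>V. \<Sum>c\<in>V. \<Sum>d\<in>V. \<Sum>u\<in>V. \<Sum>v\<in>V.
     of_bool (P a b c d) * (f a b c d u * f a b c d v :: real))"
proof -
  have "(\<Sum>u\<in>V. \<Sum>v\<in>V. of_bool (P a b c d) * (f a b c d u * f a b c d v)) =
      of_bool (P a b c d) * (\<Sum>u\<in>V. f a b c d u) ^ 2" for a b c d
    by (simp add: power2_eq_square sum_product sum_distrib_left[symmetric] del: sum_of_bool_mult_eq)
  then show ?thesis by (simp add: sum_nonneg)
qed

lemma sum_sq1_nonneg:
  "0 \<le> (\<Sum>a\<in>V. \<Sum>b\<in>V. \<Sum>c\<in>V. \<Sum>d\<in>V. \<Sum>u\<in>V. \<Sum>v\<in>V. real_of_int (sq1 f h a b c d u v))"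
proof -
  have "real_of_int (sq1 f h a b c d u v) = of_bool (h a b c \<and> \<not> (h a b d \<or> h a c d \<or> h b c d)) *
      (real_of_int (on6 f h a b c d u) * real_of_int (on6 f h a b c d v))" for a b c d u v
    by (auto simp: sq1_def)
  then show ?thesis by (simp only: sum_product_nonneg)
qed

lemma sum_sq0_nonneg:
  "0 \<le> (\<Sum>a\<in>V. \<Sum>b\<in>V. \<Sum>c\<in>V. \<Sum>d\<in>V. \<Sum>u\<in>V. \<Sum>v\<in>V. real_of_int (sq0 f h a b c d u v))"
proof -
  have "real_of_int (sq0 f h a b c d u v) = of_bool (\<not> (h a b c \<or> h a b d \<or> h a c d \<or> h b c d)) *
      (real_of_int (on6 f h a b c d u) * real_of_int (on6 f h a b c d v))" for a b c d u v
    by (auto simp: sq0_def)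
  then show ?thesis by (simp only: sum_product_nonneg)
qed

lemma sum_sq2_nonneg:
  "0 \<le> (\<Sum>a\<in>V. \<Sum>b\<in>V. \<Sum>c\<in>V. \<Sum>d\<in>V. \<Sum>u\<in>V. \<Sum>v\<in>V. real_of_int (sq2 f h a b c d u v))"
proof -
  have "0 \<le> (\<Sum>c\<in>V. \<Sum>d\<in>V. \<Sum>u\<in>V. \<Sum>v\<in>V. real_of_int (sq2 f h a b c d u v))" for a b
  proof -
    let ?F = "\<lambda>u v. real_of_int (f (h a b u) (h a b v) (h a u v) (h b u v))"
    have "(\<Sum>c\<in>V. \<Sum>d\<in>V. \<Sum>u\<in>V. \<Sum>v\<in>V. ?F c d * ?F u v) = (\<Sum>u\<in>V. \<Sum>v\<in>V. ?F u v) ^ 2"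
      by (simp only: power2_eq_square sum_distrib_left[symmetric] sum_distrib_right[symmetric])
    then have "(\<Sum>c\<in>V. \<Sum>d\<in>V. \<Sum>u\<in>V. \<Sum>v\<in>V. ?F c d * ?F u v) \<ge> 0" by simp
    then show ?thesis
      by (simp add: sq2_def)
  qed
  then show ?thesis
    by - (rule sum_nonneg, rule sum_nonneg)
qed

lemma sum_\<phi>3:
  "(\<Sum>a\<in>V. \<Sum>b\<in>V. \<Sum>c\<in>V. \<Sum>d\<in>V. \<Sum>u\<in>V. \<Sum>v\<in>V. real_of_int (\<phi>3 h a b c d u v)) = 4 * n ^ 3 * N3 V V V"
proof -
  have "real_of_int (\<phi>3 h a b c d u v) = 4 * of_bool (h a b c)" for a b c d u v
    by (simp add: \<phi>3_def)
  then show ?thesis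
    by (simp add: N3_def sum_distrib_left power3_eq_cube mult_ac)
qed

lemma sum_\<phi>2:
  "(\<Sum>a\<in>V. \<Sum>b\<in>V. \<Sum>c\<in>V. \<Sum>d\<in>V. \<Sum>u\<in>V. \<Sum>v\<in>V. real_of_int (\<phi>2 h a b c d u v)) =
   n * (\<Sum>a\<in>V. \<Sum>b\<in>V. real (card (nbr a b)) ^ 3 - 4 * N3 (nbr a b) (nbr a b) (nbr a b))"
proof -
  have "(\<Sum>c\<in>V. \<Sum>d\<in>V. \<Sum>u\<in>V. \<Sum>v\<in>V. real_of_int (\<phi>2 h a b c d u v)) =
     n * (real (card (nbr a b)) ^ 3 - 4 * N3 (nbr a b) (nbr a b) (nbr a b))" for a b
  proof -
    have "real_of_int (\<phi>2 h a b c d u v) =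
        of_bool (h a b c) * (of_bool (h a b d) * (of_bool (h a b u) * (1 - 4 * of_bool (h c d u))))" for c d u v
      by (auto simp: \<phi>2_def)
    then have "(\<Sum>c\<in>V. \<Sum>d\<in>V. \<Sum>u\<in>V. \<Sum>v\<in>V. real_of_int (\<phi>2 h a b c d u v)) =
        n * (\<Sum>c\<in>V. of_bool (h a b c) * (\<Sum>d\<in>V. of_bool (h a b d) * (\<Sum>u\<in>V. of_bool (h a b u) * (1 - 4 * of_bool (h c d u)))))"
      by (simp add: sum_distrib_left)
    also have "\<dots> = n * (\<Sum>c\<in>nbr a b. \<Sum>d\<in>nbr a b. \<Sum>u\<in>nbr a b. 1 - 4 * of_bool (h c d u))"
      unfolding sum_of_bool_V ..
    also have "\<dots> = n * (real (card (nbr a b)) ^ 3 - 4 * N3 (nbr a b) (nbr a b) (nbr a b))"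
      by (simp add: sum_subtractf N3_def sum_distrib_left power3_eq_cube)
    finally show ?thesis .
  qed
  then show ?thesis
    by (simp add: sum_distrib_left)
qed

text \<open>Since 135000 = 27 * 5000, the terms 5000 m^3 and 135000 \<open>N3\<close> combine to the
  defect in the AM-GM inequality for three disjoint neighbourhoods with union of size m. The other
  terms give -27 n^3 at m = n and are positive for m below 0.98 n. The squared factor keeps them
  small near m = n/3, the value at an edge of the second level of the balanced recursive
  construction.\<close>

definition bracket :: "'a \<Rightarrow> 'a \<Rightarrow> 'a \<Rightarrow> real" where
  "bracket a b c = (let m = real (card {t \<in> V. nb h a b c t}) in
     5000 * m ^ 3 + 40 * (n - m) * (10 * m - 3 * n) ^ 2 - 9 * n ^ 2 * (5 * m - 2 * n)
     - 135000 * N3 (nbr b c) (nbr a c) (nbr a b))"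

lemma sum_\<phi>1:
  "(\<Sum>a\<in>V. \<Sum>b\<in>V. \<Sum>c\<in>V. \<Sum>d\<in>V. \<Sum>u\<in>V. \<Sum>v\<in>V. real_of_int (\<phi>1 h a b c d u v)) =
   (\<Sum>a\<in>V. \<Sum>b\<in>V. \<Sum>c\<in>V. of_bool (h a b c) * bracket a b c)"
proof -
  have "(\<Sum>d\<in>V. \<Sum>u\<in>V. \<Sum>v\<in>V. real_of_int (\<phi>1 h a b c d u v)) = of_bool (h a b c) * bracket a b c" for a b c
  proof (cases "h a b c")
    case True
    define w where "w = (\<lambda>t. of_bool (nb h a b c t) :: real)"
    define m where "m = real (card {t \<in> V. nb h a b c t})"
    have m: "(\<Sum>t\<in>V. w t) = m"
      unfolding w_def m_def by (rule sum_of_bool_V1)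
    have "real_of_int (\<phi>1 h a b c d u v) = w d * (5000 * w u * w v - 27)
        + (1 - w d) * (18 + 40 * (10 * w u - 3) * (10 * w v - 3))
        - 135000 * (of_bool (h b c d) * (of_bool (h a c u) * (of_bool (h a b v) * of_bool (h d u v))))" for d u v
      using True by (simp add: \<phi>1_def w_def)
    then have "(\<Sum>d\<in>V. \<Sum>u\<in>V. \<Sum>v\<in>V. real_of_int (\<phi>1 h a b c d u v)) =
       (\<Sum>d\<in>V. \<Sum>u\<in>V. \<Sum>v\<in>V. w d * (5000 * w u * w v - 27) + (1 - w d) * (18 + 40 * (10 * w u - 3) * (10 * w v - 3)))
       - 135000 * (\<Sum>d\<in>V. of_bool (h b c d) * (\<Sum>u\<in>V. of_bool (h a c u) * (\<Sum>v\<in>V. of_bool (h a b v) * of_bool (h d u v))))"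
      by (simp add: sum_subtractf sum_distrib_left)
    also have "(\<Sum>d\<in>V. of_bool (h b c d) * (\<Sum>u\<in>V. of_bool (h a c u) * (\<Sum>v\<in>V. of_bool (h a b v) * of_bool (h d u v))))
       = N3 (nbr b c) (nbr a c) (nbr a b)"
      unfolding sum_of_bool_V N3_def ..
    also have "(\<Sum>d\<in>V. \<Sum>u\<in>V. \<Sum>v\<in>V. w d * (5000 * w u * w v - 27) + (1 - w d) * (18 + 40 * (10 * w u - 3) * (10 * w v - 3)))
       = m * (5000 * m * m - 27 * n * n) + (n - m) * (18 * n * n + 40 * (10 * m - 3 * n) * (10 * m - 3 * n))"
    proof -
      have "(\<Sum>v\<in>V. w d * (5000 * w u * w v - 27) + (1 - w d) * (18 + 40 * (10 * w u - 3) * (10 * w v - 3)))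
        = w d * (5000 * w u * m - 27 * n) + (1 - w d) * (18 * n + 40 * (10 * w u - 3) * (10 * m - 3 * n))" for d u
      proof -
        have "w d * (5000 * w u * w v - 27) + (1 - w d) * (18 + 40 * (10 * w u - 3) * (10 * w v - 3))
           = (5000 * w d * w u + (1 - w d) * 400 * (10 * w u - 3)) * w v
             + (w d * (- 27) + (1 - w d) * (18 - 120 * (10 * w u - 3)))" for v
          by (simp add: algebra_simps)
        then show ?thesis
          by (simp add: sum.distrib sum_distrib_left[symmetric] m) (simp add: algebra_simps)
      qed
      moreover have "(\<Sum>u\<in>V. w d * (5000 * w u * m - 27 * n) + (1 - w d) * (18 * n + 40 * (10 * w u - 3) * (10 * m - 3 * n)))
        = w d * (5000 * m * m - 27 * n * n) + (1 - w d) * (18 * n * n + 40 * (10 * m - 3 * n) * (10 * m - 3 * n))" for d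
      proof -
        have "w d * (5000 * w u * m - 27 * n) + (1 - w d) * (18 * n + 40 * (10 * w u - 3) * (10 * m - 3 * n))
           = (w d * 5000 * m + (1 - w d) * 400 * (10 * m - 3 * n)) * w u
             + (w d * (- 27 * n) + (1 - w d) * (18 * n - 120 * (10 * m - 3 * n)))" for u
          by (simp add: algebra_simps)
        then show ?thesis
          by (simp add: sum.distrib sum_distrib_left[symmetric] m) (simp add: algebra_simps)
      qed
      moreover have "(\<Sum>d\<in>V. w d * p + (1 - w d) * q) = m * p + (n - m) * q" for p q
        by (simp add: sum.distrib sum_subtractf sum_distrib_right[symmetric] m)
      ultimately show ?thesis by simp
    qed
    finally show ?thesis
      using True unfolding bracket_def m_def[symmetric] by (simp add: algebra_simps power2_eq_square power3_eq_cube)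
  qed (simp add: \<phi>1_def)
  then show ?thesis by simp
qed

lemma sum_brackets_le:
  "100 * (\<Sum>a\<in>V. \<Sum>b\<in>V. \<Sum>c\<in>V. of_bool (h a b c) * bracket a b c)
    + 972391 * (n * (\<Sum>a\<in>V. \<Sum>b\<in>V. real (card (nbr a b)) ^ 3 - 4 * N3 (nbr a b) (nbr a b) (nbr a b)))
    + 244451 * (4 * n ^ 3 * N3 V V V - n ^ 6) \<le> 40000000000 * n ^ 5"
proof -
  let ?S = "\<lambda>F. \<Sum>a\<in>V. \<Sum>b\<in>V. \<Sum>c\<in>V. \<Sum>d\<in>V. \<Sum>u\<in>V. \<Sum>v\<in>V. real_of_int (F a b c d u v)"
  have "?S (\<Phi> h) = 100 * ?S (\<phi>1 h) + 972391 * ?S (\<phi>2 h) + 244451 * ?S (\<phi>3 h) - 244451 * n ^ 6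
     + 620 * ?S (sq1 flag_i h) + 2044 * ?S (sq1 flag_s h) + 1668 * ?S (sq1 flag_t h)
     + 631 * ?S (sq0 flag_z h)
     + 585 * ?S (sq2 flag_y h) + 72 * ?S (sq2 flag_y' h) + 412 * ?S (sq2 flag_r h)"
    unfolding \<Phi>_def of_int_add of_int_diff of_int_mult of_int_numeral sum.distrib sum_subtractf sum_distrib_left[symmetric]
    by (simp add: power_numeral_reduce)
  then have "100 * ?S (\<phi>1 h) + 972391 * ?S (\<phi>2 h) + 244451 * ?S (\<phi>3 h) - 244451 * n ^ 6 \<le> 40000000000 * n ^ 5"
    using sum_\<Phi>_le sum_sq1_nonneg[of flag_i] sum_sq1_nonneg[of flag_s] sum_sq1_nonneg[of flag_t]
      sum_sq0_nonneg[of flag_z] sum_sq2_nonneg[of flag_y] sum_sq2_nonneg[of flag_y'] sum_sq2_nonneg[of flag_r]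
    by linarith
  then show ?thesis
    unfolding sum_\<phi>1 sum_\<phi>2 sum_\<phi>3 by (simp only: right_diff_distrib add_diff_eq)
qed

section \<open>Consequences of the scarcity of K_4^-\<close>

lemma sum_K4_le:
  "(\<Sum>b\<in>V. \<Sum>c\<in>V. \<Sum>d\<in>V. \<Sum>a\<in>V. of_bool (h a b c \<and> h a b d \<and> h a c d) :: real) \<le> n ^ 3"
proof -
  have "(\<Sum>a\<in>V. of_bool (h a b c \<and> h a b d \<and> h a c d) :: real) \<le> 1" for b c d
  proof -
    have "card {a \<in> V. h a b c \<and> h a b d \<and> h a c d} \<le> 1"
      unfolding One_nat_def by (subst card_le_Suc0_iff_eq) (use finite_V K4_centre_unique in auto)
    then show ?thesis by (simp add: sum_of_bool_V1)
  qed
  then have "(\<Sum>b\<in>V. \<Sum>c\<in>V. \<Sum>d\<in>V. \<Sum>a\<in>V. of_bool (h a b c \<and> h a b d \<and> h a c d) :: real)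
      \<le> (\<Sum>b\<in>V. \<Sum>c\<in>V. \<Sum>d\<in>V. 1)"
    by (intro sum_mono)
  then show ?thesis by (simp add: power3_eq_cube)
qed

text \<open>Among four vertices, two edges share exactly one of the six pairs, and three edges
  already form a K_4^-. So at most one of the six choices of the pair is counted, up to 5 extra for
  each K_4^- centre. This 1/6 is what lets the certificate absorb an unknown density.\<close>

lemma sum_codegree_sq_le: "(\<Sum>a\<in>V. \<Sum>b\<in>V. real (card (nbr a b)) ^ 2) \<le> n ^ 4 / 6 + 4 * n ^ 3"
proof -
  let ?P = "V \<times> V \<times> V \<times> V"
  let ?q = "\<lambda>a b c d. of_bool (h a b c \<and> h a b d) :: real"
  let ?k = "\<lambda>a b c d. of_bool (h a b c \<and> h a b d \<and> h a c d) :: real"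
  define Q where "Q = (\<Sum>(a, b, c, d)\<in>?P. ?q a b c d)"
  define K where "K = (\<Sum>(a, b, c, d)\<in>?P. ?k a b c d)"
  have Q: "(\<Sum>(a, b, c, d)\<in>?P. ?q a c b d) = Q" "(\<Sum>(a, b, c, d)\<in>?P. ?q a d b c) = Q"
     "(\<Sum>(a, b, c, d)\<in>?P. ?q b c a d) = Q" "(\<Sum>(a, b, c, d)\<in>?P. ?q b d a c) = Q" "(\<Sum>(a, b, c, d)\<in>?P. ?q c d a b) = Q"
    unfolding Q_def
    subgoal by (rule sum.reindex_bij_witness[of _ "\<lambda>(a, c, b, d). (a, b, c, d)" "\<lambda>(a, b, c, d). (a, c, b, d)"]) auto
    subgoal by (rule sum.reindex_bij_witness[of _ "\<lambda>(a, d, b, c). (a, b, c, d)" "\<lambda>(a, b, c, d). (a, d, b, c)"]) auto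
    subgoal by (rule sum.reindex_bij_witness[of _ "\<lambda>(b, c, a, d). (a, b, c, d)" "\<lambda>(a, b, c, d). (b, c, a, d)"]) auto
    subgoal by (rule sum.reindex_bij_witness[of _ "\<lambda>(b, d, a, c). (a, b, c, d)" "\<lambda>(a, b, c, d). (b, d, a, c)"]) auto
    subgoal by (rule sum.reindex_bij_witness[of _ "\<lambda>(c, d, a, b). (a, b, c, d)" "\<lambda>(a, b, c, d). (c, d, a, b)"]) auto
    done
  have K: "(\<Sum>(a, b, c, d)\<in>?P. ?k b a c d) = K" "(\<Sum>(a, b, c, d)\<in>?P. ?k c a b d) = K" "(\<Sum>(a, b, c, d)\<in>?P. ?k d a b c) = K"
    unfolding K_def
    subgoal by (rule sum.reindex_bij_witness[of _ "\<lambda>(b, a, c, d). (a, b, c, d)" "\<lambda>(a, b, c, d). (b, a, c, d)"]) auto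
    subgoal by (rule sum.reindex_bij_witness[of _ "\<lambda>(c, a, b, d). (a, b, c, d)" "\<lambda>(a, b, c, d). (c, a, b, d)"]) auto
    subgoal by (rule sum.reindex_bij_witness[of _ "\<lambda>(d, a, b, c). (a, b, c, d)" "\<lambda>(a, b, c, d). (d, a, b, c)"]) auto
    done
  have "K = (\<Sum>(b, c, d, a)\<in>?P. ?k a b c d)"
    unfolding K_def by (rule sum.reindex_bij_witness[of _ "\<lambda>(b, c, d, a). (a, b, c, d)" "\<lambda>(a, b, c, d). (b, c, d, a)"]) auto
  also have "\<dots> \<le> n ^ 3"
    using sum_K4_le by (simp add: sum.cartesian_product)
  finally have Kle: "K \<le> n ^ 3" .
  have "?q a b c d + ?q a c b d + ?q a d b c + ?q b c a d + ?q b d a c + ?q c d a b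
      \<le> 1 + 5 * (?k a b c d + ?k b a c d + ?k c a b d + ?k d a b c)" for a b c d
  proof -
    have e: "h b a c = h a b c" "h b a d = h a b d" "h c a b = h a b c" "h c a d = h a c d" "h d a b = h a b d"
      "h d a c = h a c d" "h a c b = h a b c" "h a d b = h a b d" "h a d c = h a c d" "h c b d = h b c d" "h b c a = h a b c"
      "h b d a = h a b d" "h b d c = h b c d" "h c d a = h a c d" "h c d b = h b c d" "h d b c = h b c d"
      using swap12 swap23 by metis+
    show ?thesis
      unfolding e by (cases "h a b c"; cases "h a b d"; cases "h a c d"; cases "h b c d") (simp_all add: e)
  qed
  then have "(\<Sum>(a, b, c, d)\<in>?P. ?q a b c d + ?q a c b d + ?q a d b c + ?q b c a d + ?q b d a c + ?q c d a b)
      \<le> (\<Sum>(a, b, c, d)\<in>?P. 1 + 5 * (?k a b c d + ?k b a c d + ?k c a b d + ?k d a b c))"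
    by (intro sum_mono) auto
  also have "\<dots> = n ^ 4 + 5 * (K + (\<Sum>(a, b, c, d)\<in>?P. ?k b a c d) + (\<Sum>(a, b, c, d)\<in>?P. ?k c a b d) + (\<Sum>(a, b, c, d)\<in>?P. ?k d a b c))"
    unfolding K_def by (simp add: split_def sum.distrib sum_distrib_left[symmetric] card_cartesian_product power_numeral_reduce)
  also have "\<dots> \<le> n ^ 4 + 20 * n ^ 3"
    unfolding K using Kle by simp
  also have "(\<Sum>(a, b, c, d)\<in>?P. ?q a b c d + ?q a c b d + ?q a d b c + ?q b c a d + ?q b d a c + ?q c d a b) =
      Q + (\<Sum>(a, b, c, d)\<in>?P. ?q a c b d) + (\<Sum>(a, b, c, d)\<in>?P. ?q a d b c) + (\<Sum>(a, b, c, d)\<in>?P. ?q b c a d)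
      + (\<Sum>(a, b, c, d)\<in>?P. ?q b d a c) + (\<Sum>(a, b, c, d)\<in>?P. ?q c d a b)"
    unfolding Q_def by (simp add: split_def sum.distrib)
  finally have "6 * Q \<le> n ^ 4 + 20 * n ^ 3"
    unfolding Q by simp
  moreover have "Q = (\<Sum>a\<in>V. \<Sum>b\<in>V. real (card (nbr a b)) ^ 2)"
  proof -
    have "Q = (\<Sum>a\<in>V. \<Sum>b\<in>V. \<Sum>c\<in>V. \<Sum>d\<in>V. ?q a b c d)"
      unfolding Q_def sum.cartesian_product ..
    also have "\<dots> = (\<Sum>a\<in>V. \<Sum>b\<in>V. (\<Sum>c\<in>V. of_bool (h a b c)) * (\<Sum>d\<in>V. of_bool (h a b d)))"
      unfolding sum_product of_bool_conj ..
    finally show ?thesis by (simp add: sum_of_bool_V1 power2_eq_square)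
  qed
  moreover have "0 \<le> n ^ 3" by simp
  ultimately show ?thesis by linarith
qed

lemma N3_nonneg: "0 \<le> N3 A B C"
  unfolding N3_def by (intro sum_nonneg) simp

lemma N3_le: "N3 A B C \<le> real (card A) * real (card B) * real (card C)"
proof -
  have "N3 A B C \<le> (\<Sum>x\<in>A. \<Sum>y\<in>B. \<Sum>z\<in>C. 1)"
    unfolding N3_def by (intro sum_mono) simp
  then show ?thesis by simp
qed

text \<open>The upper bound ranges over all subsets because it is used for the sets
  \<open>nbr a b\<close> and for the parts. Its error is measured against the whole vertex set, so
  small subsets need no separate treatment.\<close>

definition dense :: "real \<Rightarrow> real \<Rightarrow> bool" where
  "dense \<rho> \<eta> \<longleftrightarrow> 1 / 4 \<le> \<rho> \<and> \<rho> \<le> 1 \<and> 0 \<le> \<eta> \<and>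
     (\<forall>S\<subseteq>V. N3 S S S \<le> \<rho> * real (card S) ^ 3 + \<eta> * n ^ 3) \<and> (\<rho> - \<eta>) * n ^ 3 \<le> N3 V V V"

text \<open>Averaging over edges. The sets \<open>nbr b c\<close>, \<open>nbr a c\<close>,
  \<open>nbr a b\<close> may overlap, so the average is taken of \<open>bracket\<close> plus a
  penalty for overlaps, and one edge controls both.\<close>

lemma exists_good_triple:
  assumes d: "dense \<rho> \<eta>" and \<eta>: "\<eta> \<le> 1 / 100" and n: "0 < n"
  obtains X Y Z where "X \<subseteq> V" "Y \<subseteq> V" "Z \<subseteq> V" "X \<inter> Y = {}" "X \<inter> Z = {}" "Y \<inter> Z = {}"
    "let m = real (card (X \<union> Y \<union> Z)) in 5000 * m ^ 3 + 40 * (n - m) * (10 * m - 3 * n) ^ 2 - 9 * n ^ 2 * (5 * m - 2 * n)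
     - 135000 * N3 X Y Z \<le> 3000000000 * n ^ 2 + 300000 * \<eta> * n ^ 3"
proof -
  define \<theta> where "\<theta> = 4 * \<rho> - 1"
  have \<theta>: "0 \<le> \<theta>" "\<theta> \<le> 3" using d by (auto simp: \<theta>_def dense_def)
  have \<eta>0: "0 \<le> \<eta>" using d by (simp add: dense_def)
  have cle: "real (card (nbr a b)) \<le> n" for a b
    using finite_V by (auto intro: card_mono)
  have "(\<Sum>a\<in>V. \<Sum>b\<in>V. real (card (nbr a b)) ^ 3) \<le> (\<Sum>a\<in>V. \<Sum>b\<in>V. n * real (card (nbr a b)) ^ 2)"
    by (intro sum_mono) (auto simp: power3_eq_cube power2_eq_square mult.assoc intro!: mult_right_mono card_mono finite_V)
  also have "\<dots> = n * (\<Sum>a\<in>V. \<Sum>b\<in>V. real (card (nbr a b)) ^ 2)"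
    by (simp add: sum_distrib_left)
  also have "\<dots> \<le> n * (n ^ 4 / 6 + 4 * n ^ 3)"
    by (intro mult_left_mono sum_codegree_sq_le) simp
  finally have S3: "(\<Sum>a\<in>V. \<Sum>b\<in>V. real (card (nbr a b)) ^ 3) \<le> n ^ 5 / 6 + 4 * n ^ 4"
    by (simp add: algebra_simps power_numeral_reduce)
  have "(\<Sum>a\<in>V. \<Sum>b\<in>V. real (card (nbr a b)) ^ 3 - 4 * N3 (nbr a b) (nbr a b) (nbr a b))
      \<ge> (\<Sum>a\<in>V. \<Sum>b\<in>V. - \<theta> * real (card (nbr a b)) ^ 3 - 4 * \<eta> * n ^ 3)"
  proof (intro sum_mono)
    fix a b
    have "N3 (nbr a b) (nbr a b) (nbr a b) \<le> \<rho> * real (card (nbr a b)) ^ 3 + \<eta> * n ^ 3"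
      using d by (auto simp: dense_def)
    then show "- \<theta> * real (card (nbr a b)) ^ 3 - 4 * \<eta> * n ^ 3 \<le>
        real (card (nbr a b)) ^ 3 - 4 * N3 (nbr a b) (nbr a b) (nbr a b)"
      by (simp add: \<theta>_def algebra_simps)
  qed
  then have "- \<theta> * (\<Sum>a\<in>V. \<Sum>b\<in>V. real (card (nbr a b)) ^ 3) - 4 * \<eta> * n ^ 5 \<le>
      (\<Sum>a\<in>V. \<Sum>b\<in>V. real (card (nbr a b)) ^ 3 - 4 * N3 (nbr a b) (nbr a b) (nbr a b))"
    by (simp add: sum_subtractf sum_distrib_left sum_negf power_numeral_reduce mult_ac)
  moreover have "- \<theta> * (n ^ 5 / 6 + 4 * n ^ 4) \<le> - \<theta> * (\<Sum>a\<in>V. \<Sum>b\<in>V. real (card (nbr a b)) ^ 3)"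
    using mult_left_mono[OF S3 \<theta>(1)] by simp
  ultimately have "- \<theta> * (n ^ 5 / 6 + 4 * n ^ 4) - 4 * \<eta> * n ^ 5
     \<le> (\<Sum>a\<in>V. \<Sum>b\<in>V. real (card (nbr a b)) ^ 3 - 4 * N3 (nbr a b) (nbr a b) (nbr a b))"
    by linarith
  then have "n * (- \<theta> * (n ^ 5 / 6 + 4 * n ^ 4) - 4 * \<eta> * n ^ 5)
     \<le> n * (\<Sum>a\<in>V. \<Sum>b\<in>V. real (card (nbr a b)) ^ 3 - 4 * N3 (nbr a b) (nbr a b) (nbr a b))"
    by (rule mult_left_mono) simp
  moreover have "n * (- \<theta> * (n ^ 5 / 6 + 4 * n ^ 4) - 4 * \<eta> * n ^ 5) = - (\<theta> * n ^ 6) / 6 - 4 * (\<theta> * n ^ 5) - 4 * (\<eta> * n ^ 6)"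
    by (simp add: algebra_simps power_numeral_reduce)
  moreover have "4 * n ^ 3 * N3 V V V - n ^ 6 \<ge> \<theta> * n ^ 6 - 4 * (\<eta> * n ^ 6)"
  proof -
    have "n ^ 3 * ((\<rho> - \<eta>) * n ^ 3) \<le> n ^ 3 * N3 V V V"
      using d by (intro mult_left_mono) (auto simp: dense_def)
    moreover have "n ^ 3 * ((\<rho> - \<eta>) * n ^ 3) = (\<rho> - \<eta>) * n ^ 6"
      by (simp add: power_numeral_reduce)
    ultimately show ?thesis by (simp add: \<theta>_def algebra_simps)
  qed
  moreover have "\<theta> * n ^ 5 \<le> 3 * n ^ 5" "0 \<le> \<theta> * n ^ 6" "0 \<le> \<eta> * n ^ 6" "0 \<le> n ^ 5"
    using \<theta> \<eta>0 by (auto intro: mult_right_mono)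
  moreover define P where "P = n * (\<Sum>a\<in>V. \<Sum>b\<in>V. real (card (nbr a b)) ^ 3 - 4 * N3 (nbr a b) (nbr a b) (nbr a b))"
  moreover define R where "R = 4 * n ^ 3 * N3 V V V - n ^ 6"
  moreover define B where "B = (\<Sum>a\<in>V. \<Sum>b\<in>V. \<Sum>c\<in>V. of_bool (h a b c) * bracket a b c)"
  moreover have "100 * B + 972391 * P + 244451 * R \<le> 40000000000 * n ^ 5"
    using sum_brackets_le unfolding P_def R_def B_def .
  ultimately have "- (\<theta> * n ^ 6) / 6 - 4 * (\<theta> * n ^ 5) - 4 * (\<eta> * n ^ 6) \<le> P" "\<theta> * n ^ 6 - 4 * (\<eta> * n ^ 6) \<le> R"
     "\<theta> * n ^ 5 \<le> 3 * n ^ 5" "0 \<le> \<theta> * n ^ 6" "0 \<le> \<eta> * n ^ 6" "0 \<le> n ^ 5" "100 * B + 972391 * P + 244451 * R \<le> 40000000000 * n ^ 5"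
    by simp_all
  then have "B \<le> 500000000 * n ^ 5 + 50000 * (\<eta> * n ^ 6)"
    by linarith
  then have br: "(\<Sum>a\<in>V. \<Sum>b\<in>V. \<Sum>c\<in>V. of_bool (h a b c) * bracket a b c) \<le> 500000000 * n ^ 5 + 50000 * (\<eta> * n ^ 6)"
    unfolding B_def .

  \<comment> \<open>A vertex in two of the three neighbourhoods forms a K_4^- with the edge, so the
    total overlap is cubic even though it is summed over all edges. The weight
    \<open>135000 * n ^ 2\<close> used next is what making the sets disjoint can cost in
    \<open>bracket\<close>.\<close>
  define ov where "ov = (\<lambda>a b c. real (card (nbr b c \<inter> nbr a c)) + real (card (nbr b c \<inter> nbr a b)) + real (card (nbr a c \<inter> nbr a b)))"
  have "(\<Sum>a\<in>V. \<Sum>b\<in>V. \<Sum>c\<in>V. of_bool (h a b c) * ov a b c) \<le> 3 * n ^ 3"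
  proof -
    have c: "real (card (nbr x y \<inter> nbr z w)) = (\<Sum>t\<in>V. of_bool (h x y t \<and> h z w t))" for x y z w
      unfolding sum_of_bool_V1 by (rule arg_cong[of _ _ "\<lambda>A. real (card A)"]) auto
    let ?P = "V \<times> V \<times> V \<times> V"
    let ?k = "\<lambda>a b c d. of_bool (h a b c \<and> h a b d \<and> h a c d) :: real"
    have K: "(\<Sum>(b, c, d, a)\<in>?P. ?k a b c d) \<le> n ^ 3"
      using sum_K4_le by (simp add: sum.cartesian_product)
    have "(\<Sum>a\<in>V. \<Sum>b\<in>V. \<Sum>c\<in>V. of_bool (h a b c) * ov a b c) =
       (\<Sum>(a, b, c, t)\<in>?P. of_bool (h a b c \<and> h b c t \<and> h a c t)) + (\<Sum>(a, b, c, t)\<in>?P. of_bool (h a b c \<and> h b c t \<and> h a b t))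
       + (\<Sum>(a, b, c, t)\<in>?P. of_bool (h a b c \<and> h a c t \<and> h a b t))"
      unfolding ov_def c by (simp add: sum.cartesian_product[symmetric] sum.distrib distrib_left sum_distrib_left of_bool_conj)
    also have "(\<Sum>(a, b, c, t)\<in>?P. of_bool (h a b c \<and> h b c t \<and> h a c t) :: real) = (\<Sum>(b, c, d, a)\<in>?P. ?k a b c d)"
      by (rule sum.reindex_bij_witness[of _ "\<lambda>(a, b, t, c). (a, b, c, t)" "\<lambda>(a, b, c, t). (a, b, t, c)"])
        (auto simp: rot swap12 swap23 of_bool_def)
    also have "(\<Sum>(a, b, c, t)\<in>?P. of_bool (h a b c \<and> h b c t \<and> h a b t) :: real) = (\<Sum>(b, c, d, a)\<in>?P. ?k a b c d)"
      by (rule sum.reindex_bij_witness[of _ "\<lambda>(a, c, t, b). (a, b, c, t)" "\<lambda>(a, b, c, t). (a, c, t, b)"])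
        (auto simp: rot swap12 swap23 of_bool_def)
    also have "(\<Sum>(a, b, c, t)\<in>?P. of_bool (h a b c \<and> h a c t \<and> h a b t) :: real) = (\<Sum>(b, c, d, a)\<in>?P. ?k a b c d)"
      by (rule sum.reindex_bij_witness[of _ "\<lambda>(b, c, t, a). (a, b, c, t)" "\<lambda>(a, b, c, t). (b, c, t, a)"])
        (auto simp: rot swap12 swap23 of_bool_def)
    finally show ?thesis using K by simp
  qed
  then have "135000 * n ^ 2 * (\<Sum>a\<in>V. \<Sum>b\<in>V. \<Sum>c\<in>V. of_bool (h a b c) * ov a b c) \<le> 135000 * n ^ 2 * (3 * n ^ 3)"
    by (intro mult_left_mono) auto
  also have "\<dots> = 405000 * n ^ 5" by (simp add: power_numeral_reduce)
  finally have "(\<Sum>a\<in>V. \<Sum>b\<in>V. \<Sum>c\<in>V. of_bool (h a b c) * bracket a b c)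
      + 135000 * n ^ 2 * (\<Sum>a\<in>V. \<Sum>b\<in>V. \<Sum>c\<in>V. of_bool (h a b c) * ov a b c) \<le> 600000000 * n ^ 5 + 50000 * (\<eta> * n ^ 6)"
    using br \<open>0 \<le> n ^ 5\<close> by linarith
  then have tot: "(\<Sum>a\<in>V. \<Sum>b\<in>V. \<Sum>c\<in>V. of_bool (h a b c) * (bracket a b c + 135000 * n ^ 2 * ov a b c))
     \<le> 600000000 * n ^ 5 + 50000 * (\<eta> * n ^ 6)"
    unfolding distrib_left sum.distrib mult.left_commute[of "of_bool _"] sum_distrib_left[symmetric] .
  \<comment> \<open>A value just above the average: there are at least 6/25 n^3 ordered edges, as
    6/25 = 1/4 - 1/100, and 6/25 times 3000000000 and 300000 exceeds the two coefficients in
    \<open>tot\<close>.\<close>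
  define \<kappa> where "\<kappa> = 3000000000 * n ^ 2 + 300000 * \<eta> * n ^ 3"
  have "\<exists>a b c. h a b c \<and> bracket a b c + 135000 * n ^ 2 * ov a b c \<le> \<kappa>"
  proof (rule ccontr)
    assume "\<not> ?thesis"
    then have gt: "\<kappa> < bracket a b c + 135000 * n ^ 2 * ov a b c" if "h a b c" for a b c
      using that by force
    have "\<kappa> * N3 V V V \<le> (\<Sum>a\<in>V. \<Sum>b\<in>V. \<Sum>c\<in>V. of_bool (h a b c) * (bracket a b c + 135000 * n ^ 2 * ov a b c))"
      unfolding N3_def sum_distrib_left by (intro sum_mono) (use gt in \<open>auto simp: less_imp_le\<close>)
    also note tot
    finally have "\<kappa> * N3 V V V \<le> 600000000 * n ^ 5 + 50000 * (\<eta> * n ^ 6)" .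
    moreover have "\<kappa> * (6 / 25 * n ^ 3) \<le> \<kappa> * N3 V V V"
    proof (rule mult_left_mono)
      have "6 / 25 * n ^ 3 \<le> (\<rho> - \<eta>) * n ^ 3"
        using d \<eta> by (intro mult_right_mono) (auto simp: dense_def)
      then show "6 / 25 * n ^ 3 \<le> N3 V V V" using d by (auto simp: dense_def)
    qed (simp add: \<kappa>_def \<eta>0)
    moreover have "\<kappa> * (6 / 25 * n ^ 3) = 720000000 * n ^ 5 + 72000 * (\<eta> * n ^ 6)"
      by (simp add: \<kappa>_def algebra_simps power_numeral_reduce)
    moreover have "0 < n ^ 5" "0 \<le> \<eta> * n ^ 6" using n \<eta>0 by auto
    ultimately show False by linarith
  qed
  then obtain a b c where abc: "h a b c" and le: "bracket a b c + 135000 * n ^ 2 * ov a b c \<le> \<kappa>" by blast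
  define X Y Z where "X = nbr b c - nbr a c - nbr a b" and "Y = nbr a c - nbr a b" and "Z = nbr a b"
  have split: "N3 (nbr b c) (nbr a c) (nbr a b) \<le> N3 X Y Z + n ^ 2 * ov a b c"
  proof -
    have fin: "finite (nbr x y)" for x y using finite_V by simp
    have "N3 (nbr b c) C D = N3 X C D + N3 (nbr b c \<inter> (nbr a c \<union> nbr a b)) C D" for C D
      unfolding N3_def X_def
      by (subst sum.union_disjoint[symmetric]) (auto intro!: sum.cong simp: fin)
    moreover have "N3 X (nbr a c) D = N3 X Y D + N3 X (nbr a c \<inter> nbr a b) D" for D
    proof -
      have "(\<Sum>y\<in>nbr a c. f y) = (\<Sum>y\<in>Y. f y) + (\<Sum>y\<in>nbr a c \<inter> nbr a b. f y)" for f :: "'a \<Rightarrow> real"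
        unfolding Y_def by (subst sum.union_disjoint[symmetric]) (auto intro!: sum.cong simp: fin)
      then show ?thesis unfolding N3_def by (simp add: sum.distrib)
    qed
    ultimately have "N3 (nbr b c) (nbr a c) (nbr a b) = N3 X Y Z + N3 X (nbr a c \<inter> nbr a b) (nbr a b)
       + N3 (nbr b c \<inter> (nbr a c \<union> nbr a b)) (nbr a c) (nbr a b)"
      by (simp add: Z_def)
    moreover have "N3 X (nbr a c \<inter> nbr a b) (nbr a b) \<le> n * real (card (nbr a c \<inter> nbr a b)) * n"
      by (rule order_trans[OF N3_le]) (intro mult_mono; auto simp: X_def intro!: card_mono finite_V)
    moreover have "N3 (nbr b c \<inter> (nbr a c \<union> nbr a b)) (nbr a c) (nbr a b) \<le>
        (real (card (nbr b c \<inter> nbr a c)) + real (card (nbr b c \<inter> nbr a b))) * n * n"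
    proof (rule order_trans[OF N3_le], intro mult_mono cle mult_nonneg_nonneg of_nat_0_le_iff add_nonneg_nonneg)
      show "real (card (nbr b c \<inter> (nbr a c \<union> nbr a b))) \<le> real (card (nbr b c \<inter> nbr a c)) + real (card (nbr b c \<inter> nbr a b))"
        unfolding of_nat_add[symmetric] of_nat_le_iff Int_Un_distrib by (rule card_Un_le)
    qed
    ultimately have "N3 (nbr b c) (nbr a c) (nbr a b) \<le> N3 X Y Z + n * real (card (nbr a c \<inter> nbr a b)) * n
       + (real (card (nbr b c \<inter> nbr a c)) + real (card (nbr b c \<inter> nbr a b))) * n * n"
      by linarith
    then show ?thesis
      by (simp add: ov_def algebra_simps power2_eq_square)
  qed
  have un: "X \<union> Y \<union> Z = {t \<in> V. nb h a b c t}"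
    by (auto simp: X_def Y_def Z_def nb_def)
  show thesis
  proof (rule that[of X Y Z])
    show "let m = real (card (X \<union> Y \<union> Z)) in 5000 * m ^ 3 + 40 * (n - m) * (10 * m - 3 * n) ^ 2 - 9 * n ^ 2 * (5 * m - 2 * n)
       - 135000 * N3 X Y Z \<le> 3000000000 * n ^ 2 + 300000 * \<eta> * n ^ 3"
      using le split unfolding un bracket_def Let_def \<kappa>_def by (simp add: algebra_simps)
  qed (auto simp: X_def Y_def Z_def)
qed

subsection \<open>Links and missing triples\<close>

definition N1 :: "'a \<Rightarrow> 'a \<Rightarrow> 'a set \<Rightarrow> real" where
  "N1 v y C = (\<Sum>z\<in>C. of_bool (h v y z))"

definition N2 :: "'a \<Rightarrow> 'a set \<Rightarrow> 'a set \<Rightarrow> real" where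
  "N2 v B C = (\<Sum>y\<in>B. \<Sum>z\<in>C. of_bool (h v y z))"

definition miss :: "'a \<Rightarrow> 'a set \<Rightarrow> 'a set \<Rightarrow> real" where
  "miss v B C = real (card B) * real (card C) - N2 v B C"

definition missing :: "'a set \<Rightarrow> 'a set \<Rightarrow> 'a set \<Rightarrow> real" where
  "missing A B C = real (card A) * real (card B) * real (card C) - N3 A B C"

lemma N2_N1: "N2 v B C = (\<Sum>y\<in>B. N1 v y C)"
  by (simp add: N2_def N1_def)

lemma N3_N2: "N3 A B C = (\<Sum>v\<in>A. N2 v B C)"
  by (simp add: N3_def N2_def)

lemma N1_nonneg: "0 \<le> N1 v y C" and N2_nonneg: "0 \<le> N2 v B C"
  by (simp_all add: N1_def N2_def sum_nonneg)

lemma N1_le: "N1 v y C \<le> real (card C)"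
proof -
  have "N1 v y C \<le> (\<Sum>z\<in>C. 1)" unfolding N1_def by (intro sum_mono) simp
  then show ?thesis by simp
qed

lemma N2_le: "N2 v B C \<le> real (card B) * real (card C)"
proof -
  have "N2 v B C \<le> (\<Sum>y\<in>B. real (card C))" unfolding N2_N1 by (intro sum_mono N1_le)
  then show ?thesis by simp
qed

lemma miss_nonneg: "0 \<le> miss v B C"
  using N2_le by (simp add: miss_def)

lemma N2_commute: "N2 v B C = N2 v C B"
  unfolding N2_def by (subst sum.swap) (simp add: swap23)

lemma miss_commute: "miss v B C = miss v C B"
  by (simp add: miss_def N2_commute[of v B C])

lemma N3_commute12: "N3 A B C = N3 B A C"
  unfolding N3_def by (subst sum.swap) (simp add: swap12)

lemma N3_commute23: "N3 A B C = N3 A C B"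
  by (simp add: N3_N2 N2_commute[of _ B C])

lemma missing_commute12: "missing A B C = missing B A C"
  by (simp add: missing_def N3_commute12[of A B C])

lemma missing_commute23: "missing A B C = missing A C B"
  by (simp add: missing_def N3_commute23[of A B C])

lemma missing_eq_sum: "missing A B C = (\<Sum>v\<in>A. miss v B C)"
  by (simp add: missing_def miss_def N3_N2 sum_subtractf mult_ac)

lemma missing_nonneg: "0 \<le> missing A B C"
  unfolding missing_eq_sum by (intro sum_nonneg miss_nonneg)

lemma miss_eq_sum: "miss v B C = (\<Sum>y\<in>B. \<Sum>z\<in>C. of_bool (\<not> h v y z))"
  by (simp add: miss_def N2_def of_bool_not_iff sum_subtractf)

lemma missing_eq_sum3: "missing A B C = (\<Sum>x\<in>A. \<Sum>y\<in>B. \<Sum>z\<in>C. of_bool (\<not> h x y z))"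
  by (simp add: missing_eq_sum miss_eq_sum)

text \<open>For \<open>z\<close> in \<open>C\<close> with \<open>h v b z\<close> and
  \<open>x\<close> in \<open>A\<close>, the order \<open>b'\<close>, \<open>v\<close>,
  \<open>b\<close>, \<open>z\<close>, \<open>x\<close> gives a copy of C_5^{3-} unless
  \<open>b x z\<close> or \<open>b' x z\<close> is a non-edge. The \<open>- 1\<close> discards
  \<open>x = v\<close>, since \<open>v\<close> may lie in \<open>A\<close>.\<close>

lemma N1_bad_pair:
  assumes fin: "finite A" "finite C" and b: "b \<in> B" "b' \<in> B" "h v b b'"
    and disj: "A \<inter> B = {}" "A \<inter> C = {}" "B \<inter> C = {}" and v: "v \<notin> C"
  shows "N1 v b C * (real (card A) - 1) \<le> miss b A C + miss b' A C"
proof -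
  have ne: "v \<noteq> b" "v \<noteq> b'" "b \<noteq> b'" using edge[OF b(3)] by auto
  have "(\<Sum>x\<in>A - {v}. of_bool (h v b z)) \<le> (\<Sum>x\<in>A - {v}. of_bool (\<not> h b x z) + of_bool (\<not> h b' x z) :: real)"
    if z: "z \<in> C" for z
  proof (intro sum_mono)
    fix x assume x: "x \<in> A - {v}"
    have "\<not> (h v b z \<and> h b x z \<and> h b' x z)"
    proof
      assume hh: "h v b z \<and> h b x z \<and> h b' x z"
      have "distinct [b', v, b, z, x]"
        using ne x z b disj v edge[of v b z] hh by auto
      from c5[OF this] show False
        using hh b(3) swap12 swap23 by metis
    qed
    then show "of_bool (h v b z) \<le> of_bool (\<not> h b x z) + (of_bool (\<not> h b' x z) :: real)"
      by auto
  qed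
  then have "(\<Sum>z\<in>C. \<Sum>x\<in>A - {v}. of_bool (h v b z)) \<le> (\<Sum>z\<in>C. \<Sum>x\<in>A - {v}. of_bool (\<not> h b x z) + of_bool (\<not> h b' x z) :: real)"
    by (rule sum_mono)
  also have "\<dots> \<le> (\<Sum>z\<in>C. \<Sum>x\<in>A. of_bool (\<not> h b x z) + of_bool (\<not> h b' x z))"
    by (intro sum_mono sum_mono2) (use fin in auto)
  also have "\<dots> = miss b A C + miss b' A C"
    by (subst sum.swap) (simp add: miss_eq_sum sum.distrib)
  finally have "N1 v b C * real (card (A - {v})) \<le> miss b A C + miss b' A C"
    by (simp add: N1_def sum_distrib_right mult.commute[of "real (card (A - {v}))"])
  moreover have "N1 v b C * (real (card A) - 1) \<le> N1 v b C * real (card (A - {v}))"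
    using fin by (intro mult_left_mono N1_nonneg) (auto simp: card_Diff_singleton_if of_nat_diff)
  ultimately show ?thesis by linarith
qed

text \<open>Mantel's bound is applied to this set instead of \<open>S\<close>. As its size is at
  most linear in the loss of \<open>v\<close>, the edges gained inside \<open>S\<close> are
  quadratic in that loss.\<close>

definition supp :: "'a \<Rightarrow> 'a set \<Rightarrow> 'a set" where
  "supp v S = {y \<in> S. \<exists>z\<in>S. h v y z}"

text \<open>Every \<open>b\<close> in the support has a partner \<open>b'\<close>, so by
  \<open>N1_bad_pair\<close> the pair \<open>v b\<close> misses most of \<open>C\<close>. The first
  bound charges \<open>\<tau>\<close> for both endpoints. The second adds up the actual losses of
  the \<open>b\<close>, which total at most \<open>missing A B C\<close>, and charges
  \<open>\<tau>\<close> for the partner only; it is the sharper one when \<open>v\<close> itself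
  loses much.\<close>

lemma supp_bound:
  assumes fin: "finite A" "finite B" "finite C" and disj: "A \<inter> B = {}" "A \<inter> C = {}" "B \<inter> C = {}"
    and v: "v \<notin> C" and \<tau>: "\<And>b. b \<in> B \<Longrightarrow> miss b A C \<le> \<tau>" and a: "1 < real (card A)"
  shows "real (card (supp v B)) * (real (card C) - 2 * \<tau> / (real (card A) - 1)) \<le> miss v B C"
    and "real (card (supp v B)) * (real (card C) - \<tau> / (real (card A) - 1)) \<le> miss v B C + missing A B C / (real (card A) - 1)"
proof -
  let ?a = "real (card A) - 1"
  have sub: "supp v B \<subseteq> B" by (auto simp: supp_def)
  have fs: "finite (supp v B)" using fin sub by (auto intro: finite_subset)
  have N1: "N1 v b C \<le> (miss b A C + \<tau>) / ?a" if "b \<in> supp v B" for b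
  proof -
    obtain b' where b': "b \<in> B" "b' \<in> B" "h v b b'" using \<open>b \<in> supp v B\<close> by (auto simp: supp_def)
    from N1_bad_pair[OF fin(1,3) b' disj v] have "N1 v b C * ?a \<le> miss b A C + miss b' A C" .
    also have "\<dots> \<le> miss b A C + \<tau>" using \<tau>[OF b'(2)] by simp
    finally show ?thesis using a by (simp add: pos_le_divide_eq)
  qed
  have miss: "(\<Sum>b\<in>supp v B. real (card C) - N1 v b C) \<le> miss v B C"
  proof -
    have "(\<Sum>b\<in>supp v B. real (card C) - N1 v b C) \<le> (\<Sum>b\<in>B. real (card C) - N1 v b C)"
      by (intro sum_mono2 fin sub) (use N1_le in auto)
    then show ?thesis by (simp add: miss_def N2_N1 sum_subtractf)
  qed
  have "real (card (supp v B)) * (real (card C) - 2 * \<tau> / ?a) = (\<Sum>b\<in>supp v B. real (card C) - 2 * \<tau> / ?a)"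
    by simp
  also have "\<dots> \<le> (\<Sum>b\<in>supp v B. real (card C) - N1 v b C)"
  proof (intro sum_mono diff_left_mono)
    fix b assume b: "b \<in> supp v B"
    have "(miss b A C + \<tau>) / ?a \<le> 2 * \<tau> / ?a"
      using \<tau>[of b] b sub a by (intro divide_right_mono) auto
    with N1[OF b] show "N1 v b C \<le> 2 * \<tau> / ?a" by linarith
  qed
  finally show "real (card (supp v B)) * (real (card C) - 2 * \<tau> / ?a) \<le> miss v B C"
    using miss by linarith
  have "real (card (supp v B)) * (real (card C) - \<tau> / ?a) - missing A B C / ?a
      \<le> real (card (supp v B)) * (real (card C) - \<tau> / ?a) - (\<Sum>b\<in>supp v B. miss b A C) / ?a"
  proof -
    have "(\<Sum>b\<in>supp v B. miss b A C) \<le> (\<Sum>b\<in>B. miss b A C)"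
      by (intro sum_mono2 fin sub miss_nonneg)
    also have "\<dots> = missing A B C" using missing_commute12[of A B C] missing_eq_sum[of B A C] by simp
    finally show ?thesis using a by (simp add: divide_right_mono)
  qed
  also have "\<dots> = (\<Sum>b\<in>supp v B. real (card C) - (miss b A C + \<tau>) / ?a)"
    by (simp add: sum_subtractf sum_divide_distrib[symmetric] sum.distrib add_divide_distrib right_diff_distrib)
  also have "\<dots> \<le> (\<Sum>b\<in>supp v B. real (card C) - N1 v b C)"
    by (intro sum_mono diff_left_mono N1)
  finally show "real (card (supp v B)) * (real (card C) - \<tau> / ?a) \<le> miss v B C + missing A B C / ?a"
    using miss by linarith
qed

text \<open>Ordered triangles in the link of \<open>v\<close>, that is, copies of K_4^- centred at
  \<open>v\<close>.\<close>

definition tri :: "'a \<Rightarrow> real" where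
  "tri v = (\<Sum>x\<in>V. \<Sum>y\<in>V. \<Sum>z\<in>V. of_bool (h v x y \<and> h v x z \<and> h v y z))"

lemma tri_nonneg: "0 \<le> tri v"
  unfolding tri_def by (intro sum_nonneg) simp

lemma sum_tri_le: "(\<Sum>v\<in>V. tri v) \<le> n ^ 3"
proof -
  have "(\<Sum>v\<in>V. tri v) = (\<Sum>(a, b, c, d)\<in>V \<times> V \<times> V \<times> V. of_bool (h a b c \<and> h a b d \<and> h a c d))"
    unfolding tri_def sum.cartesian_product ..
  also have "\<dots> = (\<Sum>(b, c, d, a)\<in>V \<times> V \<times> V \<times> V. of_bool (h a b c \<and> h a b d \<and> h a c d))"
    by (rule sum.reindex_bij_witness[of _ "\<lambda>(b, c, d, a). (a, b, c, d)" "\<lambda>(a, b, c, d). (b, c, d, a)"]) auto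
  also have "\<dots> \<le> n ^ 3"
    using sum_K4_le by (simp add: sum.cartesian_product)
  finally show ?thesis .
qed

lemma N2_supp: assumes "finite S" shows "N2 v S S = N2 v (supp v S) (supp v S)"
proof -
  have sub: "supp v S \<subseteq> S" by (auto simp: supp_def)
  have "N2 v S S = (\<Sum>y\<in>supp v S. \<Sum>z\<in>S. of_bool (h v y z))"
    unfolding N2_def by (rule sum.mono_neutral_right) (use assms sub in \<open>auto simp: supp_def\<close>)
  also have "\<dots> = N2 v (supp v S) (supp v S)"
    unfolding N2_def
  proof (rule sum.cong[OF refl], rule sum.mono_neutral_right)
    fix y assume y: "y \<in> supp v S"
    show "\<forall>i\<in>S - supp v S. of_bool (h v y i) = (0 :: real)"
      using y swap23 unfolding supp_def by auto
  qed (use assms sub in auto)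
  finally show ?thesis .
qed

text \<open>Mantel's argument in a link graph; links are only almost triangle-free, since few copies of
  \<open>K\<^sub>4\<^sup>-\<close> may occur.\<close>

lemma mantel:
  assumes S: "S \<subseteq> V"
  shows "2 * N2 v S S ^ 2 \<le> real (card S) ^ 2 * N2 v S S + real (card S) * tri v"
proof -
  let ?d = "\<lambda>x. N1 v x S"
  let ?e = "\<lambda>x y. of_bool (h v x y) :: real"
  have fS: "finite S" using S finite_V by (rule finite_subset)
  have "(\<Sum>x\<in>S. ?d x) ^ 2 \<le> real (card S) * (\<Sum>x\<in>S. ?d x ^ 2)"
  proof -
    have "2 * (\<Sum>x\<in>S. ?d x) ^ 2 = (\<Sum>x\<in>S. \<Sum>y\<in>S. 2 * ?d x * ?d y)"
      unfolding power2_eq_square sum_product unfolding sum_distrib_left by (simp add: mult.assoc)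
    also have "\<dots> \<le> (\<Sum>x\<in>S. \<Sum>y\<in>S. ?d x ^ 2 + ?d y ^ 2)"
      by (intro sum_mono sum_squares_bound)
    finally show ?thesis
      by (simp add: sum.distrib sum_distrib_left[symmetric])
  qed
  then have cs: "N2 v S S ^ 2 \<le> real (card S) * (\<Sum>x\<in>S. ?d x ^ 2)"
    by (simp add: N2_N1)
  have "(\<Sum>x\<in>S. \<Sum>y\<in>S. ?e x y * (?d x + ?d y)) \<le>
      (\<Sum>x\<in>S. \<Sum>y\<in>S. ?e x y * (real (card S) + (\<Sum>z\<in>S. of_bool (h v x z \<and> h v y z))))"
  proof (intro sum_mono mult_left_mono)
    fix x y
    have "?d x + ?d y = (\<Sum>z\<in>S. of_bool (h v x z) + of_bool (h v y z))"
      by (simp add: N1_def sum.distrib)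
    also have "\<dots> \<le> (\<Sum>z\<in>S. 1 + of_bool (h v x z \<and> h v y z))"
      by (intro sum_mono) auto
    finally show "?d x + ?d y \<le> real (card S) + (\<Sum>z\<in>S. of_bool (h v x z \<and> h v y z))"
      by (simp add: sum.distrib)
  qed simp
  also have "\<dots> = real (card S) * N2 v S S + (\<Sum>x\<in>S. \<Sum>y\<in>S. \<Sum>z\<in>S. of_bool (h v x y \<and> h v x z \<and> h v y z))"
    by (simp add: N2_def distrib_left sum.distrib sum_distrib_left of_bool_conj mult_ac)
  also have "\<dots> \<le> real (card S) * N2 v S S + tri v"
  proof -
    have "(\<Sum>x\<in>S. \<Sum>y\<in>S. \<Sum>z\<in>S. of_bool (h v x y \<and> h v x z \<and> h v y z) :: real)
        \<le> (\<Sum>x\<in>S. \<Sum>y\<in>V. \<Sum>z\<in>V. of_bool (h v x y \<and> h v x z \<and> h v y z))"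
    proof (rule sum_mono)
      fix x
      have "(\<Sum>y\<in>S. \<Sum>z\<in>S. of_bool (h v x y \<and> h v x z \<and> h v y z) :: real)
         \<le> (\<Sum>y\<in>S. \<Sum>z\<in>V. of_bool (h v x y \<and> h v x z \<and> h v y z))"
        by (intro sum_mono sum_mono2 finite_V S) simp
      also have "\<dots> \<le> (\<Sum>y\<in>V. \<Sum>z\<in>V. of_bool (h v x y \<and> h v x z \<and> h v y z))"
        by (intro sum_mono2 finite_V S sum_nonneg) simp
      finally show "(\<Sum>y\<in>S. \<Sum>z\<in>S. of_bool (h v x y \<and> h v x z \<and> h v y z) :: real)
         \<le> (\<Sum>y\<in>V. \<Sum>z\<in>V. of_bool (h v x y \<and> h v x z \<and> h v y z))" .
    qed
    also have "\<dots> \<le> tri v"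
      unfolding tri_def by (intro sum_mono2 finite_V S sum_nonneg) simp
    finally show ?thesis by simp
  qed
  also have "(\<Sum>x\<in>S. \<Sum>y\<in>S. ?e x y * (?d x + ?d y)) = 2 * (\<Sum>x\<in>S. ?d x ^ 2)"
  proof -
    have "(\<Sum>x\<in>S. \<Sum>y\<in>S. ?e x y * ?d x) = (\<Sum>x\<in>S. ?d x ^ 2)"
      by (simp add: N1_def power2_eq_square sum_distrib_right)
    moreover have "(\<Sum>x\<in>S. \<Sum>y\<in>S. ?e x y * ?d y) = (\<Sum>x\<in>S. \<Sum>y\<in>S. ?e x y * ?d x)"
      by (subst sum.swap) (simp add: swap23[of v])
    ultimately show ?thesis by (simp add: distrib_left sum.distrib)
  qed
  finally have "2 * (\<Sum>x\<in>S. ?d x ^ 2) \<le> real (card S) * N2 v S S + tri v" .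
  from mult_left_mono[OF this, of "real (card S)"] cs show ?thesis
    by (simp add: algebra_simps power2_eq_square)
qed

text \<open>If Mantel's bound were exceeded by \<epsilon> n^2, then \<open>mantel\<close> would
  force at least 2 \<epsilon>^2 n^3 triangles, and the last term alone would be at least n^2. The
  error is linear in \<open>tri v\<close> because only the sum of \<open>tri\<close> over all
  vertices is controlled.\<close>

lemma N2_le_supp:
  assumes S: "S \<subseteq> V" and \<epsilon>: "0 < \<epsilon>" and n: "0 < n"
  shows "N2 v S S \<le> real (card (supp v S)) ^ 2 / 2 + \<epsilon> * n ^ 2 + tri v / (2 * \<epsilon> ^ 2 * n)"
proof (rule ccontr)
  define D k where "D = N2 v S S" and "k = real (card (supp v S))"
  assume "\<not> ?thesis"
  then have gt: "k ^ 2 / 2 + \<epsilon> * n ^ 2 + tri v / (2 * \<epsilon> ^ 2 * n) < D"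
    by (simp add: D_def k_def)
  have sub: "supp v S \<subseteq> V" using S by (auto simp: supp_def)
  have fS: "finite S" using S finite_V by (rule finite_subset)
  have k: "0 \<le> k" "k \<le> n" unfolding k_def using sub finite_V by (auto intro: card_mono)
  have t: "0 \<le> tri v / (2 * \<epsilon> ^ 2 * n)" using tri_nonneg n \<epsilon> by simp
  have D1: "\<epsilon> * n ^ 2 < D" using gt t zero_le_power2[of k] by linarith
  have pos: "0 < \<epsilon> * n ^ 2" using \<epsilon> n by simp
  have "D * (2 * D - k ^ 2) \<le> k * tri v"
    using mantel[OF sub, of v] N2_supp[OF fS, of v] by (simp add: D_def k_def algebra_simps power2_eq_square)
  also have "\<dots> \<le> n * tri v" using k tri_nonneg by (intro mult_right_mono)
  finally have le: "D * (2 * D - k ^ 2) \<le> n * tri v" .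
  have "2 * \<epsilon> * n ^ 2 \<le> 2 * D - k ^ 2" using gt t by linarith
  then have "(\<epsilon> * n ^ 2) * (2 * \<epsilon> * n ^ 2) \<le> D * (2 * D - k ^ 2)"
    using D1 pos \<epsilon> by (intro mult_mono) auto
  with le have "2 * \<epsilon> ^ 2 * n ^ 4 \<le> n * tri v"
    by (simp add: power2_eq_square power_numeral_reduce mult_ac)
  then have "n * (n ^ 2 * (2 * \<epsilon> ^ 2 * n)) \<le> n * tri v"
    by (simp add: power2_eq_square power_numeral_reduce mult_ac)
  then have "n ^ 2 * (2 * \<epsilon> ^ 2 * n) \<le> tri v"
    using n by (simp only: mult_le_cancel_left_pos)
  then have "n ^ 2 \<le> tri v / (2 * \<epsilon> ^ 2 * n)"
    using n \<epsilon> by (simp add: pos_le_divide_eq)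
  with gt pos zero_le_power2[of k] have "n ^ 2 < D" by linarith
  moreover have "D \<le> real (card S) * real (card S)" unfolding D_def by (rule N2_le)
  moreover have "real (card S) * real (card S) \<le> n * n"
    using S finite_V by (intro mult_mono) (auto intro: card_mono)
  ultimately show False by (simp add: power2_eq_square)
qed

text \<open>For \<open>h v x b\<close> and \<open>h v b' z\<close> with distinct \<open>b\<close>,
  \<open>b'\<close>, the order \<open>v\<close>, \<open>b\<close>, \<open>x\<close>,
  \<open>z\<close>, \<open>b'\<close> gives a copy of C_5^{3-} unless \<open>x b z\<close> or
  \<open>x b' z\<close> is missing. Hence the link of a vertex outside the parts cannot be dense
  between two different pairs of parts.\<close>

lemma link_product:
  assumes disj: "A \<inter> B = {}" "A \<inter> C = {}" "B \<inter> C = {}" and v: "v \<notin> A" "v \<notin> B" "v \<notin> C"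
  shows "N2 v A B * N2 v B C \<le> 2 * real (card B) * missing A B C + real (card A) * real (card B) * real (card C)"
proof (cases "finite B")
  case True
  have "N2 v A B * N2 v B C = (\<Sum>x\<in>A. \<Sum>b\<in>B. \<Sum>b'\<in>B. \<Sum>z\<in>C. of_bool (h v x b) * of_bool (h v b' z))"
    unfolding N2_def[of v A B] sum_distrib_right unfolding N2_def sum_distrib_left ..
  also have "\<dots> \<le> (\<Sum>x\<in>A. \<Sum>b\<in>B. \<Sum>b'\<in>B. \<Sum>z\<in>C. of_bool (b = b') + of_bool (\<not> h x b z) + of_bool (\<not> h x b' z))"
  proof (intro sum_mono)
    fix x b b' z assume xs: "x \<in> A" "b \<in> B" "b' \<in> B" "z \<in> C"
    have "\<not> (h v x b \<and> h v b' z \<and> b \<noteq> b' \<and> h x b z \<and> h x b' z)"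
    proof
      assume hh: "h v x b \<and> h v b' z \<and> b \<noteq> b' \<and> h x b z \<and> h x b' z"
      have "distinct [v, b, x, z, b']" using hh xs disj v by auto
      from c5[OF this] show False using hh swap12 swap23 by metis
    qed
    then show "of_bool (h v x b) * of_bool (h v b' z) \<le> of_bool (b = b') + of_bool (\<not> h x b z) + (of_bool (\<not> h x b' z) :: real)"
      by auto
  qed
  also have "\<dots> = real (card A) * real (card B) * real (card C) + 2 * real (card B) * missing A B C"
  proof -
    have "(\<Sum>x\<in>A. \<Sum>b\<in>B. \<Sum>b'\<in>B. \<Sum>z\<in>C. of_bool (b = b') :: real) = real (card A) * real (card B) * real (card C)"
      using True by (simp add: sum_distrib_left[symmetric] of_bool_def sum.delta)
    moreover have "(\<Sum>x\<in>A. \<Sum>b\<in>B. \<Sum>b'\<in>B. \<Sum>z\<in>C. of_bool (\<not> h x b z)) = real (card B) * missing A B C"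
      by (simp add: missing_eq_sum3 sum_distrib_left)
    moreover have "(\<Sum>x\<in>A. \<Sum>b\<in>B. \<Sum>b'\<in>B. \<Sum>z\<in>C. of_bool (\<not> h x b' z)) = real (card B) * missing A B C"
      by (simp add: missing_eq_sum3 sum_distrib_left)
    ultimately show ?thesis by (simp add: sum.distrib)
  qed
  finally show ?thesis by simp
qed (simp add: N2_def)

end

section \<open>The tripartition\<close>

lemma amgm3:
  fixes x y z :: real
  assumes "0 \<le> x" "0 \<le> y" "0 \<le> z"
  shows "27 * (x * y * z) \<le> (x + y + z) ^ 3"
proof -
  have "0 \<le> x * (y - z) ^ 2" "0 \<le> y * (x - z) ^ 2" "0 \<le> z * (x - y) ^ 2"
    "0 \<le> (x + y + z) * ((x - y) ^ 2 + (x - z) ^ 2 + (y - z) ^ 2)"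
    using assms by auto
  then show ?thesis
    by (simp add: power2_eq_square power3_eq_cube algebra_simps)
qed

text \<open>\<open>m\<close> is the covered fraction of the vertices and \<open>c\<close> the
  transversal density. The factorised form in the proof rules out \<open>m < 98 / 100\<close>.
  Beyond that point the non-AM-GM terms are at least -27 + 1893 (1 - m), and dividing by 135000
  turns 27.27 into 0.000202 and 1893 into 0.014.\<close>

lemma budget:
  fixes x y z c :: real
  assumes "0 \<le> x" "0 \<le> y" "0 \<le> z" "x + y + z = m" "m \<le> 1" "c \<le> x * y * z"
    and le: "5000 * m ^ 3 + 40 * (1 - m) * (10 * m - 3) ^ 2 - 9 * (5 * m - 2) - 135000 * c \<le> 27 / 100"
  shows "98 / 100 \<le> m" and "m ^ 3 / 27 - c + 14 / 1000 * (1 - m) \<le> 202 / 1000000"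
proof -
  have c: "0 \<le> m ^ 3 / 27 - c"
    using amgm3[OF assms(1-3)] assms(4,6) by simp
  have f: "40 * (1 - m) * (10 * m - 3) ^ 2 - 9 * (5 * m - 2)
     = 4000 * (98 / 100 - m) * (m - 31 / 100) ^ 2 + 98 / 10 * m + 1288 / 1000"
    by (simp add: power2_eq_square field_simps)
  define P where "P = 40 * (1 - m) * (10 * m - 3) ^ 2 - 9 * (5 * m - 2)"
  have leP: "5000 * m ^ 3 + P - 135000 * c \<le> 27 / 100" unfolding P_def using le by linarith
  have c': "0 \<le> 5000 * m ^ 3 - 135000 * c" using c by linarith
  show m: "98 / 100 \<le> m"
  proof (rule ccontr)
    assume "\<not> 98 / 100 \<le> m"
    then have "0 \<le> 4000 * (98 / 100 - m) * (m - 31 / 100) ^ 2" by simp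
    then have "98 / 10 * m + 1288 / 1000 \<le> P" unfolding P_def f by linarith
    moreover have "0 \<le> m" using assms by linarith
    ultimately show False using leP c' by linarith
  qed
  define r where "r = 1 - m"
  have r: "0 \<le> r" "r \<le> 2 / 100" "m = 1 - r" using m assms by (auto simp: r_def)
  have "40 * (1 - m) * (10 * m - 3) ^ 2 - 9 * (5 * m - 2) = - 27 + 1893 * r + 5600 * (r * (2 / 100 - r)) + 4000 * (r * (r * r))"
    unfolding r(3) by (simp add: power2_eq_square field_simps)
  moreover have "0 \<le> r * (2 / 100 - r)" "0 \<le> r * (r * r)" using r by auto
  ultimately have "- 27 + 1893 * r \<le> P" unfolding P_def by linarith
  then have "135000 * (m ^ 3 / 27 - c) \<le> 2727 / 100 - 1893 * r" using leP by argo
  then show "m ^ 3 / 27 - c + 14 / 1000 * (1 - m) \<le> 202 / 1000000"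
    unfolding r_def using assms(5) by argo
qed

text \<open>\<open>w\<close> is the fraction of vertices deleted in the clean-up, in the worst case
  all from this part. If \<open>x\<close> falls short of m/3 by \<delta>, then AM-GM for the other
  two parts shows that the product loses \<delta>^2 (m + \<delta>)/4.\<close>

lemma part_size:
  fixes x y z :: real
  assumes "0 \<le> x" "0 \<le> y" "0 \<le> z" "x + y + z = m" "m \<le> 1" "98 / 100 \<le> m" "0 \<le> w"
    and le: "m ^ 3 / 27 - x * y * z + 138 / 10000 * (1 - m + w) \<le> 202 / 1000000"
  shows "304 / 1000 \<le> x - w"
proof -
  define \<delta> where "\<delta> = m / 3 - x"
  have x: "x = m / 3 - \<delta>" by (simp add: \<delta>_def)
  have "y * z \<le> ((m - x) / 2) ^ 2"
  proof -
    have "0 \<le> (y - z) ^ 2" by simp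
    then show ?thesis using assms(4) by (simp add: power2_eq_square field_simps) (simp add: algebra_simps flip: assms(4))
  qed
  then have "x * (y * z) \<le> x * ((m - x) / 2) ^ 2" using assms(1) by (rule mult_left_mono)
  then have "m ^ 3 / 27 - x * ((m - x) / 2) ^ 2 \<le> m ^ 3 / 27 - x * y * z" by (simp add: mult.assoc)
  moreover have "m ^ 3 / 27 - x * ((m - x) / 2) ^ 2 = \<delta> ^ 2 / 4 * (m + \<delta>)"
    unfolding x by (simp add: power2_eq_square power3_eq_cube field_simps)
  ultimately have d: "\<delta> ^ 2 / 4 * (m + \<delta>) \<le> m ^ 3 / 27 - x * y * z" by simp
  show ?thesis
  proof (cases "\<delta> \<le> 0")
    case True
    have "0 \<le> \<delta> ^ 2 / 4 * (m + \<delta>)" using assms(1-6) x by (intro mult_nonneg_nonneg) auto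
    then have "138 / 10000 * (1 - m + w) \<le> 202 / 1000000" using d le by linarith
    then show ?thesis using True x assms by simp
  next
    case False
    have "\<delta> ^ 2 / 4 * (98 / 100) \<le> \<delta> ^ 2 / 4 * (m + \<delta>)"
      using False assms by (intro mult_left_mono) auto
    \<comment> \<open>The tangent to the square at 0.02816, where the slope 0.245 * 2 * 0.02816
      nearly equals the weight 0.0138; deficit and deletions then enter a single linear
      bound.\<close>
    moreover have "0 \<le> (\<delta> - 2816 / 100000) ^ 2" by simp
    then have "\<delta> ^ 2 \<ge> 2 * (2816 / 100000) * \<delta> - 7929856 / 10000000000"
      by (simp add: power2_eq_square algebra_simps)
    moreover define E where "E = m ^ 3 / 27 - x * y * z"
    moreover have "E + 138 / 10000 * (1 - m + w) \<le> 202 / 1000000" unfolding E_def by (rule le)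
    moreover have "\<delta> ^ 2 / 4 * (m + \<delta>) \<le> E" unfolding E_def by (rule d)
    ultimately have "137984 / 10000000 * \<delta> + 138 / 10000 * (1 - m + w) \<le> 3964 / 10000000"
      by argo
    then show ?thesis using False x assms(5-7) by argo
  qed
qed

context c5_free begin

lemma missing_remove:
  assumes "finite A" "v \<in> A"
  shows "missing (A - {v}) B C = missing A B C - miss v B C"
  using assms by (simp add: missing_eq_sum sum_diff1)

lemma missing_insert:
  assumes "finite A" "v \<notin> A"
  shows "missing (insert v A) B C = missing A B C + miss v B C"
  using assms by (simp add: missing_eq_sum)

lemma N2_mono: "finite B \<Longrightarrow> finite C \<Longrightarrow> B' \<subseteq> B \<Longrightarrow> C' \<subseteq> C \<Longrightarrow> N2 v B' C' \<le> N2 v B C"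
proof -
  assume a: "finite B" "finite C" "B' \<subseteq> B" "C' \<subseteq> C"
  have "N2 v B' C' \<le> (\<Sum>y\<in>B'. \<Sum>z\<in>C. of_bool (h v y z))"
    unfolding N2_def by (intro sum_mono sum_mono2 a) simp
  also have "\<dots> \<le> N2 v B C"
    unfolding N2_def by (intro sum_mono2 a sum_nonneg) simp
  finally show ?thesis .
qed

lemma missing_rotate: "missing A B C = missing C A B"
  using missing_commute23[of A B C] missing_commute12[of A C B] by simp

text \<open>First-order optimality: at a minimiser of \<open>missing\<close> minus
  \<open>\<tau>\<close> times the number of vertices, deleting a vertex does not help, so it misses
  at most \<open>\<tau>\<close> pairs. \<open>miss_ge_of_insert\<close> is the counterpart for
  insertion.\<close>

lemma miss_le_of_remove:
  assumes "missing A B C - \<tau> * s \<le> missing (A - {v}) B C - \<tau> * s'" "s = s' + 1" "finite A" "v \<in> A"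
  shows "miss v B C \<le> \<tau>"
  using assms by (simp add: missing_remove algebra_simps)

lemma miss_ge_of_insert:
  assumes "missing A B C - \<tau> * s \<le> missing (insert v A) B C - \<tau> * s'" "s' = s + 1" "finite A" "v \<notin> A"
  shows "\<tau> \<le> miss v B C"
  using assms by (simp add: missing_insert algebra_simps)

text \<open>
  The vertices outside \<open>A \<union> B \<union> C\<close> are the exceptional ones; \<open>miss v B C\<close> counts the non-edges \<open>v y z\<close> with
  \<open>y \<in> B\<close> and \<open>z \<in> C\<close>. The constants satisfy 0.0196 \<open>\<ge>\<close> 0.0138 + 0.392 * 0.01464 and
  0.000287 \<open>\<ge>\<close> 0.000202 * 0.0196 / 0.0138, where 0.000202 is the budget from the certificate, 0.0138 the threshold
  for deleting a vertex and 0.0196 the threshold for adding one.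
\<close>

definition config :: "'a set \<Rightarrow> 'a set \<Rightarrow> 'a set \<Rightarrow> bool" where
  "config A B C \<longleftrightarrow> A \<subseteq> V \<and> B \<subseteq> V \<and> C \<subseteq> V \<and> A \<inter> B = {} \<and> A \<inter> C = {} \<and> B \<inter> C = {} \<and>
     304 / 1000 * n \<le> real (card A) \<and> 304 / 1000 * n \<le> real (card B) \<and> 304 / 1000 * n \<le> real (card C) \<and>
     (\<forall>v\<in>A. miss v B C \<le> 196 / 10000 * n ^ 2) \<and> (\<forall>v\<in>B. miss v A C \<le> 196 / 10000 * n ^ 2) \<and>
     (\<forall>v\<in>C. miss v A B \<le> 196 / 10000 * n ^ 2) \<and>
     (\<forall>v\<in>V - (A \<union> B \<union> C). 196 / 10000 * n ^ 2 \<le> miss v B C \<and> 196 / 10000 * n ^ 2 \<le> miss v A C \<and>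
        196 / 10000 * n ^ 2 \<le> miss v A B) \<and>
     missing A B C + 196 / 10000 * n ^ 2 * real (card (V - (A \<union> B \<union> C))) \<le> 287 / 1000000 * n ^ 3"

lemma config_swap12: "config A B C \<Longrightarrow> config B A C"
  unfolding config_def by (simp add: missing_commute12[of B A] miss_commute[of _ B A] Int_commute[of B A] Un_commute[of B A])

lemma config_swap23: "config A B C \<Longrightarrow> config A C B"
  unfolding config_def
  by (simp add: missing_commute23[of A C B] miss_commute[of _ C B] Int_commute[of C B] Un_assoc Un_commute[of C B])

lemma arg_min_triple:
  fixes f :: "'a set \<Rightarrow> 'a set \<Rightarrow> 'a set \<Rightarrow> real"
  assumes "P A0 B0 C0" and "\<And>A B C. P A B C \<Longrightarrow> A \<subseteq> V \<and> B \<subseteq> V \<and> C \<subseteq> V"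
  obtains A B C where "P A B C" "\<And>A' B' C'. P A' B' C' \<Longrightarrow> f A B C \<le> f A' B' C'"
proof -
  let ?S = "{(A, B, C). P A B C}"
  have "?S \<subseteq> Pow V \<times> Pow V \<times> Pow V" using assms(2) by blast
  then have "finite ?S" using finite_V by (meson finite_Pow_iff finite_SigmaI finite_subset)
  moreover have "?S \<noteq> {}" using assms(1) by blast
  ultimately obtain s where s: "is_arg_min (\<lambda>(A, B, C). f A B C) (\<lambda>s. s \<in> ?S) s"
    using ex_is_arg_min_if_finite by blast
  obtain A B C where "s = (A, B, C)" by (metis surj_pair)
  with s show thesis by (intro that[of A B C]) (auto simp: is_arg_min_linorder)
qed

text \<open>Both clean-ups minimise \<open>missing\<close> minus a threshold times the number of
  vertices. Optimality gives the conditions on single vertices, and comparison with the starting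
  triple gives the bound on the total loss.\<close>

lemma exists_config:
  assumes d: "dense \<rho> \<eta>" and \<eta>: "\<eta> \<le> 4 / 10000000" and n: "30000000000 \<le> n"
  obtains A B C where "config A B C"
proof -
  have n0: "0 < n" using n by linarith
  obtain X Y Z where sub: "X \<subseteq> V" "Y \<subseteq> V" "Z \<subseteq> V" and disj: "X \<inter> Y = {}" "X \<inter> Z = {}" "Y \<inter> Z = {}"
    and br: "let m = real (card (X \<union> Y \<union> Z)) in 5000 * m ^ 3 + 40 * (n - m) * (10 * m - 3 * n) ^ 2 - 9 * n ^ 2 * (5 * m - 2 * n)
     - 135000 * N3 X Y Z \<le> 3000000000 * n ^ 2 + 300000 * \<eta> * n ^ 3"
    using exists_good_triple[OF d _ n0] \<eta> by auto
  note fin = sub[THEN finite_subset, OF finite_V]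
  define x y z where "x = real (card X) / n" and "y = real (card Y) / n" and "z = real (card Z) / n"
  have X: "real (card X) = x * n" "real (card Y) = y * n" "real (card Z) = z * n"
    using n0 by (simp_all add: x_def y_def z_def)
  have xyz0: "0 \<le> x" "0 \<le> y" "0 \<le> z" using n0 by (simp_all add: x_def y_def z_def)
  define m where "m = x + y + z"
  have cU: "real (card (A \<union> B \<union> C)) = real (card A) + real (card B) + real (card C)"
    if "finite A" "finite B" "finite C" "A \<inter> B = {}" "A \<inter> C = {}" "B \<inter> C = {}" for A B C :: "'a set"
    using that by (simp add: card_Un_disjoint Int_Un_distrib2)
  have mn: "real (card (X \<union> Y \<union> Z)) = m * n"
    using cU[OF fin disj] by (simp add: X m_def algebra_simps)
  have "real (card (X \<union> Y \<union> Z)) \<le> n" using sub finite_V by (simp add: card_mono)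
  then have m1: "m \<le> 1" using mn n0 by simp
  define c where "c = N3 X Y Z / n ^ 3"
  have c: "N3 X Y Z = c * n ^ 3" using n0 by (simp add: c_def)
  have cle: "c \<le> x * y * z"
  proof -
    have "c * n ^ 3 \<le> x * y * z * n ^ 3"
      using N3_le[of X Y Z] unfolding c X by (simp add: power3_eq_cube mult_ac)
    then show ?thesis using n0 by simp
  qed
  have "(5000 * m ^ 3 + 40 * (1 - m) * (10 * m - 3) ^ 2 - 9 * (5 * m - 2) - 135000 * c) * n ^ 3
     \<le> 3000000000 * n ^ 2 + 300000 * \<eta> * n ^ 3"
    using br unfolding mn c Let_def by (simp add: power2_eq_square power3_eq_cube algebra_simps)
  \<comment> \<open>The bounds on \<open>n\<close> and \<open>\<eta>\<close> are chosen here: the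
    two errors stay within the 0.27 that \<open>budget\<close> allows.\<close>
  also have "\<dots> \<le> 1 / 10 * n ^ 3 + 12 / 100 * n ^ 3"
  proof (rule add_mono)
    show "3000000000 * n ^ 2 \<le> 1 / 10 * n ^ 3"
      using mult_right_mono[OF n, of "n ^ 2 / 10"] by (simp add: power2_eq_square power3_eq_cube)
    show "300000 * \<eta> * n ^ 3 \<le> 12 / 100 * n ^ 3"
      using \<eta> n0 by (intro mult_right_mono) auto
  qed
  also have "\<dots> \<le> 27 / 100 * n ^ 3" using n0 by simp
  finally have br': "5000 * m ^ 3 + 40 * (1 - m) * (10 * m - 3) ^ 2 - 9 * (5 * m - 2) - 135000 * c \<le> 27 / 100"
    using n0 by simp
  note m98 = budget(1)[OF xyz0 m_def[symmetric] m1 cle br'] and bud = budget(2)[OF xyz0 m_def[symmetric] m1 cle br']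

  \<comment> \<open>First drop the vertices that miss too much, then add back every vertex that fits into some part.\<close>
  let ?\<tau> = "138 / 10000 * n ^ 2"
  obtain A0 B0 C0 where S0: "A0 \<subseteq> X \<and> B0 \<subseteq> Y \<and> C0 \<subseteq> Z"
    and min0: "\<And>A B C. A \<subseteq> X \<and> B \<subseteq> Y \<and> C \<subseteq> Z \<Longrightarrow>
       missing A0 B0 C0 - ?\<tau> * (real (card A0) + real (card B0) + real (card C0))
       \<le> missing A B C - ?\<tau> * (real (card A) + real (card B) + real (card C))"
    by (rule arg_min_triple[of "\<lambda>A B C. A \<subseteq> X \<and> B \<subseteq> Y \<and> C \<subseteq> Z" X Y Z
        "\<lambda>A B C. missing A B C - ?\<tau> * (real (card A) + real (card B) + real (card C))"]) (use sub in auto)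
  have fin0: "finite A0" "finite B0" "finite C0" using S0 fin by (auto intro: finite_subset)
  have card_remove: "real (card (A - {v})) = real (card A) - 1" if "finite A" "v \<in> A" for A :: "'a set" and v
    using that card_gt_0_iff[of A] by (auto simp: card_Diff_singleton of_nat_diff)
  have mA0: "miss v B0 C0 \<le> ?\<tau>" if "v \<in> A0" for v
    by (rule miss_le_of_remove[OF min0[of "A0 - {v}" B0 C0]]) (use S0 fin0 that in \<open>auto simp: card_remove simp del: card_Diff_singleton card_Diff_insert\<close>)
  have mB0: "miss v A0 C0 \<le> ?\<tau>" if "v \<in> B0" for v
    by (rule miss_le_of_remove[OF min0[of A0 "B0 - {v}" C0, unfolded missing_commute12[of A0]]])
      (use S0 fin0 that in \<open>auto simp: card_remove simp del: card_Diff_singleton card_Diff_insert\<close>)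
  have mC0: "miss v A0 B0 \<le> ?\<tau>" if "v \<in> C0" for v
    by (rule miss_le_of_remove[OF min0[of A0 B0 "C0 - {v}", unfolded missing_rotate[of A0 B0]]])
      (use S0 fin0 that in \<open>auto simp: card_remove simp del: card_Diff_singleton card_Diff_insert\<close>)
  define a0 b0 c0 where "a0 = real (card A0) / n" and "b0 = real (card B0) / n" and "c0 = real (card C0) / n"
  have A0: "real (card A0) = a0 * n" "real (card B0) = b0 * n" "real (card C0) = c0 * n"
    using n0 by (simp_all add: a0_def b0_def c0_def)
  have a0x: "a0 \<le> x" "b0 \<le> y" "c0 \<le> z"
    using S0 fin n0 by (auto simp: a0_def b0_def c0_def x_def y_def z_def divide_right_mono card_mono)
  define w where "w = m - (a0 + b0 + c0)"
  have w: "0 \<le> w" using a0x by (simp add: w_def m_def)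
  define M0 where "M0 = missing A0 B0 C0 / n ^ 3"
  have M0: "missing A0 B0 C0 = M0 * n ^ 3" using n0 by (simp add: M0_def)
  have M00: "0 \<le> M0" using missing_nonneg n0 by (simp add: M0_def)
  have "M0 * n ^ 3 + 138 / 10000 * w * n ^ 3 \<le> (x * y * z - c) * n ^ 3"
    using min0[of X Y Z] unfolding M0 A0 X missing_def[of X] c w_def m_def
    by (simp add: power2_eq_square power3_eq_cube field_simps)
  then have "(M0 + 138 / 10000 * w) * n ^ 3 \<le> (x * y * z - c) * n ^ 3" by (simp add: algebra_simps)
  then have M0w: "M0 + 138 / 10000 * w \<le> x * y * z - c" using n0 by simp
  have q0: "m ^ 3 / 27 - x * y * z + M0 + 138 / 10000 * (1 - m + w) \<le> 202 / 1000000"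
    using bud M0w m1 by argo
  have xyzm: "x * y * z \<le> m ^ 3 / 27" using amgm3[OF xyz0] by (simp add: m_def)
  have bnd: "m ^ 3 / 27 - x * y * z + 138 / 10000 * (1 - m + w) \<le> 202 / 1000000" using q0 M00 by linarith
  have a0: "304 / 1000 \<le> a0"
    using part_size[OF xyz0 m_def[symmetric] m1 m98 w bnd] a0x by (simp add: w_def m_def)
  have b0: "304 / 1000 \<le> b0"
    using part_size[of y x z m w] xyz0 m1 m98 w bnd a0x by (simp add: w_def m_def mult.commute[of y x])
  have c0: "304 / 1000 \<le> c0"
    using part_size[of z y x m w] xyz0 m1 m98 w bnd a0x by (simp add: w_def m_def mult_ac)
  define q where "q = 1 - (a0 + b0 + c0)"
  have q: "q = 1 - m + w" by (simp add: q_def w_def)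
  have q0': "m ^ 3 / 27 - x * y * z + M0 + 138 / 10000 * q \<le> 202 / 1000000" using q0 q by simp
  have q1: "0 \<le> q" using q w m1 by simp
  have q2: "q \<le> 14638 / 1000000" using q0' M00 xyzm by argo

  let ?\<sigma> = "196 / 10000 * n ^ 2"
  let ?P = "\<lambda>A B C. A0 \<subseteq> A \<and> B0 \<subseteq> B \<and> C0 \<subseteq> C \<and> A \<subseteq> V \<and> B \<subseteq> V \<and> C \<subseteq> V \<and> A \<inter> B = {} \<and> A \<inter> C = {} \<and> B \<inter> C = {}"
  let ?f = "\<lambda>A B C. missing A B C - ?\<sigma> * (real (card A) + real (card B) + real (card C))"
  have P0: "?P A0 B0 C0" using S0 sub disj by blast
  obtain A B C where S: "?P A B C" and min: "\<And>A' B' C'. ?P A' B' C' \<Longrightarrow> ?f A B C \<le> ?f A' B' C'"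
    by (rule arg_min_triple[of ?P A0 B0 C0 ?f]) (use P0 in auto)
  have finS: "finite A" "finite B" "finite C" using S finite_V by (auto intro: finite_subset)
  define a b c' where "a = real (card A) / n" and "b = real (card B) / n" and "c' = real (card C) / n"
  have A: "real (card A) = a * n" "real (card B) = b * n" "real (card C) = c' * n"
    using n0 by (simp_all add: a_def b_def c'_def)
  have aa0: "a0 \<le> a" "b0 \<le> b" "c0 \<le> c'"
    using S finS n0 by (auto simp: a0_def b0_def c0_def a_def b_def c'_def divide_right_mono card_mono)
  have cUn: "real (card (A \<union> B \<union> C)) = (a + b + c') * n"
    using cU[OF finS] S by (simp add: A algebra_simps)
  have "real (card (A \<union> B \<union> C)) \<le> n" using S finite_V by (simp add: card_mono)
  then have s1: "a + b + c' \<le> 1" using cUn n0 by simp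
  \<comment> \<open>Vertices added to the other two parts can spoil a vertex kept by the first
    stage. A part has size at most 1 - 2 * 0.304 = 0.392, so at most 0.392 * 0.014638 < 0.0058 new
    missing pairs arise, and 0.0138 + 0.0058 is the second threshold 0.0196.\<close>
  have grow: "miss v B' C' \<le> ?\<sigma>"
    if "miss v B0' C0' \<le> ?\<tau>" "B0' \<subseteq> B'" "C0' \<subseteq> C'" "finite B'" "finite C'"
      "real (card B0') = p0 * n" "real (card C0') = r0 * n" "real (card B') = p * n" "real (card C') = r * n"
      "304 / 1000 \<le> p0" "304 / 1000 \<le> r0" "p0 \<le> p" "r0 \<le> r" "p + r \<le> 696 / 1000" "p - p0 + (r - r0) \<le> q"
    for v B' C' B0' C0' p r p0 r0
  proof -
    have "miss v B' C' \<le> miss v B0' C0' + (p * r - p0 * r0) * n ^ 2"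
      using N2_mono[OF that(4,5,2,3), of v] that(6-9) by (simp add: miss_def power2_eq_square algebra_simps)
    also have "(p * r - p0 * r0) * n ^ 2 \<le> 58 / 10000 * n ^ 2"
    proof (rule mult_right_mono)
      have "p * r - p0 * r0 = (p - p0) * r + p0 * (r - r0)" by (simp add: algebra_simps)
      also have "\<dots> \<le> (p - p0) * (392 / 1000) + 392 / 1000 * (r - r0)"
        using that(10-) by (intro add_mono mult_left_mono mult_right_mono) auto
      also have "\<dots> \<le> 58 / 10000" using that(15) q2 by argo
      finally show "p * r - p0 * r0 \<le> 58 / 10000" .
    qed simp
    finally show ?thesis using that(1) by simp
  qed
  have sm: "a - a0 + (b - b0) + (c' - c0) \<le> q" using s1 by (simp add: q_def)
  have sub0: "A0 \<subseteq> A" "B0 \<subseteq> B" "C0 \<subseteq> C" using S by blast+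
  have pr: "b + c' \<le> 696 / 1000" "b - b0 + (c' - c0) \<le> q" "a + c' \<le> 696 / 1000" "a - a0 + (c' - c0) \<le> q"
    "a + b \<le> 696 / 1000" "a - a0 + (b - b0) \<le> q"
    using s1 sm aa0 a0 b0 c0 by linarith+
  have mA: "miss v B C \<le> ?\<sigma>" if "v \<in> A" for v
  proof (cases "v \<in> A0")
    case True
    show ?thesis
      by (rule grow[OF mA0[OF True] sub0(2,3) finS(2,3) A0(2,3) A(2,3) b0 c0 aa0(2,3) pr(1,2)])
  next
    case False
    show ?thesis
      by (rule miss_le_of_remove[OF min[of "A - {v}" B C]]) (use False S finS that in \<open>auto simp: card_remove simp del: card_Diff_singleton card_Diff_insert\<close>)
  qed
  have mB: "miss v A C \<le> ?\<sigma>" if "v \<in> B" for v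
  proof (cases "v \<in> B0")
    case True
    show ?thesis
      by (rule grow[OF mB0[OF True] sub0(1,3) finS(1,3) A0(1,3) A(1,3) a0 c0 aa0(1,3) pr(3,4)])
  next
    case False
    show ?thesis
      by (rule miss_le_of_remove[OF min[of A "B - {v}" C, unfolded missing_commute12[of A]]])
        (use False S finS that in \<open>auto simp: card_remove simp del: card_Diff_singleton card_Diff_insert\<close>)
  qed
  have mC: "miss v A B \<le> ?\<sigma>" if "v \<in> C" for v
  proof (cases "v \<in> C0")
    case True
    show ?thesis
      by (rule grow[OF mC0[OF True] sub0(1,2) finS(1,2) A0(1,2) A(1,2) a0 b0 aa0(1,2) pr(5,6)])
  next
    case False
    show ?thesis
      by (rule miss_le_of_remove[OF min[of A B "C - {v}", unfolded missing_rotate[of A B]]])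
        (use False S finS that in \<open>auto simp: card_remove simp del: card_Diff_singleton card_Diff_insert\<close>)
  qed
  have mQ: "?\<sigma> \<le> miss v B C \<and> ?\<sigma> \<le> miss v A C \<and> ?\<sigma> \<le> miss v A B" if v: "v \<in> V - (A \<union> B \<union> C)" for v
  proof (intro conjI)
    show "?\<sigma> \<le> miss v B C"
      by (rule miss_ge_of_insert[OF min[of "insert v A" B C]]) (use S finS v in auto)
    show "?\<sigma> \<le> miss v A C"
      by (rule miss_ge_of_insert[OF min[of A "insert v B" C, unfolded missing_commute12[of A]]]) (use S finS v in auto)
    show "?\<sigma> \<le> miss v A B"
      by (rule miss_ge_of_insert[OF min[of A B "insert v C", unfolded missing_rotate[of A B]]])
        (use S finS v in auto)
  qed
  have cQ: "real (card (V - (A \<union> B \<union> C))) = (1 - (a + b + c')) * n"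
    using S finite_V finS cUn by (simp add: card_Diff_subset of_nat_diff card_mono algebra_simps)
  have "missing A B C + ?\<sigma> * real (card (V - (A \<union> B \<union> C))) \<le> (M0 + 196 / 10000 * q) * n ^ 3"
    using min[OF P0] unfolding cQ M0 A A0 q_def by (simp add: power2_eq_square power3_eq_cube field_simps)
  also have "\<dots> \<le> 287 / 1000000 * n ^ 3"
  proof (rule mult_right_mono)
    show "M0 + 196 / 10000 * q \<le> 287 / 1000000" using q0' M00 q1 xyzm by argo
  qed simp
  finally have "missing A B C + ?\<sigma> * real (card (V - (A \<union> B \<union> C))) \<le> 287 / 1000000 * n ^ 3" .
  moreover have "304 / 1000 * n \<le> real (card A)" "304 / 1000 * n \<le> real (card B)" "304 / 1000 * n \<le> real (card C)"
    unfolding A using a0 b0 c0 aa0 n0 by (auto intro!: mult_right_mono)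
  ultimately have "config A B C"
    unfolding config_def using S mA mB mC mQ by blast
  then show thesis by (rule that)
qed

end

subsection \<open>Typical and exceptional vertices\<close>

text \<open>The function e/2 + p/e is convex and takes the same value t + p/(2t) at e = p/t and at e
  = 2t. Below p/t the bound \<open>f \<le> e\<close> takes over.\<close>

lemma link_product_arith:
  fixes e f p t :: real
  assumes "0 \<le> e" "e \<le> 2 * t" "0 < t" "f \<le> e" "e * f \<le> p" "0 \<le> p" "p \<le> t ^ 2"
  shows "e / 2 + f \<le> t + p / (2 * t)"
proof -
  have pt: "p / t \<le> t" using assms by (simp add: pos_divide_le_eq power2_eq_square)
  show ?thesis
  proof (cases "p / t \<le> e")
    case True
    have "0 \<le> (2 * t - e) * (e - p / t)" using True assms by simp
    also have "\<dots> = 2 * (e * (t + p / (2 * t) - e / 2) - p)"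
      using assms(3) by (simp add: field_simps)
    finally have "p \<le> e * (t + p / (2 * t) - e / 2)" by simp
    then have le: "e * f \<le> e * (t + p / (2 * t) - e / 2)" using assms by linarith
    show ?thesis
    proof (cases "e = 0")
      case True
      moreover have "0 \<le> p / (2 * t)" using assms by simp
      ultimately show ?thesis using assms by linarith
    next
      case False
      then have "f \<le> t + p / (2 * t) - e / 2" using le assms by simp
      then show ?thesis by simp
    qed
  next
    case False
    have "p / (2 * t) = p / t / 2" by simp
    then show ?thesis using False assms pt by linarith
  qed
qed

text \<open>All quantities are normalised by powers of n: \<open>e\<close>, \<open>f\<close>,
  \<open>g\<close> are the link densities between pairs of parts, \<open>e\<close> the largest, and
  \<open>\<beta>\<close>, \<open>\<gamma>\<close> the support sizes in the two parts of that pair.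
  If \<open>e\<close> is small, the link lies mainly inside parts, and Mantel's bound on the full
  parts is far below 2bc. If \<open>e\<close> is large, \<open>link_product\<close> makes
  \<open>f\<close> and \<open>g\<close> tiny and the supports are bounded through the loss
  \<open>mv\<close>.\<close>

lemma exceptional_arith:
  fixes a b c M Q e f g \<beta> \<gamma> p mv :: real
  assumes abc: "304 / 1000 \<le> a" "304 / 1000 \<le> b" "304 / 1000 \<le> c" "a + b + c \<le> 1"
    and MQ: "0 \<le> M" "0 \<le> Q" "M + 196 / 10000 * Q \<le> 287 / 1000000"
    and fg: "0 \<le> f" "f \<le> e" "0 \<le> g" "g \<le> e" "e * f \<le> p" "e * g \<le> p" and p: "p = 784 / 1000 * M + 1 / 100000000"
    and mv: "mv = b * c - e" "196 / 10000 \<le> mv"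
    and \<beta>: "0 \<le> \<beta>" "\<beta> \<le> b" "\<beta> * (2395 / 10000) \<le> mv + 945 / 1000000"
    and \<gamma>: "0 \<le> \<gamma>" "\<gamma> \<le> c" "\<gamma> * (2395 / 10000) \<le> mv + 945 / 1000000"
  shows "2 * e + 2 * f + 2 * g + \<beta> ^ 2 / 2 + \<gamma> ^ 2 / 2 + Q \<le> 2 * (b * c) - 5 / 10000"
proof -
  \<comment> \<open>Chosen so that \<open>t ^ 2\<close> lies just above the largest possible
    \<open>p\<close>, about 0.000225.\<close>
  define t :: real where "t = 151 / 10000"
  have e0: "0 \<le> e" using fg by linarith
  have p0: "0 \<le> p" using p MQ by simp
  have Mu: "M \<le> 287 / 1000000" using MQ by argo
  show ?thesis
  proof (cases "e \<le> 2 * t")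
    case True
    have pt: "p \<le> t ^ 2" unfolding p t_def using Mu by (simp add: power2_eq_square)
    have "e / 2 + f \<le> t + p / (2 * t)" "e / 2 + g \<le> t + p / (2 * t)"
      using link_product_arith[of e t f p] link_product_arith[of e t g p] e0 True fg p0 pt by (simp_all add: t_def)
    then have efg: "2 * e + 2 * f + 2 * g \<le> 604 / 10000 + 13246 / 100 * p" using p0 by (simp add: t_def)
    have "\<beta> ^ 2 \<le> b ^ 2" "\<gamma> ^ 2 \<le> c ^ 2" using \<beta> \<gamma> by (auto intro: power_mono)
    moreover have "b ^ 2 / 2 + c ^ 2 / 2 \<le> 2 * (b * c) - 924 / 10000"
    proof -
      define x y where "x = b - 304 / 1000" and "y = c - 304 / 1000"
      have xy: "0 \<le> x" "0 \<le> y" "x \<le> 88 / 1000" "y \<le> 88 / 1000" using abc by (auto simp: x_def y_def)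
      have bc: "b = x + 304 / 1000" "c = y + 304 / 1000" by (simp_all add: x_def y_def)
      have "0 \<le> x * (304 / 1000 - x / 2)" "0 \<le> y * (304 / 1000 - y / 2)" "0 \<le> x * y" using xy by auto
      then show ?thesis unfolding bc by (simp add: power2_eq_square field_simps)
    qed
    moreover have "13246 / 100 * p + Q \<le> 300 / 10000" unfolding p using MQ by argo
    ultimately show ?thesis using efg by argo
  next
    case False
    have e: "302 / 10000 \<le> e" using False by (simp add: t_def)
    have "302 / 10000 * f \<le> e * f" "302 / 10000 * g \<le> e * g" using mult_right_mono[OF e fg(1)] mult_right_mono[OF e fg(3)] by simp_all
    then have fg2: "302 / 10000 * f \<le> p" "302 / 10000 * g \<le> p" using fg by linarith+
    have fgQ: "2 * f + 2 * g + Q \<le> 299 / 10000" using fg2 p MQ by argo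
    have bc: "b * c \<le> 121104 / 1000000"
    proof -
      have "0 \<le> (b - c) ^ 2" by simp
      then have "4 * (b * c) \<le> (b + c) ^ 2" by (simp add: power2_eq_square algebra_simps)
      also have "\<dots> \<le> (696 / 1000) ^ 2" using abc by (intro power_mono) auto
      finally show ?thesis by (simp add: power2_eq_square)
    qed
    have mvu: "mv \<le> 90904 / 1000000" using mv bc e by linarith
    have sq: "x ^ 2 \<le> 17434 / 1000 * (mv + 945 / 1000000) ^ 2" if "0 \<le> x" "x * (2395 / 10000) \<le> mv + 945 / 1000000" for x
    proof -
      have "(x * (2395 / 10000)) ^ 2 \<le> (mv + 945 / 1000000) ^ 2" using that by (intro power_mono) auto
      then have "x ^ 2 * (2395 / 10000) ^ 2 \<le> (mv + 945 / 1000000) ^ 2" unfolding power_mult_distrib .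
      moreover have "0 \<le> (mv + 945 / 1000000) ^ 2" by simp
      ultimately show ?thesis unfolding power2_eq_square[of "2395 / 10000"] by argo
    qed
    \<comment> \<open>A convex quadratic lies below its chord over the range of \<open>mv\<close>,
      from 0.0196 to 0.090904.\<close>
    have "0 \<le> (mv - 196 / 10000) * (90904 / 1000000 - mv)" using mv mvu by simp
    then have "17434 / 1000 * (mv + 945 / 1000000) ^ 2 \<le> 2 * mv - 304 / 10000"
      using mv(2) mvu by (simp add: power2_eq_square field_simps)
    then show ?thesis using sq[OF \<beta>(1,3)] sq[OF \<gamma>(1,3)] fgQ mv(1) by argo
  qed
qed

context c5_free begin

definition err :: "real \<Rightarrow> 'a \<Rightarrow> real" where
  "err \<epsilon> v = 2 * \<epsilon> * n ^ 2 + tri v / (\<epsilon> ^ 2 * n)"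

lemma N2_pair_le_supp:
  assumes "B \<subseteq> V" "C \<subseteq> V" "0 < \<epsilon>" "0 < n"
  shows "N2 v B B + N2 v C C \<le> real (card (supp v B)) ^ 2 / 2 + real (card (supp v C)) ^ 2 / 2 + err \<epsilon> v"
proof -
  have "tri v / (\<epsilon> ^ 2 * n) = tri v / (2 * \<epsilon> ^ 2 * n) + tri v / (2 * \<epsilon> ^ 2 * n)"
    by simp
  then show ?thesis
    using N2_le_supp[OF assms(1,3,4), of v] N2_le_supp[OF assms(2,3,4), of v] unfolding err_def by linarith
qed

lemma config_finite: "config A B C \<Longrightarrow> finite A \<and> finite B \<and> finite C"
  unfolding config_def using finite_V by (meson finite_subset)

text \<open>\<open>supp_bound\<close> with the constants of \<open>config\<close>: 0.175 and 0.2395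
  are 0.304 minus 2 * 0.0196 / 0.30399 and 0.0196 / 0.30399, rounded down, and 0.000945 is 0.000287
  / 0.30399 rounded up. The step from 0.304 to 0.30399 absorbs the \<open>- 1\<close> in the size of
  \<open>A\<close>.\<close>

lemma config_supp:
  assumes cf: "config A B C" and v: "v \<notin> C" and n: "30000000000 \<le> n"
  shows "real (card (supp v B)) * (175 / 1000 * n) \<le> miss v B C"
    and "real (card (supp v B)) * (2395 / 10000 * n) \<le> miss v B C + 945 / 1000000 * n ^ 2"
proof -
  have fin: "finite A" "finite B" "finite C" using config_finite[OF cf] by auto
  have a: "30399 / 100000 * n \<le> real (card A) - 1" using cf n unfolding config_def by linarith
  have a0: "0 < 30399 / 100000 * n" using n by simp
  have c: "304 / 1000 * n \<le> real (card C)" using cf by (simp add: config_def)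
  have disj: "A \<inter> B = {}" "A \<inter> C = {}" "B \<inter> C = {}" using cf by (auto simp: config_def)
  have \<tau>: "\<And>b. b \<in> B \<Longrightarrow> miss b A C \<le> 196 / 10000 * n ^ 2" using cf by (simp add: config_def)
  have a1: "1 < real (card A)" using a a0 by linarith
  note sb = supp_bound[OF fin disj v \<tau> a1]
  have inv: "x / (real (card A) - 1) \<le> x / (30399 / 100000 * n)" if "0 \<le> x" for x
    using a a0 that by (intro divide_left_mono mult_pos_pos) linarith+
  have "2 * (196 / 10000 * n ^ 2) / (real (card A) - 1) \<le> 2 * (196 / 10000 * n ^ 2) / (30399 / 100000 * n)"
    by (rule inv) simp
  also have "\<dots> \<le> 129 / 1000 * n" using a0 by (simp add: field_simps power2_eq_square)
  finally have "175 / 1000 * n \<le> real (card C) - 2 * (196 / 10000 * n ^ 2) / (real (card A) - 1)"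
    using c by linarith
  then show "real (card (supp v B)) * (175 / 1000 * n) \<le> miss v B C"
    using sb(1) by (meson mult_left_mono of_nat_0_le_iff order_trans)
  have "196 / 10000 * n ^ 2 / (real (card A) - 1) \<le> 196 / 10000 * n ^ 2 / (30399 / 100000 * n)"
    by (rule inv) simp
  also have "\<dots> \<le> 645 / 10000 * n" using a0 by (simp add: field_simps power2_eq_square)
  finally have "2395 / 10000 * n \<le> real (card C) - 196 / 10000 * n ^ 2 / (real (card A) - 1)"
    using c by linarith
  then have "real (card (supp v B)) * (2395 / 10000 * n) \<le> miss v B C + missing A B C / (real (card A) - 1)"
    using sb(2) by (meson mult_left_mono of_nat_0_le_iff order_trans)
  moreover have "missing A B C / (real (card A) - 1) \<le> 945 / 1000000 * n ^ 2"
  proof -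
    have "0 \<le> 196 / 10000 * n ^ 2 * real (card (V - (A \<union> B \<union> C)))" by simp
    then have "missing A B C \<le> 287 / 1000000 * n ^ 3" using cf unfolding config_def by linarith
    then have "missing A B C / (30399 / 100000 * n) \<le> 287 / 1000000 * n ^ 3 / (30399 / 100000 * n)"
      using a0 by (intro divide_right_mono) auto
    also have "\<dots> \<le> 945 / 1000000 * n ^ 2" using a0 by (simp add: field_simps power2_eq_square power3_eq_cube)
    finally show ?thesis using inv[OF missing_nonneg, of A B C] by linarith
  qed
  ultimately show "real (card (supp v B)) * (2395 / 10000 * n) \<le> miss v B C + 945 / 1000000 * n ^ 2" by linarith
qed

text \<open>Each support has size at most m n / 0.175, where m is the normalised loss. Since m is at
  most 0.0196, its square is at most 0.64 times the loss. What matters is 9 * 0.65 < 6: this gain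
  enters three times for each of three parts, whereas a missing transversal triple costs six ordered
  edges.\<close>

lemma typical_vertex:
  assumes cf: "config A B C" and v: "v \<in> A" and n: "30000000000 \<le> n" and \<epsilon>: "0 < \<epsilon>"
  shows "N2 v B B + N2 v C C \<le> 65 / 100 * miss v B C + err \<epsilon> v"
proof -
  have n0: "0 < n" using n by linarith
  have sub: "B \<subseteq> V" "C \<subseteq> V" and vB: "v \<notin> B" "v \<notin> C" using cf v by (auto simp: config_def)
  define m where "m = miss v B C / n ^ 2"
  have m: "miss v B C = m * n ^ 2" using n0 by (simp add: m_def)
  have m0: "0 \<le> m" using miss_nonneg n0 by (simp add: m_def)
  have m1: "m \<le> 196 / 10000"
  proof -
    have "m * n ^ 2 \<le> 196 / 10000 * n ^ 2" using cf v unfolding config_def m[symmetric] by blast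
    then show ?thesis using n0 by simp
  qed
  have sq: "real k ^ 2 \<le> 64 / 100 * miss v B C" if "real k * (175 / 1000 * n) \<le> miss v B C" for k
  proof -
    have "real k * (175 / 1000) * n \<le> m * n * n" using that unfolding m by (simp add: power2_eq_square mult_ac)
    then have "real k * (175 / 1000) \<le> m * n" using n0 by (simp only: mult_le_cancel_right_pos)
    then have "(real k * (175 / 1000)) ^ 2 \<le> (m * n) ^ 2" by (intro power_mono) auto
    then have "real k ^ 2 * (175 / 1000) ^ 2 \<le> m * miss v B C" unfolding m by (simp add: power_mult_distrib power2_eq_square mult_ac)
    also have "\<dots> \<le> 196 / 10000 * miss v B C" by (intro mult_right_mono m1 miss_nonneg)
    finally show ?thesis by (simp add: power2_eq_square[of "7 / 40"])
  qed
  have "real (card (supp v B)) ^ 2 \<le> 64 / 100 * miss v B C"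
    by (rule sq[OF config_supp(1)[OF cf vB(2) n]])
  moreover have "real (card (supp v C)) ^ 2 \<le> 64 / 100 * miss v B C"
    by (rule sq) (use config_supp(1)[OF config_swap23[OF cf] vB(1) n] in \<open>simp add: miss_commute[of v C B]\<close>)
  ultimately show ?thesis
    using N2_pair_le_supp[OF sub \<epsilon> n0, of v] miss_nonneg[of v B C] by linarith
qed

text \<open>The left side counts the link pairs of \<open>v\<close> in the three parts that do not
  lie inside \<open>A\<close>, the part it will join. The right side is what a perfect vertex of
  \<open>A\<close> contributes, less a fixed gain. The summand with the number of exceptional
  vertices pays for edges that contain several of them.\<close>

lemma exceptional_vertex:
  assumes cf: "config A B C" and v: "v \<in> V - (A \<union> B \<union> C)" and n: "30000000000 \<le> n" and \<epsilon>: "0 < \<epsilon>"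
    and best: "N2 v A B \<le> N2 v B C" "N2 v A C \<le> N2 v B C"
  shows "2 * N2 v B C + 2 * N2 v A B + 2 * N2 v A C + N2 v B B + N2 v C C + real (card (V - (A \<union> B \<union> C))) * n
    \<le> 2 * (real (card B) * real (card C)) - 5 / 10000 * n ^ 2 + err \<epsilon> v"
proof -
  have n0: "0 < n" using n by linarith
  have fin: "finite A" "finite B" "finite C" using config_finite[OF cf] by auto
  have sub: "A \<subseteq> V" "B \<subseteq> V" "C \<subseteq> V" and disj: "A \<inter> B = {}" "A \<inter> C = {}" "B \<inter> C = {}"
    using cf by (auto simp: config_def)
  have vn: "v \<notin> A" "v \<notin> B" "v \<notin> C" using v by auto
  define a b c where "a = real (card A) / n" and "b = real (card B) / n" and "c = real (card C) / n"
  have A: "real (card A) = a * n" "real (card B) = b * n" "real (card C) = c * n"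
    using n0 by (simp_all add: a_def b_def c_def)
  define Q where "Q = real (card (V - (A \<union> B \<union> C))) / n"
  have Q: "real (card (V - (A \<union> B \<union> C))) = Q * n" using n0 by (simp add: Q_def)
  define M where "M = missing A B C / n ^ 3"
  have M: "missing A B C = M * n ^ 3" using n0 by (simp add: M_def)
  define e f g where "e = N2 v B C / n ^ 2" and "f = N2 v A B / n ^ 2" and "g = N2 v A C / n ^ 2"
  have e: "N2 v B C = e * n ^ 2" "N2 v A B = f * n ^ 2" "N2 v A C = g * n ^ 2"
    using n0 by (simp_all add: e_def f_def g_def)
  define \<beta> \<gamma> where "\<beta> = real (card (supp v B)) / n" and "\<gamma> = real (card (supp v C)) / n"
  have \<beta>: "real (card (supp v B)) = \<beta> * n" "real (card (supp v C)) = \<gamma> * n"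
    using n0 by (simp_all add: \<beta>_def \<gamma>_def)
  have can: "x \<le> y" if "x * n ^ k \<le> y * n ^ k" for x y :: real and k :: nat
    using that n0 by simp
  have abc: "304 / 1000 \<le> a" "304 / 1000 \<le> b" "304 / 1000 \<le> c"
    using cf n0 unfolding config_def A by auto
  have "card (A \<union> B \<union> C) \<le> card V" using sub finite_V by (intro card_mono) auto
  then have "real (card A) + real (card B) + real (card C) \<le> n"
    using fin disj by (simp add: card_Un_disjoint Int_Un_distrib2)
  then have "(a + b + c) * n ^ 1 \<le> 1 * n ^ 1" unfolding A by (simp add: algebra_simps)
  then have s1: "a + b + c \<le> 1" by (rule can)
  have MQ0: "0 \<le> M" "0 \<le> Q" using missing_nonneg n0 by (simp_all add: M_def Q_def)
  have "(M + 196 / 10000 * Q) * n ^ 3 \<le> 287 / 1000000 * n ^ 3"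
    using cf unfolding config_def M Q by (simp add: power2_eq_square power3_eq_cube algebra_simps)
  then have MQ: "M + 196 / 10000 * Q \<le> 287 / 1000000" by (rule can)
  have fg0: "0 \<le> f" "0 \<le> g" using N2_nonneg by (simp_all add: f_def g_def)
  have fe: "f \<le> e" "g \<le> e" using best unfolding e by (auto intro: can)
  define p where "p = 784 / 1000 * M + 1 / 100000000"
  have pr: "x * y \<le> p"
    if "y * n ^ 2 * (x * n ^ 2) \<le> 2 * (s * n) * (M * n ^ 3) + s' * n * (s * n) * (s'' * n)" "0 \<le> s'" "s' \<le> 1" "0 \<le> s" "s \<le> 392 / 1000" "0 \<le> s''" "s'' \<le> 1"
    for x y s s' s'' :: real
  proof -
    have "(x * y) * n ^ 4 \<le> (2 * s * M) * n ^ 4 + s' * s * s'' * n ^ 3"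
      using that(1) by (simp add: power2_eq_square power3_eq_cube power_numeral_reduce mult_ac)
    also have "s' * s * s'' * n ^ 3 \<le> 1 * 1 * 1 * n ^ 3"
      using that n0 by (intro mult_right_mono mult_mono) auto
    also have "1 * 1 * 1 * n ^ 3 \<le> 1 / 100000000 * n ^ 4"
    proof -
      have "100000000 * n ^ 3 \<le> n * n ^ 3" using n by (intro mult_right_mono) auto
      then show ?thesis by (simp add: power_numeral_reduce)
    qed
    finally have "(x * y) * n ^ 4 \<le> (2 * s * M + 1 / 100000000) * n ^ 4" by (simp add: algebra_simps)
    then have "x * y \<le> 2 * s * M + 1 / 100000000" by (rule can)
    also have "2 * s * M \<le> 784 / 1000 * M" using that MQ0 by (intro mult_right_mono) auto
    finally show ?thesis by (simp add: p_def)
  qed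
  have ef: "e * f \<le> p"
    by (rule pr[of f e b a c]) (use link_product[OF disj vn] abc s1 in \<open>simp_all add: e A M mult_ac\<close>)
  have eg: "e * g \<le> p"
    by (rule pr[of g e c a b])
      (use link_product[of A C B v] disj vn abc s1 in
        \<open>simp_all add: e A M mult_ac Int_commute[of C B] N2_commute[of v C B] missing_commute23[of A C B]\<close>)
  define mv where "mv = b * c - e"
  have mv: "miss v B C = mv * n ^ 2"
    by (simp add: miss_def A e mv_def power2_eq_square algebra_simps)
  have "196 / 10000 * n ^ 2 \<le> mv * n ^ 2" using cf v unfolding config_def mv[symmetric] by blast
  then have mv1: "196 / 10000 \<le> mv" by (rule can)
  have b0: "0 \<le> \<beta>" "0 \<le> \<gamma>" using n0 by (simp_all add: \<beta>_def \<gamma>_def)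
  have "card (supp v B) \<le> card B" "card (supp v C) \<le> card C" using fin by (auto simp: supp_def intro!: card_mono)
  then have bb: "\<beta> \<le> b" "\<gamma> \<le> c" using n0 by (auto simp: \<beta>_def b_def \<gamma>_def c_def divide_right_mono)
  have "(\<beta> * (2395 / 10000)) * n ^ 2 \<le> (mv + 945 / 1000000) * n ^ 2"
    using config_supp(2)[OF cf vn(3) n] unfolding \<beta> mv by (simp add: power2_eq_square algebra_simps)
  then have b3: "\<beta> * (2395 / 10000) \<le> mv + 945 / 1000000" by (rule can)
  have "(\<gamma> * (2395 / 10000)) * n ^ 2 \<le> (mv + 945 / 1000000) * n ^ 2"
    using config_supp(2)[OF config_swap23[OF cf] vn(2) n] unfolding miss_commute[of v C B] \<beta> mv
    by (simp add: power2_eq_square algebra_simps)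
  then have c3: "\<gamma> * (2395 / 10000) \<le> mv + 945 / 1000000" by (rule can)
  have "2 * e + 2 * f + 2 * g + \<beta> ^ 2 / 2 + \<gamma> ^ 2 / 2 + Q \<le> 2 * (b * c) - 5 / 10000"
    by (rule exceptional_arith[OF abc s1 MQ0 MQ fg0(1) fe(1) fg0(2) fe(2) ef eg p_def mv_def mv1 b0(1) bb(1) b3 b0(2) bb(2) c3])
  then have "(2 * e + 2 * f + 2 * g + \<beta> ^ 2 / 2 + \<gamma> ^ 2 / 2 + Q) * n ^ 2 \<le> (2 * (b * c) - 5 / 10000) * n ^ 2"
    by (rule mult_right_mono) simp
  then show ?thesis
    using N2_pair_le_supp[OF sub(2,3) \<epsilon> n0, of v] unfolding e \<beta> A Q
    by (simp add: power2_eq_square algebra_simps)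
qed

subsection \<open>Comparison with the density\<close>

lemma N2_Un1: "finite B \<Longrightarrow> finite B' \<Longrightarrow> B \<inter> B' = {} \<Longrightarrow> N2 v (B \<union> B') C = N2 v B C + N2 v B' C"
  by (simp add: N2_def sum.union_disjoint)

lemma N2_Un2: "finite C \<Longrightarrow> finite C' \<Longrightarrow> C \<inter> C' = {} \<Longrightarrow> N2 v B (C \<union> C') = N2 v B C + N2 v B C'"
  by (simp add: N2_commute[of v B] N2_Un1)

lemma N3_Un1: "finite A \<Longrightarrow> finite A' \<Longrightarrow> A \<inter> A' = {} \<Longrightarrow> N3 (A \<union> A') B C = N3 A B C + N3 A' B C"
  by (simp add: N3_def sum.union_disjoint)

lemma N3_Un2: "finite B \<Longrightarrow> finite B' \<Longrightarrow> B \<inter> B' = {} \<Longrightarrow> N3 A (B \<union> B') C = N3 A B C + N3 A B' C"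
  by (simp add: N3_N2 N2_Un1 sum.distrib)

lemma N3_Un3: "finite C \<Longrightarrow> finite C' \<Longrightarrow> C \<inter> C' = {} \<Longrightarrow> N3 A B (C \<union> C') = N3 A B C + N3 A B C'"
  by (simp add: N3_N2 N2_Un2 sum.distrib)

lemma N3_cube_Un:
  assumes "finite A" "finite A'" "A \<inter> A' = {}"
  shows "N3 (A \<union> A') (A \<union> A') (A \<union> A') = N3 A A A + 3 * N3 A' A A + 3 * N3 A' A' A + N3 A' A' A'"
proof -
  have "N3 A A A' = N3 A' A A" "N3 A A' A = N3 A' A A" "N3 A A' A' = N3 A' A' A" "N3 A' A A' = N3 A' A' A"
    using N3_commute12 N3_commute23 by metis+
  then show ?thesis using assms by (simp add: N3_Un1 N3_Un2 N3_Un3)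
qed

lemma N3_square_Un3:
  assumes "finite A" "finite B" "finite C" "A \<inter> B = {}" "A \<inter> C = {}" "B \<inter> C = {}"
  shows "N3 S (A \<union> B \<union> C) (A \<union> B \<union> C) = N3 S A A + N3 S B B + N3 S C C + 2 * N3 S A B + 2 * N3 S A C + 2 * N3 S B C"
  using assms by (simp add: N3_Un2 N3_Un3 Int_Un_distrib2 N3_commute23[of S B A] N3_commute23[of S C A] N3_commute23[of S C B])

lemma N3_cube_Un3:
  assumes "finite A" "finite B" "finite C" "A \<inter> B = {}" "A \<inter> C = {}" "B \<inter> C = {}"
  shows "N3 (A \<union> B \<union> C) (A \<union> B \<union> C) (A \<union> B \<union> C) = N3 A A A + N3 B B B + N3 C C C + 6 * N3 A B C
    + 3 * (N3 A B B + N3 A C C) + 3 * (N3 B A A + N3 B C C) + 3 * (N3 C A A + N3 C B B)"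
proof -
  have "N3 A A B = N3 B A A" "N3 A A C = N3 C A A" "N3 B A B = N3 A B B" "N3 B B C = N3 C B B" "N3 B A C = N3 A B C"
    "N3 C A C = N3 A C C" "N3 C B C = N3 B C C" "N3 C A B = N3 A B C"
    using N3_commute12 N3_commute23 by metis+
  then show ?thesis
    using assms by (simp add: N3_square_Un3 N3_Un1[of "A \<union> B" C] N3_Un1[of A B] Int_Un_distrib2)
qed

lemma sum_err_le:
  assumes "0 < \<epsilon>" "0 < n"
  shows "(\<Sum>v\<in>V. err \<epsilon> v) \<le> 2 * \<epsilon> * n ^ 3 + n ^ 2 / \<epsilon> ^ 2"
proof -
  have "(\<Sum>v\<in>V. err \<epsilon> v) = 2 * \<epsilon> * n ^ 3 + (\<Sum>v\<in>V. tri v) / (\<epsilon> ^ 2 * n)"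
    by (simp add: err_def sum.distrib sum_divide_distrib power2_eq_square power3_eq_cube mult_ac)
  also have "(\<Sum>v\<in>V. tri v) / (\<epsilon> ^ 2 * n) \<le> n ^ 3 / (\<epsilon> ^ 2 * n)"
    using assms sum_tri_le by (intro divide_right_mono) auto
  also have "n ^ 3 / (\<epsilon> ^ 2 * n) = n ^ 2 / \<epsilon> ^ 2"
    using assms by (simp add: power2_eq_square power3_eq_cube)
  finally show ?thesis by simp
qed

text \<open>Exceptional vertices are distributed by their densest pair of parts. Edges inside a
  final part may be undercounted, since they are subtracted on the left; all others are bounded
  vertex by vertex.\<close>

lemma config_partition:
  assumes cf: "config A B C" and n: "30000000000 \<le> n" and \<epsilon>: "0 < \<epsilon>"
  obtains P1 P2 P3 \<mu> where "P1 \<union> P2 \<union> P3 = V" "P1 \<inter> P2 = {}" "P1 \<inter> P3 = {}" "P2 \<inter> P3 = {}"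
    "304 / 1000 * n \<le> real (card P1)" "304 / 1000 * n \<le> real (card P2)" "304 / 1000 * n \<le> real (card P3)" "0 \<le> \<mu>"
    "N3 V V V - N3 P1 P1 P1 - N3 P2 P2 P2 - N3 P3 P3 P3 + \<mu>
      \<le> 6 * (real (card P1) * real (card P2) * real (card P3)) + 6 * \<epsilon> * n ^ 3 + 3 * n ^ 2 / \<epsilon> ^ 2"
    "6 * (real (card P1) * real (card P2) * real (card P3)) - 6 * N3 P1 P2 P3 \<le> 4000 * \<mu>"
proof -
  have n0: "0 < n" using n by linarith
  have fin: "finite A" "finite B" "finite C" using config_finite[OF cf] by auto
  have sub: "A \<subseteq> V" "B \<subseteq> V" "C \<subseteq> V" and disj: "A \<inter> B = {}" "A \<inter> C = {}" "B \<inter> C = {}"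
    using cf by (auto simp: config_def)
  define Q where "Q = V - (A \<union> B \<union> C)"
  define QA where "QA = {v \<in> Q. N2 v A B \<le> N2 v B C \<and> N2 v A C \<le> N2 v B C}"
  define QB where "QB = {v \<in> Q - QA. N2 v A B \<le> N2 v A C}"
  define QC where "QC = Q - QA - QB"
  define W where "W = A \<union> B \<union> C"
  have finQ: "finite Q" "finite QA" "finite QB" "finite QC" "finite W"
    using finite_V fin by (auto simp: Q_def QA_def QB_def QC_def W_def)
  have QU: "Q = QA \<union> QB \<union> QC" and Qd: "QA \<inter> QB = {}" "QA \<inter> QC = {}" "QB \<inter> QC = {}"
    by (auto simp: QA_def QB_def QC_def)
  have VW: "V = W \<union> Q" "W \<inter> Q = {}" using sub by (auto simp: Q_def W_def)
  define q where "q = real (card Q)"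
  have cf2: "config B A C" by (rule config_swap12[OF cf])
  have cf3: "config C A B" using config_swap12[OF config_swap23[OF cf]] .
  have Wc: "B \<union> A \<union> C = W" "C \<union> A \<union> B = W" by (auto simp: W_def)
  have sA: "N3 A B B + N3 A C C \<le> 65 / 100 * missing A B C + (\<Sum>v\<in>A. err \<epsilon> v)"
  proof -
    have "N3 A B B + N3 A C C = (\<Sum>v\<in>A. N2 v B B + N2 v C C)" by (simp add: N3_N2 sum.distrib)
    also have "\<dots> \<le> (\<Sum>v\<in>A. 65 / 100 * miss v B C + err \<epsilon> v)"
      by (intro sum_mono typical_vertex[OF cf _ n \<epsilon>])
    finally show ?thesis by (simp add: sum.distrib missing_eq_sum sum_distrib_left)
  qed
  have sB: "N3 B A A + N3 B C C \<le> 65 / 100 * missing A B C + (\<Sum>v\<in>B. err \<epsilon> v)"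
  proof -
    have "N3 B A A + N3 B C C = (\<Sum>v\<in>B. N2 v A A + N2 v C C)" by (simp add: N3_N2 sum.distrib)
    also have "\<dots> \<le> (\<Sum>v\<in>B. 65 / 100 * miss v A C + err \<epsilon> v)"
      by (intro sum_mono typical_vertex[OF cf2 _ n \<epsilon>])
    finally show ?thesis unfolding missing_commute12[of A B C] by (simp add: sum.distrib missing_eq_sum sum_distrib_left)
  qed
  have sC: "N3 C A A + N3 C B B \<le> 65 / 100 * missing A B C + (\<Sum>v\<in>C. err \<epsilon> v)"
  proof -
    have "N3 C A A + N3 C B B = (\<Sum>v\<in>C. N2 v A A + N2 v B B)" by (simp add: N3_N2 sum.distrib)
    also have "\<dots> \<le> (\<Sum>v\<in>C. 65 / 100 * miss v A B + err \<epsilon> v)"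
      by (intro sum_mono typical_vertex[OF cf3 _ n \<epsilon>])
    finally show ?thesis unfolding missing_rotate[of A B C] by (simp add: sum.distrib missing_eq_sum sum_distrib_left)
  qed
  have eA: "N3 QA W W - N3 QA A A \<le> real (card QA) * (2 * (real (card B) * real (card C)) - 5 / 10000 * n ^ 2 - q * n) + (\<Sum>v\<in>QA. err \<epsilon> v)"
  proof -
    have "N3 QA W W - N3 QA A A = (\<Sum>v\<in>QA. 2 * N2 v B C + 2 * N2 v A B + 2 * N2 v A C + N2 v B B + N2 v C C)"
      unfolding W_def N3_square_Un3[OF fin disj] by (simp add: N3_N2 sum.distrib sum_distrib_left)
    also have "\<dots> \<le> (\<Sum>v\<in>QA. 2 * (real (card B) * real (card C)) - 5 / 10000 * n ^ 2 - q * n + err \<epsilon> v)"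
    proof (rule sum_mono)
      fix v assume v: "v \<in> QA"
      have "v \<in> V - (A \<union> B \<union> C)" "N2 v A B \<le> N2 v B C" "N2 v A C \<le> N2 v B C" using v by (auto simp: QA_def Q_def)
      from exceptional_vertex[OF cf this(1) n \<epsilon> this(2,3)]
      show "2 * N2 v B C + 2 * N2 v A B + 2 * N2 v A C + N2 v B B + N2 v C C
         \<le> 2 * (real (card B) * real (card C)) - 5 / 10000 * n ^ 2 - q * n + err \<epsilon> v"
        unfolding q_def Q_def by linarith
    qed
    finally show ?thesis by (simp add: sum.distrib)
  qed
  have eB: "N3 QB W W - N3 QB B B \<le> real (card QB) * (2 * (real (card A) * real (card C)) - 5 / 10000 * n ^ 2 - q * n) + (\<Sum>v\<in>QB. err \<epsilon> v)"
  proof -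
    have "N3 QB W W - N3 QB B B = (\<Sum>v\<in>QB. 2 * N2 v A C + 2 * N2 v B A + 2 * N2 v B C + N2 v A A + N2 v C C)"
      unfolding W_def N3_square_Un3[OF fin disj] by (simp add: N3_N2 sum.distrib sum_distrib_left N2_commute[of _ B A])
    also have "\<dots> \<le> (\<Sum>v\<in>QB. 2 * (real (card A) * real (card C)) - 5 / 10000 * n ^ 2 - q * n + err \<epsilon> v)"
    proof (rule sum_mono)
      fix v assume v: "v \<in> QB"
      have "v \<in> V - (B \<union> A \<union> C)" "N2 v B A \<le> N2 v A C" "N2 v B C \<le> N2 v A C"
        using v by (auto simp: QA_def QB_def Q_def N2_commute[of v B A])
      from exceptional_vertex[OF cf2 this(1) n \<epsilon> this(2,3)]
      show "2 * N2 v A C + 2 * N2 v B A + 2 * N2 v B C + N2 v A A + N2 v C C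
         \<le> 2 * (real (card A) * real (card C)) - 5 / 10000 * n ^ 2 - q * n + err \<epsilon> v"
        unfolding q_def Q_def Wc W_def by linarith
    qed
    finally show ?thesis by (simp add: sum.distrib)
  qed
  have eC: "N3 QC W W - N3 QC C C \<le> real (card QC) * (2 * (real (card A) * real (card B)) - 5 / 10000 * n ^ 2 - q * n) + (\<Sum>v\<in>QC. err \<epsilon> v)"
  proof -
    have "N3 QC W W - N3 QC C C = (\<Sum>v\<in>QC. 2 * N2 v A B + 2 * N2 v C A + 2 * N2 v C B + N2 v A A + N2 v B B)"
      unfolding W_def N3_square_Un3[OF fin disj]
      by (simp add: N3_N2 sum.distrib sum_distrib_left N2_commute[of _ C A] N2_commute[of _ C B])
    also have "\<dots> \<le> (\<Sum>v\<in>QC. 2 * (real (card A) * real (card B)) - 5 / 10000 * n ^ 2 - q * n + err \<epsilon> v)"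
    proof (rule sum_mono)
      fix v assume v: "v \<in> QC"
      have "v \<in> V - (C \<union> A \<union> B)" "N2 v C A \<le> N2 v A B" "N2 v C B \<le> N2 v A B"
        using v by (auto simp: QA_def QB_def QC_def Q_def N2_commute[of v C A] N2_commute[of v C B])
      from exceptional_vertex[OF cf3 this(1) n \<epsilon> this(2,3)]
      show "2 * N2 v A B + 2 * N2 v C A + 2 * N2 v C B + N2 v A A + N2 v B B
         \<le> 2 * (real (card A) * real (card B)) - 5 / 10000 * n ^ 2 - q * n + err \<epsilon> v"
        unfolding q_def Q_def Wc W_def by linarith
    qed
    finally show ?thesis by (simp add: sum.distrib)
  qed
  define P1 P2 P3 where "P1 = A \<union> QA" and "P2 = B \<union> QB" and "P3 = C \<union> QC"
  have dA: "A \<inter> QA = {}" "B \<inter> QB = {}" "C \<inter> QC = {}" by (auto simp: QA_def QB_def QC_def Q_def)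
  have tA: "N3 A A A + 3 * N3 QA A A \<le> N3 P1 P1 P1" "N3 B B B + 3 * N3 QB B B \<le> N3 P2 P2 P2" "N3 C C C + 3 * N3 QC C C \<le> N3 P3 P3 P3"
    unfolding P1_def P2_def P3_def using fin finQ dA N3_nonneg by (simp_all add: N3_cube_Un)
  have NQ: "N3 Q W W = N3 QA W W + N3 QB W W + N3 QC W W"
    unfolding QU using finQ Qd by (simp add: N3_Un1 Int_Un_distrib2)
  have cP: "real (card P1) = real (card A) + real (card QA)" "real (card P2) = real (card B) + real (card QB)"
     "real (card P3) = real (card C) + real (card QC)"
    unfolding P1_def P2_def P3_def using fin finQ dA by (simp_all add: card_Un_disjoint)
  have cQ: "q = real (card QA) + real (card QB) + real (card QC)"
    unfolding q_def QU using finQ Qd by (simp add: card_Un_disjoint Int_Un_distrib2)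
  have cV: "n = real (card W) + q" unfolding q_def using VW finQ by (simp add: card_Un_disjoint)
  \<comment> \<open>These edges are paid for by the term \<open>- q * n\<close> in
    \<open>eA\<close>, \<open>eB\<close> and \<open>eC\<close>, which adds up to exactly 3 q^2
    n.\<close>
  have QQ: "3 * N3 Q Q W + N3 Q Q Q \<le> 3 * q ^ 2 * n"
  proof -
    have "N3 Q Q W \<le> q * q * real (card W)" "N3 Q Q Q \<le> q * q * q" using N3_le[of Q Q W] N3_le[of Q Q Q] by (simp_all add: q_def)
    moreover have "3 * q ^ 2 * n = 3 * (q * q * real (card W)) + 3 * (q * q * q)" unfolding cV by (simp add: power2_eq_square algebra_simps)
    moreover have "0 \<le> q * q * q" by (simp add: q_def)
    ultimately show ?thesis by linarith
  qed
  have errs: "(\<Sum>v\<in>A. err \<epsilon> v) + (\<Sum>v\<in>B. err \<epsilon> v) + (\<Sum>v\<in>C. err \<epsilon> v) + (\<Sum>v\<in>QA. err \<epsilon> v) + (\<Sum>v\<in>QB. err \<epsilon> v) + (\<Sum>v\<in>QC. err \<epsilon> v)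
      \<le> 2 * \<epsilon> * n ^ 3 + n ^ 2 / \<epsilon> ^ 2"
  proof -
    have "(\<Sum>v\<in>V. err \<epsilon> v) = (\<Sum>v\<in>W. err \<epsilon> v) + (\<Sum>v\<in>Q. err \<epsilon> v)"
      using VW(2) finQ by (subst VW(1)) (simp add: sum.union_disjoint)
    also have "(\<Sum>v\<in>W. err \<epsilon> v) = (\<Sum>v\<in>A. err \<epsilon> v) + (\<Sum>v\<in>B. err \<epsilon> v) + (\<Sum>v\<in>C. err \<epsilon> v)"
      unfolding W_def using fin disj by (simp add: sum.union_disjoint Int_Un_distrib2)
    also have "(\<Sum>v\<in>Q. err \<epsilon> v) = (\<Sum>v\<in>QA. err \<epsilon> v) + (\<Sum>v\<in>QB. err \<epsilon> v) + (\<Sum>v\<in>QC. err \<epsilon> v)"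
      unfolding QU using finQ Qd by (simp add: sum.union_disjoint Int_Un_distrib2)
    finally show ?thesis using sum_err_le[OF \<epsilon> n0] by linarith
  qed
  \<comment> \<open>The slack left over: 0.15 = 6 - 9 * 0.65 from the typical vertices and 0.0015 =
    3 * 0.0005 from the exceptional ones. The factor 4000 in the conclusion is 6 / 0.0015.\<close>
  define \<mu> where "\<mu> = 15 / 100 * missing A B C + 15 / 10000 * q * n ^ 2"
  have q0: "0 \<le> q" by (simp add: q_def)
  have N3V: "N3 V V V = N3 W W W + 3 * N3 Q W W + 3 * N3 Q Q W + N3 Q Q Q"
    using N3_cube_Un[of W Q] finQ VW by simp
  define a b c qa qb qc where "a = real (card A)" and "b = real (card B)" and "c = real (card C)"
    and "qa = real (card QA)" and "qb = real (card QB)" and "qc = real (card QC)"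
  have nn: "0 \<le> a" "0 \<le> b" "0 \<le> c" "0 \<le> qa" "0 \<le> qb" "0 \<le> qc" by (simp_all add: a_def b_def c_def qa_def qb_def qc_def)
  define RA RB RC Z X where "RA = qa * (2 * (b * c) - 5 / 10000 * n ^ 2 - q * n)"
    and "RB = qb * (2 * (a * c) - 5 / 10000 * n ^ 2 - q * n)" and "RC = qc * (2 * (a * b) - 5 / 10000 * n ^ 2 - q * n)"
    and "Z = 3 * q ^ 2 * n" and "X = 2 * \<epsilon> * n ^ 3 + n ^ 2 / \<epsilon> ^ 2"
  note R = RA_def RB_def RC_def Z_def X_def and abc = a_def b_def c_def qa_def qb_def qc_def
  have "N3 V V V - N3 P1 P1 P1 - N3 P2 P2 P2 - N3 P3 P3 P3 \<le> 6 * N3 A B C + 585 / 100 * missing A B C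
     + 3 * (RA + RB + RC) + Z + 3 * X"
    using N3V tA NQ sA sB sC eA[folded abc, folded R] eB[folded abc, folded R] eC[folded abc, folded R] QQ[folded R] errs[folded R] N3_cube_Un3[OF fin disj, folded W_def]
    by argo
  moreover have "N3 A B C = a * b * c - missing A B C" by (simp add: missing_def a_def b_def c_def)
  moreover have "qa * (2 * (b * c) - 5 / 10000 * n ^ 2 - q * n) + qb * (2 * (a * c) - 5 / 10000 * n ^ 2 - q * n)
         + qc * (2 * (a * b) - 5 / 10000 * n ^ 2 - q * n) = 2 * (qa * (b * c) + qb * (a * c) + qc * (a * b)) - 5 / 10000 * q * n ^ 2 - q ^ 2 * n"
    unfolding cQ qa_def[symmetric] qb_def[symmetric] qc_def[symmetric] by (simp add: power2_eq_square algebra_simps)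
  moreover have "a * b * c + (qa * (b * c) + qb * (a * c) + qc * (a * b)) \<le> (a + qa) * (b + qb) * (c + qc)"
  proof -
    have "(a + qa) * (b + qb) * (c + qc) = a * b * c + (qa * (b * c) + qb * (a * c) + qc * (a * b))
       + (a * qb * qc + qa * b * qc + qa * qb * c + qa * qb * qc)" by (simp add: algebra_simps)
    moreover have "0 \<le> a * qb * qc + qa * b * qc + qa * qb * c + qa * qb * qc" using nn by simp
    ultimately show ?thesis by linarith
  qed
  moreover note RA_def RB_def RC_def Z_def X_def
  ultimately have main: "N3 V V V - N3 P1 P1 P1 - N3 P2 P2 P2 - N3 P3 P3 P3 + \<mu>
      \<le> 6 * (real (card P1) * real (card P2) * real (card P3)) + 6 * \<epsilon> * n ^ 3 + 3 * n ^ 2 / \<epsilon> ^ 2"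
    unfolding cP \<mu>_def a_def[symmetric] b_def[symmetric] c_def[symmetric] qa_def[symmetric] qb_def[symmetric] qc_def[symmetric]
    by argo
  have sz: "a + qa \<le> n" "b + qb \<le> n" "c + qc \<le> n" "a \<le> n" "b \<le> n"
  proof -
    have "n = a + b + c + (qa + qb + qc)"
      unfolding cV cQ a_def b_def c_def qa_def qb_def qc_def W_def
      using fin disj by (simp add: card_Un_disjoint Int_Un_distrib2)
    then show "a + qa \<le> n" "b + qb \<le> n" "c + qc \<le> n" "a \<le> n" "b \<le> n" using nn by linarith+
  qed
  have "(a + qa) * (b + qb) * (c + qc) - a * b * c \<le> q * n ^ 2"
  proof -
    have "qa * ((b + qb) * (c + qc)) \<le> qa * (n * n)" "qb * (a * (c + qc)) \<le> qb * (n * n)" "qc * (a * b) \<le> qc * (n * n)"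
      using nn sz by (auto intro!: mult_left_mono mult_mono)
    then show ?thesis unfolding cQ qa_def[symmetric] qb_def[symmetric] qc_def[symmetric]
      by (simp add: power2_eq_square algebra_simps)
  qed
  moreover have "N3 A B C \<le> N3 P1 P2 P3"
    unfolding P1_def P2_def P3_def using fin finQ dA N3_nonneg by (simp add: N3_Un1 N3_Un2 N3_Un3 add_nonneg_nonneg)
  moreover have "N3 A B C = a * b * c - missing A B C" by (simp add: missing_def a_def b_def c_def)
  moreover have "0 \<le> missing A B C" "0 \<le> q * n ^ 2" using missing_nonneg q0 by auto
  ultimately have "6 * (real (card P1) * real (card P2) * real (card P3)) - 6 * N3 P1 P2 P3 \<le> 4000 * \<mu>"
    unfolding cP \<mu>_def a_def[symmetric] b_def[symmetric] c_def[symmetric] qa_def[symmetric] qb_def[symmetric] qc_def[symmetric]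
    by argo
  moreover have "0 \<le> \<mu>" unfolding \<mu>_def using missing_nonneg[of A B C] q0 by simp
  moreover have "304 / 1000 * n \<le> real (card P1)" "304 / 1000 * n \<le> real (card P2)" "304 / 1000 * n \<le> real (card P3)"
    unfolding cP using cf unfolding config_def by (auto intro: order_trans)
  moreover have "P1 \<union> P2 \<union> P3 = V" using VW(1) unfolding P1_def P2_def P3_def W_def QU by blast
  moreover have "P1 \<inter> P2 = {}" "P1 \<inter> P3 = {}" "P2 \<inter> P3 = {}"
    unfolding P1_def P2_def P3_def using disj by (auto simp: QA_def QB_def QC_def Q_def)
  ultimately show thesis by (intro that[OF _ _ _ _ _ _ _ _ main]) auto
qed

text \<open>Expanding (p + q + r)^3 shows that n^3 exceeds p^3 + q^3 + r^3 by at least 24pqr, so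
  \<open>\<rho> \<ge> 1 / 4\<close> lets the transversal edges contribute at most their share of
  \<rho> n^3. Near-extremality therefore bounds (24 \<rho> - 6) pqr + \<open>\<mu>\<close> by the
  errors. Of the 4 \<open>\<eta>\<close> in \<open>E\<close>, one belongs to \<open>V\<close> and
  three to the parts.\<close>

lemma near_tripartite:
  assumes d: "dense \<rho> \<eta>" and \<eta>: "\<eta> \<le> 4 / 10000000" and n: "30000000000 \<le> n" and \<epsilon>: "0 < \<epsilon>"
    and E: "E = 4 * \<eta> + 6 * \<epsilon> + 3 / (\<epsilon> ^ 2 * n)"
  obtains P1 P2 P3 where "P1 \<union> P2 \<union> P3 = V" "P1 \<inter> P2 = {}" "P1 \<inter> P3 = {}" "P2 \<inter> P3 = {}"
    "304 / 1000 * n \<le> real (card P1)" "304 / 1000 * n \<le> real (card P2)" "304 / 1000 * n \<le> real (card P3)"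
    "(\<rho> - 1 / 4) / 2 \<le> E"
    "N3 V V V - N3 P1 P1 P1 - N3 P2 P2 P2 - N3 P3 P3 P3 - 6 * N3 P1 P2 P3 \<le> 4001 * E * n ^ 3"
    "\<rho> * real (card P1) ^ 3 - E * n ^ 3 \<le> N3 P1 P1 P1" "\<rho> * real (card P2) ^ 3 - E * n ^ 3 \<le> N3 P2 P2 P2"
    "\<rho> * real (card P3) ^ 3 - E * n ^ 3 \<le> N3 P3 P3 P3"
proof -
  have n0: "0 < n" using n by linarith
  obtain A B C where "config A B C" using exists_config[OF d \<eta> n] .
  then obtain P1 P2 P3 \<mu> where P: "P1 \<union> P2 \<union> P3 = V" "P1 \<inter> P2 = {}" "P1 \<inter> P3 = {}" "P2 \<inter> P3 = {}"
    and sz: "304 / 1000 * n \<le> real (card P1)" "304 / 1000 * n \<le> real (card P2)" "304 / 1000 * n \<le> real (card P3)"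
    and \<mu>: "0 \<le> \<mu>"
    and X: "N3 V V V - N3 P1 P1 P1 - N3 P2 P2 P2 - N3 P3 P3 P3 + \<mu>
      \<le> 6 * (real (card P1) * real (card P2) * real (card P3)) + 6 * \<epsilon> * n ^ 3 + 3 * n ^ 2 / \<epsilon> ^ 2"
    and bad: "6 * (real (card P1) * real (card P2) * real (card P3)) - 6 * N3 P1 P2 P3 \<le> 4000 * \<mu>"
    by (rule config_partition[OF _ n \<epsilon>])
  define p q r where "p = real (card P1)" and "q = real (card P2)" and "r = real (card P3)"
  have fin: "finite P1" "finite P2" "finite P3" using P(1) finite_V by auto
  have pqr: "n = p + q + r"
    unfolding p_def q_def r_def using fin P by (simp add: card_Un_disjoint Int_Un_distrib2 flip: P(1))
  have nn: "0 \<le> p" "0 \<le> q" "0 \<le> r" by (simp_all add: p_def q_def r_def)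
  have \<eta>0: "0 \<le> \<eta>" and \<rho>: "1 / 4 \<le> \<rho>" and T: "(\<rho> - \<eta>) * n ^ 3 \<le> N3 V V V" using d by (auto simp: dense_def)
  have ub: "N3 P1 P1 P1 \<le> \<rho> * p ^ 3 + \<eta> * n ^ 3" "N3 P2 P2 P2 \<le> \<rho> * q ^ 3 + \<eta> * n ^ 3" "N3 P3 P3 P3 \<le> \<rho> * r ^ 3 + \<eta> * n ^ 3"
    using d P(1) unfolding dense_def p_def q_def r_def by blast+
  define D where "D = (6 * \<epsilon> + 3 / (\<epsilon> ^ 2 * n)) * n ^ 3"
  have D0: "0 \<le> D" using \<epsilon> n0 by (simp add: D_def)
  have D: "6 * \<epsilon> * n ^ 3 + 3 * n ^ 2 / \<epsilon> ^ 2 = D"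
    unfolding D_def using \<epsilon> n0 by (simp add: distrib_right power2_eq_square power3_eq_cube)
  have En: "E * n ^ 3 = 4 * (\<eta> * n ^ 3) + D" unfolding E D_def by (simp add: algebra_simps)
  have \<eta>n: "0 \<le> \<eta> * n ^ 3" using \<eta>0 by simp
  define m where "m = p * q * r"
  have cube: "24 * m \<le> n ^ 3 - p ^ 3 - q ^ 3 - r ^ 3"
  proof -
    have "n ^ 3 - p ^ 3 - q ^ 3 - r ^ 3 - 24 * m = 3 * (p * (q - r) ^ 2 + q * (p - r) ^ 2 + r * (p - q) ^ 2)"
      unfolding pqr m_def by (simp add: power2_eq_square power3_eq_cube algebra_simps)
    moreover have "0 \<le> 3 * (p * (q - r) ^ 2 + q * (p - r) ^ 2 + r * (p - q) ^ 2)" using nn by simp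
    ultimately show ?thesis by linarith
  qed
  then have cube': "\<rho> * (24 * m) \<le> \<rho> * n ^ 3 - \<rho> * p ^ 3 - \<rho> * q ^ 3 - \<rho> * r ^ 3"
    using mult_left_mono[of _ _ \<rho>] \<rho> by (simp add: right_diff_distrib[symmetric])
  have m6: "6 * m \<le> \<rho> * (24 * m)"
  proof -
    have "0 \<le> m" using nn by (simp add: m_def)
    then have "1 / 4 * (24 * m) \<le> \<rho> * (24 * m)" using \<rho> by (intro mult_right_mono) auto
    then show ?thesis by simp
  qed
  have T': "\<rho> * n ^ 3 - \<eta> * n ^ 3 \<le> N3 V V V" using T by (simp add: left_diff_distrib)
  have X': "N3 V V V - N3 P1 P1 P1 - N3 P2 P2 P2 - N3 P3 P3 P3 + \<mu> \<le> 6 * m + D"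
    using X D unfolding m_def p_def q_def r_def by linarith
  have bad': "6 * m - 6 * N3 P1 P2 P3 \<le> 4000 * \<mu>" using bad unfolding m_def p_def q_def r_def .
  define s0 s1 s2 s3 y w F where "s0 = \<rho> * n ^ 3" and "s1 = \<rho> * p ^ 3" and "s2 = \<rho> * q ^ 3" and "s3 = \<rho> * r ^ 3"
    and "y = \<eta> * n ^ 3" and "w = \<rho> * (24 * m)" and "F = E * n ^ 3"
  note f = s0_def s1_def s2_def s3_def y_def w_def F_def
  note facts = X' bad' ub[folded f] T'[folded f] cube'[folded f] m6[folded f] En[folded f] \<eta>n[folded f] \<mu> D0
  have key: "w - 6 * m + \<mu> \<le> F" using facts by linarith
  have \<mu>E: "\<mu> \<le> F" using facts by linarith
  have "(\<rho> - 1 / 4) / 2 \<le> E"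
  proof -
    have "(304 / 1000 * n) * (304 / 1000 * n) * (304 / 1000 * n) \<le> m"
      unfolding m_def using sz[folded p_def q_def r_def] nn n0 by (intro mult_mono) auto
    moreover have "(304 / 1000 * n) * (304 / 1000 * n) * (304 / 1000 * n) = 28094464 / 1000000000 * n ^ 3"
      by (simp add: power3_eq_cube)
    moreover have "0 \<le> n ^ 3" by simp
    ultimately have "28 / 1000 * n ^ 3 \<le> m" by linarith
    then have "(24 * \<rho> - 6) * (28 / 1000 * n ^ 3) \<le> (24 * \<rho> - 6) * m" using \<rho> by (intro mult_left_mono) auto
    also have "\<dots> \<le> E * n ^ 3" using key \<mu> unfolding f by (simp add: algebra_simps)
    finally have "(24 * \<rho> - 6) * (28 / 1000) * n ^ 3 \<le> E * n ^ 3" by (simp only: mult.assoc)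
    then have "(24 * \<rho> - 6) * (28 / 1000) \<le> E" using n0 by (simp only: mult_le_cancel_right_pos zero_less_power)
    \<comment> \<open>24 * 0.028 exceeds 1/2.\<close>
    then show ?thesis using \<rho> by argo
  qed
  moreover have "N3 V V V - N3 P1 P1 P1 - N3 P2 P2 P2 - N3 P3 P3 P3 - 6 * N3 P1 P2 P3 \<le> 4001 * E * n ^ 3"
  proof -
    have "4001 * E * n ^ 3 = 4001 * F" by (simp add: F_def)
    then show ?thesis using facts \<mu>E by linarith
  qed
  moreover have "\<rho> * p ^ 3 - E * n ^ 3 \<le> N3 P1 P1 P1" "\<rho> * q ^ 3 - E * n ^ 3 \<le> N3 P2 P2 P2" "\<rho> * r ^ 3 - E * n ^ 3 \<le> N3 P3 P3 P3"
    unfolding f[symmetric] using facts by linarith+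
  ultimately show thesis using that[OF P sz] unfolding p_def q_def r_def by blast
qed

section \<open>Restriction to a part\<close>

lemma subgraph:
  assumes S: "S \<subseteq> V" and sy: "sym3 h'" and le: "\<And>x y z. h' x y z \<Longrightarrow> h x y z \<and> x \<in> S \<and> y \<in> S \<and> z \<in> S"
  shows "c5_free S h'"
proof
  show "finite S" using S finite_V by (rule finite_subset)
  show "sym3 h'" by (rule sy)
  show "a \<in> S \<and> b \<in> S \<and> c \<in> S \<and> a \<noteq> b \<and> a \<noteq> c \<and> b \<noteq> c" if "h' a b c" for a b c
    using le[OF that] edge[of a b c] by blast
  show "\<not> (h' a b c \<and> h' b c d \<and> h' c d e \<and> h' d e a)" if "distinct [a, b, c, d, e]" for a b c d e
    using c5[OF that] le by blast
qed

definition restr :: "'a set \<Rightarrow> 'a \<Rightarrow> 'a \<Rightarrow> 'a \<Rightarrow> bool" where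
  "restr S x y z \<longleftrightarrow> h x y z \<and> x \<in> S \<and> y \<in> S \<and> z \<in> S"

lemma restr: "S \<subseteq> V \<Longrightarrow> c5_free S (restr S)"
  by (rule subgraph) (use sym in \<open>auto simp: restr_def sym3_def\<close>)

lemma N3_restr:
  assumes "S \<subseteq> V"
  shows "c5_free.N3 (restr S) S S S = N3 S S S"
proof -
  interpret r: c5_free S "restr S" by (rule restr[OF assms])
  show ?thesis unfolding r.N3_def N3_def by (intro sum.cong refl) (simp add: restr_def)
qed

end

section \<open>The extremal density\<close>

abbreviation T :: "('a \<Rightarrow> 'a \<Rightarrow> 'a \<Rightarrow> bool) \<Rightarrow> 'a set \<Rightarrow> real" where
  "T h S \<equiv> c5_free.N3 h S S S"

text \<open>The extremal density is taken as an infimum of admissible bounds, which avoids proving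
  that a limit exists; \<open>K\<close> absorbs small graphs. Demanding
  \<open>1 / 4 \<le> \<rho>\<close> from the start replaces the analysis of a lower-bound
  construction.\<close>

definition bounds :: "'a itself \<Rightarrow> real set" where
  "bounds _ = {\<rho>. 1 / 4 \<le> \<rho> \<and> \<rho> \<le> 1 \<and>
     (\<exists>K. \<forall>V (h :: 'a \<Rightarrow> 'a \<Rightarrow> 'a \<Rightarrow> bool). c5_free V h \<longrightarrow> T h V \<le> \<rho> * real (card V) ^ 3 + K)}"

lemma one_in_bounds: "1 \<in> bounds TYPE('a)"
proof -
  have "T h V \<le> 1 * real (card V) ^ 3 + 0" if "c5_free V h" for V and h :: "'a \<Rightarrow> 'a \<Rightarrow> 'a \<Rightarrow> bool"
    using c5_free.N3_le[OF that, of V V V] by (simp add: power3_eq_cube)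
  then show ?thesis unfolding bounds_def by (auto intro!: exI[of _ 0])
qed

text \<open>Some \<open>\<rho>'\<close> below \<open>\<rho> + \<eta> / 2\<close> is admissible, and
  its constant \<open>K\<close> is at most \<eta> n^3 / 2 for large n. The bound passes to every
  subset because \<open>restr S\<close> is again free.\<close>

lemma eventually_dense:
  assumes \<rho>: "\<rho> = Inf (bounds TYPE('a))" and \<eta>: "0 < \<eta>"
  obtains N where "\<And>V (h :: 'a \<Rightarrow> 'a \<Rightarrow> 'a \<Rightarrow> bool). c5_free V h \<Longrightarrow> N \<le> real (card V) \<Longrightarrow>
    (\<rho> - \<eta>) * real (card V) ^ 3 \<le> T h V \<Longrightarrow> c5_free.dense V h \<rho> \<eta>"
proof -
  have ne: "bounds TYPE('a) \<noteq> {}" using one_in_bounds by blast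
  have bdd: "bdd_below (bounds TYPE('a))" by (rule bdd_belowI[of _ "1 / 4"]) (simp add: bounds_def)
  have "1 / 4 \<le> \<rho>" unfolding \<rho> by (rule cInf_greatest[OF ne]) (simp add: bounds_def)
  moreover have "\<rho> \<le> 1" unfolding \<rho> by (rule cInf_lower[OF one_in_bounds bdd])
  moreover obtain \<rho>' where \<rho>': "\<rho>' \<in> bounds TYPE('a)" "\<rho>' < \<rho> + \<eta> / 2"
    using cInf_lessD[OF ne, of "\<rho> + \<eta> / 2"] \<rho> \<eta> by auto
  then obtain K where K: "\<And>V (h :: 'a \<Rightarrow> 'a \<Rightarrow> 'a \<Rightarrow> bool). c5_free V h \<Longrightarrow> T h V \<le> \<rho>' * real (card V) ^ 3 + K"
    unfolding bounds_def by blast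
  have "c5_free.dense V h \<rho> \<eta>"
    if c: "c5_free V h" and N: "max 1 (2 * K / \<eta>) \<le> real (card V)" and T: "(\<rho> - \<eta>) * real (card V) ^ 3 \<le> T h V"
    for V and h :: "'a \<Rightarrow> 'a \<Rightarrow> 'a \<Rightarrow> bool"
  proof -
    interpret c5_free V h by (rule c)
    have n1: "1 \<le> n" using N by simp
    have "n * 1 \<le> n * (n * n)" using n1 mult_mono[of 1 n 1 n] by (intro mult_left_mono) auto
    then have n3: "n \<le> n ^ 3" by (simp add: power3_eq_cube)
    have "2 * K / \<eta> \<le> n" using N by simp
    then have "2 * K / \<eta> \<le> n ^ 3" using n3 by (rule order_trans)
    then have K': "K \<le> \<eta> / 2 * n ^ 3" using \<eta> by (simp add: field_simps)
    have "N3 S S S \<le> \<rho> * real (card S) ^ 3 + \<eta> * n ^ 3" if S: "S \<subseteq> V" for S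
    proof -
      have "N3 S S S \<le> \<rho>' * real (card S) ^ 3 + K"
        using K[OF restr[OF S]] N3_restr[OF S] by simp
      also have "\<rho>' * real (card S) ^ 3 \<le> (\<rho> + \<eta> / 2) * real (card S) ^ 3"
        using \<rho>' by (intro mult_right_mono) auto
      also have "\<dots> = \<rho> * real (card S) ^ 3 + \<eta> / 2 * real (card S) ^ 3" by (simp add: algebra_simps)
      also have "\<eta> / 2 * real (card S) ^ 3 \<le> \<eta> / 2 * n ^ 3"
        using \<eta> S finite_V by (intro mult_left_mono power_mono) (auto intro: card_mono)
      finally show ?thesis using K' by simp
    qed
    then show ?thesis
      unfolding dense_def using \<open>1 / 4 \<le> \<rho>\<close> \<open>\<rho> \<le> 1\<close> \<eta> T by auto
  qed
  then show thesis by (rule that)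
qed

lemma choose_parameters:
  fixes \<xi> :: real
  assumes "0 < \<xi>"
  obtains \<eta> \<epsilon> N :: real where "0 < \<eta>" "\<eta> \<le> 4 / 10000000" "\<eta> \<le> \<xi> / 12" "0 < \<epsilon>"
    "\<And>n. N \<le> n \<Longrightarrow> 30000000000 \<le> n \<and> 4 * \<eta> + 6 * \<epsilon> + 3 / (\<epsilon> ^ 2 * n) \<le> \<xi>"
proof -
  define \<eta> \<epsilon> where "\<eta> = min (4 / 10000000) (\<xi> / 12)" and "\<epsilon> = \<xi> / 18"
  define N where "N = max 30000000000 (9 / (\<epsilon> ^ 2 * \<xi>))"
  have \<epsilon>: "0 < \<epsilon>" using assms by (simp add: \<epsilon>_def)
  show thesis
  proof (rule that[of \<eta> \<epsilon> N])
    fix n assume n: "N \<le> n"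
    then have n': "30000000000 \<le> n" "9 / (\<epsilon> ^ 2 * \<xi>) \<le> n" by (auto simp: N_def)
    have "9 \<le> n * (\<epsilon> ^ 2 * \<xi>)" using n'(2) \<epsilon> assms by (simp add: pos_divide_le_eq)
    then have "3 / (\<epsilon> ^ 2 * n) \<le> \<xi> / 3" using n'(1) \<epsilon> by (simp add: divide_le_eq mult_ac)
    moreover have "4 * \<eta> \<le> \<xi> / 3" by (simp add: \<eta>_def)
    moreover have "6 * \<epsilon> = \<xi> / 3" by (simp add: \<epsilon>_def)
    ultimately show "30000000000 \<le> n \<and> 4 * \<eta> + 6 * \<epsilon> + 3 / (\<epsilon> ^ 2 * n) \<le> \<xi>" using n'(1) by simp
  qed (use assms \<epsilon> in \<open>auto simp: \<eta>_def\<close>)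
qed

text \<open>Otherwise \<open>\<rho> - \<eta>\<close> is not admissible, so some graph exceeds that
  density by the additive term \<open>L ^ 3\<close>, which forces at least \<open>L\<close>
  vertices. For such a graph \<open>near_tripartite\<close> yields (\<rho> - 1/4)/2 \<le>
  \<open>\<xi>\<close>, half of what it bounds.\<close>

lemma Inf_bounds: "Inf (bounds TYPE('a)) = 1 / 4"
proof (rule ccontr)
  define \<rho> where "\<rho> = Inf (bounds TYPE('a))"
  assume "Inf (bounds TYPE('a)) \<noteq> 1 / 4"
  have ne: "bounds TYPE('a) \<noteq> {}" using one_in_bounds by blast
  have bdd: "bdd_below (bounds TYPE('a))" by (rule bdd_belowI[of _ "1 / 4"]) (simp add: bounds_def)
  have "1 / 4 \<le> \<rho>" unfolding \<rho>_def by (rule cInf_greatest[OF ne]) (simp add: bounds_def)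
  with \<open>Inf (bounds TYPE('a)) \<noteq> 1 / 4\<close> have gt: "1 / 4 < \<rho>" by (simp add: \<rho>_def)
  have \<rho>1: "\<rho> \<le> 1" unfolding \<rho>_def by (rule cInf_lower[OF one_in_bounds bdd])
  define \<xi> where "\<xi> = (\<rho> - 1 / 4) / 4"
  have "0 < \<xi>" using gt by (simp add: \<xi>_def)
  then obtain \<eta> \<epsilon> N where p: "0 < \<eta>" "\<eta> \<le> 4 / 10000000" "\<eta> \<le> \<xi> / 12" "0 < \<epsilon>"
    and N: "\<And>n. N \<le> n \<Longrightarrow> 30000000000 \<le> n \<and> 4 * \<eta> + 6 * \<epsilon> + 3 / (\<epsilon> ^ 2 * n) \<le> \<xi>"
    by (rule choose_parameters) blast
  obtain N' where N': "\<And>V (h :: 'a \<Rightarrow> 'a \<Rightarrow> 'a \<Rightarrow> bool). c5_free V h \<Longrightarrow> N' \<le> real (card V) \<Longrightarrow>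
    (\<rho> - \<eta>) * real (card V) ^ 3 \<le> T h V \<Longrightarrow> c5_free.dense V h \<rho> \<eta>"
    by (rule eventually_dense[OF \<rho>_def p(1)]) blast
  define L where "L = max 1 (max N N')"
  have \<rho>\<eta>: "1 / 4 \<le> \<rho> - \<eta>" "\<rho> - \<eta> \<le> 1" using p gt \<rho>1 unfolding \<xi>_def by argo+
  have "\<rho> - \<eta> \<notin> bounds TYPE('a)"
    using cInf_lower[OF _ bdd, of "\<rho> - \<eta>"] p(1) unfolding \<rho>_def[symmetric] by fastforce
  then have "\<not> (\<exists>K. \<forall>V (h :: 'a \<Rightarrow> 'a \<Rightarrow> 'a \<Rightarrow> bool). c5_free V h \<longrightarrow> T h V \<le> (\<rho> - \<eta>) * real (card V) ^ 3 + K)"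
    using \<rho>\<eta> unfolding bounds_def by blast
  then obtain V and h :: "'a \<Rightarrow> 'a \<Rightarrow> 'a \<Rightarrow> bool" where c: "c5_free V h" and big: "(\<rho> - \<eta>) * real (card V) ^ 3 + L ^ 3 < T h V"
    by (meson not_le)
  interpret c5_free V h by (rule c)
  have "L \<le> n"
  proof (rule ccontr)
    assume "\<not> L \<le> n"
    then have "n ^ 3 \<le> L ^ 3" by (intro power_mono) auto
    moreover have "N3 V V V \<le> n ^ 3" using N3_le[of V V V] by (simp add: power3_eq_cube)
    moreover have "0 \<le> (\<rho> - \<eta>) * n ^ 3" using \<rho>\<eta> by simp
    ultimately show False using big by linarith
  qed
  then have n: "N \<le> n" "N' \<le> n" by (auto simp: L_def)
  have "0 \<le> L ^ 3" by (simp add: L_def)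
  then have d: "dense \<rho> \<eta>" using big by (intro N'[OF c n(2)]) linarith
  have "(\<rho> - 1 / 4) / 2 \<le> 4 * \<eta> + 6 * \<epsilon> + 3 / (\<epsilon> ^ 2 * n)"
    by (rule near_tripartite[OF d p(2) _ p(4) refl]) (use N[OF n(1)] in auto)
  also have "\<dots> \<le> \<xi>" using N[OF n(1)] by blast
  finally show False using gt by (simp add: \<xi>_def)
qed

lemma stability_step:
  fixes \<xi> :: real
  assumes "0 < \<xi>"
  obtains \<delta> N where "0 < \<delta>"
    "\<And>V (h :: 'a \<Rightarrow> 'a \<Rightarrow> 'a \<Rightarrow> bool). c5_free V h \<Longrightarrow> N \<le> real (card V) \<Longrightarrow>
      (1 / 4 - \<delta>) * real (card V) ^ 3 \<le> T h V \<Longrightarrow>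
      \<exists>P1 P2 P3. P1 \<union> P2 \<union> P3 = V \<and> P1 \<inter> P2 = {} \<and> P1 \<inter> P3 = {} \<and> P2 \<inter> P3 = {} \<and>
        (\<forall>P\<in>{P1, P2, P3}. 304 / 1000 * real (card V) \<le> real (card P) \<and>
           1 / 4 * real (card P) ^ 3 - \<xi> * real (card V) ^ 3 \<le> T h P) \<and>
        T h V - T h P1 - T h P2 - T h P3 - 6 * c5_free.N3 h P1 P2 P3 \<le> \<xi> * real (card V) ^ 3"
proof -
  have "0 < \<xi> / 4001" using assms by simp
  then obtain \<eta> \<epsilon> N where p: "0 < \<eta>" "\<eta> \<le> 4 / 10000000" "\<eta> \<le> \<xi> / 4001 / 12" "0 < \<epsilon>"
    and N: "\<And>n. N \<le> n \<Longrightarrow> 30000000000 \<le> n \<and> 4 * \<eta> + 6 * \<epsilon> + 3 / (\<epsilon> ^ 2 * n) \<le> \<xi> / 4001"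
    by (rule choose_parameters) blast
  obtain N' where N': "\<And>V (h :: 'a \<Rightarrow> 'a \<Rightarrow> 'a \<Rightarrow> bool). c5_free V h \<Longrightarrow> N' \<le> real (card V) \<Longrightarrow>
    (1 / 4 - \<eta>) * real (card V) ^ 3 \<le> T h V \<Longrightarrow> c5_free.dense V h (1 / 4) \<eta>"
    by (rule eventually_dense[OF Inf_bounds[symmetric] p(1)]) blast
  show thesis
  proof (rule that[OF p(1), of "max N N'"])
    fix V and h :: "'a \<Rightarrow> 'a \<Rightarrow> 'a \<Rightarrow> bool"
    assume c: "c5_free V h" and n: "max N N' \<le> real (card V)" and T: "(1 / 4 - \<eta>) * real (card V) ^ 3 \<le> T h V"
    interpret c5_free V h by (rule c)
    have d: "dense (1 / 4) \<eta>" using n by (intro N'[OF c _ T]) simp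
    have n': "30000000000 \<le> n" and E: "4 * \<eta> + 6 * \<epsilon> + 3 / (\<epsilon> ^ 2 * n) \<le> \<xi> / 4001" using N[of n] n by auto
    obtain P1 P2 P3 where P: "P1 \<union> P2 \<union> P3 = V" "P1 \<inter> P2 = {}" "P1 \<inter> P3 = {}" "P2 \<inter> P3 = {}"
      and sz: "304 / 1000 * n \<le> real (card P1)" "304 / 1000 * n \<le> real (card P2)" "304 / 1000 * n \<le> real (card P3)"
      and bad: "N3 V V V - N3 P1 P1 P1 - N3 P2 P2 P2 - N3 P3 P3 P3 - 6 * N3 P1 P2 P3 \<le> 4001 * (4 * \<eta> + 6 * \<epsilon> + 3 / (\<epsilon> ^ 2 * n)) * n ^ 3"
      and low: "1 / 4 * real (card P1) ^ 3 - (4 * \<eta> + 6 * \<epsilon> + 3 / (\<epsilon> ^ 2 * n)) * n ^ 3 \<le> N3 P1 P1 P1"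
        "1 / 4 * real (card P2) ^ 3 - (4 * \<eta> + 6 * \<epsilon> + 3 / (\<epsilon> ^ 2 * n)) * n ^ 3 \<le> N3 P2 P2 P2"
        "1 / 4 * real (card P3) ^ 3 - (4 * \<eta> + 6 * \<epsilon> + 3 / (\<epsilon> ^ 2 * n)) * n ^ 3 \<le> N3 P3 P3 P3"
      by (rule near_tripartite[OF d p(2) n' p(4) refl]) blast
    have "4001 * (4 * \<eta> + 6 * \<epsilon> + 3 / (\<epsilon> ^ 2 * n)) * n ^ 3 \<le> \<xi> * n ^ 3"
      using E by (intro mult_right_mono) auto
    moreover have "(4 * \<eta> + 6 * \<epsilon> + 3 / (\<epsilon> ^ 2 * n)) * n ^ 3 \<le> \<xi> * n ^ 3"
    proof (rule mult_right_mono)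
      have "\<xi> / 4001 \<le> \<xi>" using assms by simp
      then show "4 * \<eta> + 6 * \<epsilon> + 3 / (\<epsilon> ^ 2 * n) \<le> \<xi>" using E by linarith
    qed simp
    ultimately show "\<exists>P1 P2 P3. P1 \<union> P2 \<union> P3 = V \<and> P1 \<inter> P2 = {} \<and> P1 \<inter> P3 = {} \<and> P2 \<inter> P3 = {} \<and>
        (\<forall>P\<in>{P1, P2, P3}. 304 / 1000 * n \<le> real (card P) \<and> 1 / 4 * real (card P) ^ 3 - \<xi> * n ^ 3 \<le> T h P) \<and>
        T h V - T h P1 - T h P2 - T h P3 - 6 * N3 P1 P2 P3 \<le> \<xi> * n ^ 3"
      using P sz bad low by (intro exI[of _ P1] exI[of _ P2] exI[of _ P3]) auto
  qed
qed

section \<open>Stability\<close>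

text \<open>Two singleton parts and recursion on the rest. Any construction will do, since it only
  feeds the trivial start \<open>stable_ge_1\<close>.\<close>

lemma ex_T_rec_construction: "finite V \<Longrightarrow> \<exists>E. T_rec_construction V E"
proof (induction "card V" arbitrary: V rule: less_induct)
  case less
  show ?case
  proof (cases "card V \<le> 2")
    case True
    then show ?thesis using T_rec_construction.small[OF less.prems] by blast
  next
    case False
    then have "3 \<le> card V" by simp
    then obtain S where S: "S \<subseteq> V" "card S = 2"
      by (metis (no_types) numeral_2_eq_2 numeral_3_eq_3 Suc_leD obtain_subset_with_card_n)
    then obtain x y where xy: "S = {x, y}" "x \<noteq> y" by (meson card_2_iff)
    have "card (V - {x, y}) = card V - 2"
      using S xy less.prems by (simp add: card_Diff_subset)
    then have c: "card (V - {x, y}) < card V" "card (V - {x, y}) \<noteq> 0" using False by auto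
    then obtain E where E: "T_rec_construction (V - {x, y}) E" using less.hyps[of "V - {x, y}"] less.prems by blast
    have ne: "V - {x, y} \<noteq> {}" using c(2) by (metis card.empty)
    have "T_rec_construction ({x} \<union> {y} \<union> (V - {x, y})) (complete_3partite {x} {y} (V - {x, y}) \<union> {} \<union> {} \<union> E)"
      by (rule T_rec_construction.step)
        (use xy ne E in \<open>auto intro: T_rec_construction.small\<close>)
    moreover have "{x} \<union> {y} \<union> (V - {x, y}) = V" using S xy by auto
    ultimately show ?thesis by auto
  qed
qed

lemma card_ordered_triples:
  assumes V: "finite V" and F: "\<And>e. e \<in> F \<Longrightarrow> e \<subseteq> V \<and> card e = 3"
  shows "(\<Sum>x\<in>V. \<Sum>y\<in>V. \<Sum>z\<in>V. of_bool ({x, y, z} \<in> F) :: real) = 6 * real (card F)"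
proof -
  let ?P = "V \<times> V \<times> V"
  have fF: "finite F" using V F by (metis finite_Pow_iff finite_subset PowI subsetI)
  have c6: "card {(x, y, z). (x, y, z) \<in> ?P \<and> {x, y, z} = e} = 6" if "e \<in> F" for e
  proof -
    obtain a b c where e: "e = {a, b, c}" "a \<noteq> b" "a \<noteq> c" "b \<noteq> c"
      using F[OF \<open>e \<in> F\<close>] by (metis card_3_iff)
    have V3: "a \<in> V" "b \<in> V" "c \<in> V" using F[OF \<open>e \<in> F\<close>] e by auto
    let ?O = "{(a, b, c), (a, c, b), (b, a, c), (b, c, a), (c, a, b), (c, b, a)}"
    have O1: "(x, y, z) \<in> ?O" if eq: "{x, y, z} = {a, b, c}" for x y z
    proof -
      have "x \<in> {a, b, c}" "y \<in> {a, b, c}" "z \<in> {a, b, c}" "a \<in> {x, y, z}" "b \<in> {x, y, z}" "c \<in> {x, y, z}"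
        using eq by blast+
      then show ?thesis using e(2-4) by auto
    qed
    have O2: "t \<in> ?P \<and> {fst t, fst (snd t), snd (snd t)} = {a, b, c}" if "t \<in> ?O" for t
      using that V3 by auto
    have "{(x, y, z). (x, y, z) \<in> ?P \<and> {x, y, z} = e} = ?O"
    proof (intro equalityI subsetI)
      fix t assume t: "t \<in> {(x, y, z). (x, y, z) \<in> ?P \<and> {x, y, z} = e}"
      obtain x y z where xyz: "t = (x, y, z)" by (metis surj_pair)
      show "t \<in> ?O" unfolding xyz by (rule O1) (use t in \<open>simp add: xyz e(1)\<close>)
    next
      fix t assume t: "t \<in> ?O"
      obtain x y z where xyz: "t = (x, y, z)" by (metis surj_pair)
      show "t \<in> {(x, y, z). (x, y, z) \<in> ?P \<and> {x, y, z} = e}"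
        using O2[OF t] by (simp add: xyz e(1))
    qed
    then show ?thesis using e by simp
  qed
  have "(\<Sum>x\<in>V. \<Sum>y\<in>V. \<Sum>z\<in>V. of_bool ({x, y, z} \<in> F) :: real) = (\<Sum>(x, y, z)\<in>?P. of_bool ({x, y, z} \<in> F))"
    by (simp add: sum.cartesian_product)
  also have "\<dots> = (\<Sum>(x, y, z)\<in>?P. \<Sum>e\<in>F. of_bool ({x, y, z} = e))"
    using fF by (intro sum.cong refl) (auto simp: of_bool_def sum.delta')
  also have "\<dots> = (\<Sum>e\<in>F. \<Sum>(x, y, z)\<in>?P. of_bool ({x, y, z} = e))"
    unfolding split_def by (rule sum.swap)
  also have "\<dots> = (\<Sum>e\<in>F. 6)"
  proof (intro sum.cong refl)
    fix e assume e: "e \<in> F"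
    have "(\<Sum>(x, y, z)\<in>?P. of_bool ({x, y, z} = e) :: real) = (\<Sum>t\<in>?P. if t \<in> {(x, y, z). {x, y, z} = e} then 1 else 0)"
      by (intro sum.cong refl) auto
    also have "\<dots> = real (card (?P \<inter> {(x, y, z). {x, y, z} = e}))"
      using V by (simp add: sum.If_cases)
    also have "?P \<inter> {(x, y, z). {x, y, z} = e} = {(x, y, z). (x, y, z) \<in> ?P \<and> {x, y, z} = e}" by auto
    finally show "(\<Sum>(x, y, z)\<in>?P. of_bool ({x, y, z} = e) :: real) = 6" using c6[OF e] by simp
  qed
  finally show ?thesis by simp
qed

definition rest :: "('a \<Rightarrow> 'a \<Rightarrow> 'a \<Rightarrow> bool) \<Rightarrow> 'a set set \<Rightarrow> 'a \<Rightarrow> 'a \<Rightarrow> 'a \<Rightarrow> bool" where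
  "rest h E x y z \<longleftrightarrow> h x y z \<and> {x, y, z} \<notin> E"

lemma (in c5_free) rest: "c5_free V (rest h E)"
proof (rule subgraph)
  show "sym3 (rest h E)"
    using sym unfolding sym3_def rest_def by (metis insert_commute)
qed (use edge in \<open>auto simp: rest_def\<close>)

text \<open>Stated for a single \<open>\<epsilon>\<close>, so that finitely many passages from
  \<open>4 * \<epsilon>\<close> to \<open>\<epsilon>\<close>, beginning with a value of at least 1,
  replace a recursion down to small parts.\<close>

definition stable :: "'a itself \<Rightarrow> real \<Rightarrow> bool" where
  "stable _ \<epsilon> \<longleftrightarrow> (\<exists>\<delta> N. 0 < \<delta> \<and> (\<forall>V (h :: 'a \<Rightarrow> 'a \<Rightarrow> 'a \<Rightarrow> bool). c5_free V h \<and> N \<le> real (card V) \<and>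
     (1 / 4 - \<delta>) * real (card V) ^ 3 \<le> T h V \<longrightarrow>
     (\<exists>E. T_rec_construction V E \<and> T (rest h E) V \<le> \<epsilon> * real (card V) ^ 3)))"

lemma stable_ge_1:
  assumes "1 \<le> \<epsilon>"
  shows "stable TYPE('a) \<epsilon>"
proof -
  have "\<exists>E. T_rec_construction V E \<and> T (rest h E) V \<le> \<epsilon> * real (card V) ^ 3"
    if c: "c5_free V h" for V and h :: "'a \<Rightarrow> 'a \<Rightarrow> 'a \<Rightarrow> bool"
  proof -
    obtain E where E: "T_rec_construction V E" using ex_T_rec_construction[OF c5_free.finite_V[OF c]] by blast
    have "T (rest h E) V \<le> real (card V) ^ 3"
      using c5_free.N3_le[OF c5_free.rest[OF c], of E V V V] by (simp add: power3_eq_cube)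
    also have "\<dots> \<le> \<epsilon> * real (card V) ^ 3" using mult_right_mono[OF assms, of "real (card V) ^ 3"] by simp
    finally show ?thesis using E by blast
  qed
  then show ?thesis unfolding stable_def by (auto intro!: exI[of _ 1])
qed

text \<open>The error contracts under one level of the recursion, since a part has at most 0.392 n vertices and
  4 * 0.392\<open>\<^sup>2\<close> < 1.\<close>

lemma stable_quarter:
  assumes \<epsilon>: "0 < \<epsilon>" and st: "stable TYPE('a) (4 * \<epsilon>)"
  shows "stable TYPE('a) \<epsilon>"
proof -
  from st obtain \<delta>' N' where \<delta>': "0 < \<delta>'" and N': "\<And>V (h :: 'a \<Rightarrow> 'a \<Rightarrow> 'a \<Rightarrow> bool). c5_free V h \<Longrightarrow> N' \<le> real (card V) \<Longrightarrow>
     (1 / 4 - \<delta>') * real (card V) ^ 3 \<le> T h V \<Longrightarrow>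
     \<exists>E. T_rec_construction V E \<and> T (rest h E) V \<le> 4 * \<epsilon> * real (card V) ^ 3"
    unfolding stable_def by blast
  \<comment> \<open>The second bound makes the deficit of a part small relative to its own size: a
    part has at least 0.304 n vertices and 0.304^3 > 0.028.\<close>
  define \<xi> where "\<xi> = min (\<epsilon> / 4) (\<delta>' * (28 / 1000))"
  have \<xi>: "0 < \<xi>" "\<xi> \<le> \<epsilon> / 4" "\<xi> \<le> \<delta>' * (28 / 1000)" using \<epsilon> \<delta>' by (auto simp: \<xi>_def)
  obtain \<delta> N where \<delta>: "0 < \<delta>" and N: "\<And>V (h :: 'a \<Rightarrow> 'a \<Rightarrow> 'a \<Rightarrow> bool). c5_free V h \<Longrightarrow> N \<le> real (card V) \<Longrightarrow>
      (1 / 4 - \<delta>) * real (card V) ^ 3 \<le> T h V \<Longrightarrow>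
      \<exists>P1 P2 P3. P1 \<union> P2 \<union> P3 = V \<and> P1 \<inter> P2 = {} \<and> P1 \<inter> P3 = {} \<and> P2 \<inter> P3 = {} \<and>
        (\<forall>P\<in>{P1, P2, P3}. 304 / 1000 * real (card V) \<le> real (card P) \<and>
           1 / 4 * real (card P) ^ 3 - \<xi> * real (card V) ^ 3 \<le> T h P) \<and>
        T h V - T h P1 - T h P2 - T h P3 - 6 * c5_free.N3 h P1 P2 P3 \<le> \<xi> * real (card V) ^ 3"
    by (rule stability_step[OF \<xi>(1)]) blast
  have "\<exists>E. T_rec_construction V E \<and> T (rest h E) V \<le> \<epsilon> * real (card V) ^ 3"
    if c: "c5_free V h" and n: "max 1 (max N (4 * N')) \<le> real (card V)" and T: "(1 / 4 - \<delta>) * real (card V) ^ 3 \<le> T h V"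
    for V and h :: "'a \<Rightarrow> 'a \<Rightarrow> 'a \<Rightarrow> bool"
  proof -
    interpret c5_free V h by (rule c)
    have n': "1 \<le> n" "N \<le> n" "4 * N' \<le> n" using n by auto
    obtain P1 P2 P3 where P: "P1 \<union> P2 \<union> P3 = V" "P1 \<inter> P2 = {}" "P1 \<inter> P3 = {}" "P2 \<inter> P3 = {}"
      and part: "\<And>P. P \<in> {P1, P2, P3} \<Longrightarrow> 304 / 1000 * n \<le> real (card P) \<and> 1 / 4 * real (card P) ^ 3 - \<xi> * n ^ 3 \<le> N3 P P P"
      and bad: "N3 V V V - N3 P1 P1 P1 - N3 P2 P2 P2 - N3 P3 P3 P3 - 6 * N3 P1 P2 P3 \<le> \<xi> * n ^ 3"
      using N[OF c n'(2) T] by blast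
    have fin: "finite P1" "finite P2" "finite P3" using P(1) finite_V by auto
    have pqr: "n = real (card P1) + real (card P2) + real (card P3)"
      using fin P by (simp add: card_Un_disjoint Int_Un_distrib2 flip: P(1))
    have sub: "P \<subseteq> V" if "P \<in> {P1, P2, P3}" for P using P(1) that by auto
    have ex: "\<exists>E. T_rec_construction P E \<and> T (rest (restr P) E) P \<le> 4 * \<epsilon> * real (card P) ^ 3" if PP: "P \<in> {P1, P2, P3}" for P
    proof (rule N'[OF restr[OF sub[OF PP]]])
      show "N' \<le> real (card P)" using part[OF PP] n'(1,3) by argo
      have "(304 / 1000 * n) ^ 3 \<le> real (card P) ^ 3" using part[OF PP] by (intro power_mono) auto
      then have "28 / 1000 * n ^ 3 \<le> real (card P) ^ 3"
      proof -
        have "(304 / 1000 * n) ^ 3 = 28094464 / 1000000000 * n ^ 3" by (simp add: power3_eq_cube)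
        moreover have "0 \<le> n ^ 3" by simp
        ultimately show ?thesis using \<open>(304 / 1000 * n) ^ 3 \<le> real (card P) ^ 3\<close> by linarith
      qed
      then have "\<delta>' * (28 / 1000 * n ^ 3) \<le> \<delta>' * real (card P) ^ 3" using \<delta>' by (intro mult_left_mono) auto
      moreover have "\<xi> * n ^ 3 \<le> \<delta>' * (28 / 1000) * n ^ 3" using \<xi>(3) by (intro mult_right_mono) auto
      ultimately have "\<xi> * n ^ 3 \<le> \<delta>' * real (card P) ^ 3" by (simp only: mult.assoc)
      then show "(1 / 4 - \<delta>') * real (card P) ^ 3 \<le> T (restr P) P"
        using part[OF PP] N3_restr[OF sub[OF PP]] by (simp add: left_diff_distrib)
    qed
    obtain E1 where E1: "T_rec_construction P1 E1" "T (rest (restr P1) E1) P1 \<le> 4 * \<epsilon> * real (card P1) ^ 3" using ex[of P1] by auto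
    obtain E2 where E2: "T_rec_construction P2 E2" "T (rest (restr P2) E2) P2 \<le> 4 * \<epsilon> * real (card P2) ^ 3" using ex[of P2] by auto
    obtain E3 where E3: "T_rec_construction P3 E3" "T (rest (restr P3) E3) P3 \<le> 4 * \<epsilon> * real (card P3) ^ 3" using ex[of P3] by auto
    define E where "E = complete_3partite P1 P2 P3 \<union> E1 \<union> E2 \<union> E3"
    have EE: "E1 \<subseteq> E" "E2 \<subseteq> E" "E3 \<subseteq> E" by (auto simp: E_def)
    have ne: "P \<noteq> {}" if "P \<in> {P1, P2, P3}" for P
    proof
      assume "P = {}"
      then have "304 / 1000 * n \<le> 0" using part[OF that] by simp
      then show False using n'(1) by linarith
    qed
    have TE: "T_rec_construction V E"
      unfolding E_def P(1)[symmetric] by (rule T_rec_construction.step) (use ne P E1 E2 E3 in auto)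
    interpret r: c5_free V "rest h E" by (rule rest)
    have mono: "r.N3 A B C \<le> N3 A B C" for A B C
      unfolding r.N3_def N3_def by (intro sum_mono) (simp add: rest_def)
    have le: "r.N3 P P P \<le> T (rest (restr P) E') P" if "P \<in> {P1, P2, P3}" "E' \<subseteq> E" for P E'
    proof -
      interpret q: c5_free P "rest (restr P) E'" by (rule c5_free.rest[OF restr[OF sub[OF that(1)]]])
      show ?thesis
        unfolding r.N3_def q.N3_def by (intro sum_mono) (use that(2) in \<open>auto simp: rest_def restr_def\<close>)
    qed
    \<comment> \<open>So an edge outside \<open>E\<close> lies inside a part, where recursion
      applies, or has exactly two vertices in some part, and \<open>bad\<close> bounds the latter
      kind.\<close>
    have cross: "r.N3 P1 P2 P3 = 0"
      unfolding r.N3_def by (intro sum.neutral ballI) (auto simp: rest_def E_def complete_3partite_def)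
    have "r.N3 V V V = r.N3 P1 P1 P1 + r.N3 P2 P2 P2 + r.N3 P3 P3 P3 + 6 * r.N3 P1 P2 P3
      + 3 * (r.N3 P1 P2 P2 + r.N3 P1 P3 P3) + 3 * (r.N3 P2 P1 P1 + r.N3 P2 P3 P3) + 3 * (r.N3 P3 P1 P1 + r.N3 P3 P2 P2)"
      using r.N3_cube_Un3[OF fin P(2-4)] unfolding P(1) .
    moreover have "N3 V V V = N3 P1 P1 P1 + N3 P2 P2 P2 + N3 P3 P3 P3 + 6 * N3 P1 P2 P3
      + 3 * (N3 P1 P2 P2 + N3 P1 P3 P3) + 3 * (N3 P2 P1 P1 + N3 P2 P3 P3) + 3 * (N3 P3 P1 P1 + N3 P3 P2 P2)"
      using N3_cube_Un3[OF fin P(2-4)] unfolding P(1) .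
    moreover have "r.N3 P1 P1 P1 \<le> 4 * \<epsilon> * real (card P1) ^ 3" "r.N3 P2 P2 P2 \<le> 4 * \<epsilon> * real (card P2) ^ 3"
      "r.N3 P3 P3 P3 \<le> 4 * \<epsilon> * real (card P3) ^ 3"
      using le[OF _ EE(1), of P1] le[OF _ EE(2), of P2] le[OF _ EE(3), of P3] E1(2) E2(2) E3(2) by fastforce+
    moreover note mono[of P1 P2 P2] mono[of P1 P3 P3] mono[of P2 P1 P1] mono[of P2 P3 P3] mono[of P3 P1 P1] mono[of P3 P2 P2]
    ultimately have "r.N3 V V V \<le> 4 * \<epsilon> * real (card P1) ^ 3 + 4 * \<epsilon> * real (card P2) ^ 3 + 4 * \<epsilon> * real (card P3) ^ 3 + \<xi> * n ^ 3"
      using bad cross by argo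
    also have "\<dots> \<le> 4 * \<epsilon> * (154 / 1000 * n ^ 3) + \<xi> * n ^ 3"
    proof -
      have cube: "x ^ 3 \<le> 154 / 1000 * n ^ 2 * x" if "0 \<le> x" "x \<le> 392 / 1000 * n" for x
      proof -
        have "x ^ 2 \<le> (392 / 1000 * n) ^ 2" using that by (intro power_mono)
        also have "\<dots> \<le> 154 / 1000 * n ^ 2" by (simp add: power2_eq_square)
        finally have "x ^ 2 * x \<le> 154 / 1000 * n ^ 2 * x" using that by (intro mult_right_mono)
        then show ?thesis by (simp add: power3_eq_cube power2_eq_square)
      qed
      have "real (card P) \<le> 392 / 1000 * n" if "P \<in> {P1, P2, P3}" for P
        using part[of P1] part[of P2] part[of P3] pqr that by auto
      then have "real (card P1) ^ 3 + real (card P2) ^ 3 + real (card P3) ^ 3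
          \<le> 154 / 1000 * n ^ 2 * real (card P1) + 154 / 1000 * n ^ 2 * real (card P2) + 154 / 1000 * n ^ 2 * real (card P3)"
        by (intro add_mono cube) auto
      also have "\<dots> = 154 / 1000 * n ^ 2 * (real (card P1) + real (card P2) + real (card P3))"
        by (simp only: distrib_left)
      also have "\<dots> = 154 / 1000 * n ^ 3"
        unfolding pqr[symmetric] by (simp add: power2_eq_square power3_eq_cube)
      finally have "4 * \<epsilon> * (real (card P1) ^ 3 + real (card P2) ^ 3 + real (card P3) ^ 3) \<le> 4 * \<epsilon> * (154 / 1000 * n ^ 3)"
        using \<epsilon> by (intro mult_left_mono) auto
      then show ?thesis by (simp only: distrib_left)
    qed
    also have "\<dots> \<le> 4 * \<epsilon> * (154 / 1000 * n ^ 3) + \<epsilon> / 4 * n ^ 3"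
      using \<xi>(2) by (intro add_left_mono mult_right_mono) auto
    \<comment> \<open>4 * 0.154 + 1/4 = 0.866 < 1, with 0.154 > 0.392^2.\<close>
    also have "\<dots> \<le> \<epsilon> * n ^ 3"
    proof -
      have "0 \<le> \<epsilon> * n ^ 3" using \<epsilon> by simp
      then show ?thesis by simp
    qed
    finally show ?thesis using TE by blast
  qed
  then show ?thesis unfolding stable_def using \<delta> by (intro exI[of _ \<delta>] exI[of _ "max 1 (max N (4 * N'))"]) blast
qed

lemma stable:
  assumes "0 < \<epsilon>"
  shows "stable TYPE('a) \<epsilon>"
proof -
  obtain k :: nat where "1 / \<epsilon> < 4 ^ k" using real_arch_pow[of 4 "1 / \<epsilon>"] by auto
  then have "1 \<le> 4 ^ k * \<epsilon>" using assms by (simp add: field_simps)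
  then have "stable TYPE('a) (4 ^ k * \<epsilon>)" by (rule stable_ge_1)
  then show ?thesis
  proof (induction k)
    case (Suc k)
    have "stable TYPE('a) (4 ^ k * \<epsilon>)"
      by (rule stable_quarter) (use Suc.prems assms in \<open>simp_all add: mult.assoc\<close>)
    then show ?case by (rule Suc.IH)
  qed simp
qed

section \<open>Translation from set systems\<close>

lemma three_graph_c5_free:
  assumes g: "three_graph V E" and fr: "C5_minus_free V E"
  shows "c5_free V (\<lambda>x y z. {x, y, z} \<in> E)"
proof
  show "finite V" using g by (simp add: three_graph_def)
  show "sym3 (\<lambda>x y z. {x, y, z} \<in> E)"
    unfolding sym3_def by (metis insert_commute)
  show "a \<in> V \<and> b \<in> V \<and> c \<in> V \<and> a \<noteq> b \<and> a \<noteq> c \<and> b \<noteq> c" if "{a, b, c} \<in> E" for a b c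
  proof -
    have "{a, b, c} \<subseteq> V" "card {a, b, c} = 3" using g that by (auto simp: three_graph_def)
    then show ?thesis by (auto simp: card_insert_if split: if_splits)
  qed
  show "\<not> ({a, b, c} \<in> E \<and> {b, c, d} \<in> E \<and> {c, d, e} \<in> E \<and> {d, e, a} \<in> E)" if di: "distinct [a, b, c, d, e]" for a b c d e
  proof
    assume ed: "{a, b, c} \<in> E \<and> {b, c, d} \<in> E \<and> {c, d, e} \<in> E \<and> {d, e, a} \<in> E"
    define f :: "nat \<Rightarrow> 'a" where "f = (\<lambda>i. if i = 1 then a else if i = 2 then b else if i = 3 then c else if i = 4 then d else e)"
    have s5: "{1..5 :: nat} = {1, 2, 3, 4, 5}" by auto
    have "inj_on f {1..5}" unfolding s5 f_def using di by (auto simp: inj_on_def)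
    moreover have "f ` {1..5} \<subseteq> V"
      unfolding s5 f_def using ed g by (auto simp: three_graph_def)
    moreover have "\<forall>e\<in>C5_minus_edges. f ` e \<in> E"
      unfolding C5_minus_edges_def f_def using ed by (simp add: insert_commute)
    ultimately have "contains_copy {1..5} C5_minus_edges V E" unfolding contains_copy_def by blast
    with fr show False by (simp add: C5_minus_free_def)
  qed
qed

lemma choose_3_ge: "real (m choose 3) \<ge> (real m ^ 3 - 3 * real m ^ 2) / 6"
proof (cases "m < 3")
  case True
  have "real m ^ 3 - 3 * real m ^ 2 = real m ^ 2 * (real m - 3)" by (simp add: power2_eq_square power3_eq_cube algebra_simps)
  also have "\<dots> \<le> 0" using True by (intro mult_nonneg_nonpos) auto
  finally show ?thesis by (smt (verit) of_nat_0_le_iff divide_nonpos_pos)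
next
  case False
  have "real (m choose 3) = real m * (real m - 1) * (real m - 2) / 6"
    unfolding binomial_gbinomial by (simp add: gbinomial_prod_rev numeral_3_eq_3 fact_numeral)
  then show ?thesis by (simp add: power2_eq_square power3_eq_cube algebra_simps)
qed

theorem theorem1p2:
  shows "\<forall>\<epsilon>::real. \<epsilon> > 0 \<longrightarrow> (\<exists>\<delta>::real. \<delta> > 0 \<and> (\<exists>N0::nat. \<forall>n\<ge>N0.
    \<forall>(V :: 'a set) E.
      three_graph V E \<and> card V = n \<and> C5_minus_free V E \<and>
      real (card E) \<ge> 1 / 4 * real (n choose 3) - \<delta> * real n ^ 3
      \<longrightarrow> (\<exists>R \<subseteq> E. real (card R) \<le> \<epsilon> * real n ^ 3 \<and> T_rec_subconstruction V (E - R))))"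
proof (intro allI impI)
  fix \<epsilon> :: real assume "0 < \<epsilon>"
  then obtain \<delta>' N where \<delta>': "0 < \<delta>'" and st: "\<And>V (h :: 'a \<Rightarrow> 'a \<Rightarrow> 'a \<Rightarrow> bool). c5_free V h \<Longrightarrow> N \<le> real (card V) \<Longrightarrow>
     (1 / 4 - \<delta>') * real (card V) ^ 3 \<le> T h V \<Longrightarrow> \<exists>E. T_rec_construction V E \<and> T (rest h E) V \<le> \<epsilon> * real (card V) ^ 3"
    using stable[of \<epsilon>] unfolding stable_def by blast
  \<comment> \<open>Replacing the binomial coefficient by n^3/6 costs 3n^2/4 ordered edges, at most
    \<delta>' n^3/2 once n \<ge> 3/(2 \<delta>'). The tolerance \<open>\<delta>' / 12\<close> costs
    another \<delta>' n^3/2, as each edge is counted six times.\<close>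
  define N0 where "N0 = nat \<lceil>max N (3 / (2 * \<delta>'))\<rceil>"
  show "\<exists>\<delta>::real. \<delta> > 0 \<and> (\<exists>N0::nat. \<forall>n\<ge>N0. \<forall>(V :: 'a set) E.
      three_graph V E \<and> card V = n \<and> C5_minus_free V E \<and>
      real (card E) \<ge> 1 / 4 * real (n choose 3) - \<delta> * real n ^ 3
      \<longrightarrow> (\<exists>R \<subseteq> E. real (card R) \<le> \<epsilon> * real n ^ 3 \<and> T_rec_subconstruction V (E - R)))"
  proof (intro exI[of _ "\<delta>' / 12"] conjI exI[of _ N0] allI impI)
    show "0 < \<delta>' / 12" using \<delta>' by simp
    fix n V and E :: "'a set set"
    assume n: "N0 \<le> n" and "three_graph V E \<and> card V = n \<and> C5_minus_free V E \<and>
      1 / 4 * real (n choose 3) - \<delta>' / 12 * real n ^ 3 \<le> real (card E)"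
    then have g: "three_graph V E" and c: "card V = n" and fr: "C5_minus_free V E"
      and dn: "1 / 4 * real (n choose 3) - \<delta>' / 12 * real n ^ 3 \<le> real (card E)" by auto
    define h where "h = (\<lambda>x y z. {x, y, z} \<in> E)"
    have cf: "c5_free V h" unfolding h_def by (rule three_graph_c5_free[OF g fr])
    have fV: "finite V" and E3: "\<And>e. e \<in> E \<Longrightarrow> e \<subseteq> V \<and> card e = 3" using g by (auto simp: three_graph_def)
    have TE: "T h V = 6 * real (card E)"
      unfolding c5_free.N3_def[OF cf] unfolding h_def by (rule card_ordered_triples[OF fV E3])
    have n': "N \<le> real n" "3 / (2 * \<delta>') \<le> real n" using n unfolding N0_def by linarith+
    have "(1 / 4 - \<delta>') * real n ^ 3 \<le> 6 * real (card E)"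
    proof -
      have "3 \<le> real n * (2 * \<delta>')" using n'(2) \<delta>' by (simp add: pos_divide_le_eq)
      then have "3 * real n ^ 2 \<le> real n * (2 * \<delta>') * real n ^ 2" by (intro mult_right_mono) auto
      also have "\<dots> = 2 * (\<delta>' * real n ^ 3)" by (simp add: power2_eq_square power3_eq_cube)
      finally have "3 * real n ^ 2 \<le> 2 * (\<delta>' * real n ^ 3)" .
      moreover have "(1 / 4 - \<delta>') * real n ^ 3 = real n ^ 3 / 4 - \<delta>' * real n ^ 3" by (simp add: left_diff_distrib)
      moreover have "\<delta>' / 12 * real n ^ 3 = (\<delta>' * real n ^ 3) / 12" by simp
      ultimately show ?thesis using dn choose_3_ge[of n] by argo
    qed
    then obtain E' where E': "T_rec_construction V E'" and le: "T (rest h E') V \<le> \<epsilon> * real n ^ 3"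
      using st[OF cf] n'(1) c TE by auto
    define R where "R = E - E'"
    have "T (rest h E') V = 6 * real (card R)"
      unfolding c5_free.N3_def[OF c5_free.rest[OF cf]] unfolding rest_def h_def
      using card_ordered_triples[OF fV, of R] E3 by (simp add: R_def)
    then have "real (card R) \<le> \<epsilon> * real n ^ 3" using le of_nat_0_le_iff[of "card R"] by linarith
    moreover have "R \<subseteq> E" by (auto simp: R_def)
    moreover have "T_rec_subconstruction V (E - R)"
      unfolding T_rec_subconstruction_def using E' by (intro exI[of _ E']) (auto simp: R_def)
    ultimately show "\<exists>R \<subseteq> E. real (card R) \<le> \<epsilon> * real n ^ 3 \<and> T_rec_subconstruction V (E - R)" by blast
  qed
qed

end
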